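(* Let $f:\mathbb R\to\mathbb R$ be a smooth function such that $f$ and $f_u$ are linearly independent over $\mathbb R$. For all integers $d$ the linear map $V_d\to\bar H^1_{\mathbb C}$, $P\mapsto[\varphi_P]$, is injective.
   Context: Subscripts such as $f_u$, $P_{u_i}$ denote partial derivatives; bars denote complex conjugation. For $k\ge 0$ let $M^{(k)}=\mathbb C^{k+2}\times\mathbb R$ with complex coordinates $z,u_0,\dots,u_k$ and real coordinate $u$. Let $M^{(\infty)}$ be the inverse limit of the projections $M^{(k+1)}\to M^{(k)}$ forgetting $u_{k+1}$; smooth functions and differential forms on $M^{(\infty)}$ are by definition pullbacks of such objects from some $M^{(k)}$. Put $T^0=f(u)$, $T^{i+1}=\sum_{j=0}^{i}\binom ij u_{i-j}\,T^j_u$, and $\zeta=dz$, $\eta_0=du-u_0\zeta-\bar u_0\bar\zeta$, $\omega_{i+1}=du_i+T^i\bar\zeta$, $\eta_{i+1}=\omega_{i+1}-u_{i+1}\zeta$ ($i\ge0$), $\psi=\operatorname{Im}(\zeta\wedge\omega_1)$. Let $e_{-1}=\partial_z+u_0\partial_u+\sum_{i\ge0}u_{i+1}\partial_{u_i}-\sum_{i\ge0}\overline{T^i}\,\partial_{\bar u_i}$ and $e_{\overline{-1}}=\overline{e_{-1}}$. Let $J$ be the complex-linear operator on $1$-forms acting as $\sqrt{-1}$ on $\zeta,\eta_1,\eta_2,\dots$, as $-\sqrt{-1}$ on $\bar\zeta,\bar\eta_1,\bar\eta_2,\dots$, and as the identity on $\eta_0$. Let $\mathcal I_{\mathbb C}$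 be the differential ideal of complex forms on $M^{(\infty)}$ generated by $\eta_0,\eta_i,\bar\eta_i$ ($i\ge1$). $\bar H^1_{\mathbb C}$ is the degree $1$ cohomology of the complex $\Omega^*(M^{(\infty)},\mathbb C)/\mathcal I_{\mathbb C}$ with the differential induced by $d$. For $|\lambda|=1$ let $F_\lambda(u,z,u_j)=(u,\lambda^{-1}z,\lambda^{j+1}u_j)$; a complex function or form $\varphi$ has weighted degree $d\in\mathbb Z$ if $F_\lambda^*\varphi=\lambda^d\varphi$ for all such $\lambda$. $V_d$ is the complex vector space of complex-valued functions $P$ on $M^{(\infty)}$ of weighted degree $d$ satisfying $e_{\overline{-1}}e_{-1}P+f_uP=0$, $P_u=0$ and $P_{u_i\bar u_j}=0$ for all $i,j\ge0$. One has $V_0=\mathbb C\cdot q$ with $q=zu_0-\bar z\bar u_0$. For a complex function $P$ put $B^{ij}(P)=\sqrt{-1}\sum_{m\ge0}(-1)^{m-i+1}\binom{m+i-1}{i-1}(e_{-1})^mP_{u_{m+i+j-1}}$ (a finite sum) and $\Phi_P=-\tfrac12\eta_0\wedge J\,dP+P\psi+\sum_{1\le i<j}\big(B^{ij}(P)\,\eta_i\wedge\eta_j+\overline{B^{ij}(\bar P)}\,\bar\eta_i\wedge\bar\eta_j\big)$. Let $v=\frac{d}{dt}\big|_{t=0}F_{e^{\sqrt{-1}t}}$. For $P\in V_d$ with $d\ne0$ put $\varphi_P=\frac{1}{\sqrt{-1}\,d}\,(v\lrcorner\Phi_P)$. For $d=0$ let $\varphi_0=G\eta_0+E\zeta+\bar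 E\bar\zeta$ with $G=-\frac12(zu_0+\bar z\bar u_0)$, $E=-\frac12zu_0^2+\bar z\int f\,du$ (a fixed antiderivative of $f$), and put $\varphi_{cq}=-\sqrt{-1}\,c\,\varphi_0$ for $c\in\mathbb C$.
   Formalization: The fact V_0 = C·q is an explicit hypothesis; it fails for affine f (e.g. f(u)=u, where f, f_u are independent), and there P = z u_2 + 2u_1 + z̄u_0 in V_2 is nonzero with [φ_P] = 0, so the claim without it is false. *)

theory Defs
  imports "HOL-Analysis.Analysis" "HOL-Library.Function_Algebras"
begin

instantiation "fun" :: (type, real_vector) real_vector
begin

definition scaleR_fun :: "real \<Rightarrow> ('a \<Rightarrow> 'b) \<Rightarrow> 'a \<Rightarrow> 'b"
  where "scaleR_fun r g = (\<lambda>x. r *\<^sub>R g x)"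

instance
  by standard (auto simp: scaleR_fun_def fun_eq_iff algebra_simps)

end

section \<open>Functions on the infinite jet space\<close>

text \<open>
  A point of the inverse limit is a triple \<open>(z, u, (u\<^sub>0, u\<^sub>1, \<dots>))\<close>.  It carries the product
  topology; a function of finitely many coordinates is continuous for it iff it is continuous in
  these coordinates.  The limit is a real vector space and is identified with its tangent spaces.
\<close>

type_synonym jet = "complex \<times> real \<times> (nat \<Rightarrow> complex)"

abbreviation zc :: "jet \<Rightarrow> complex" where "zc p \<equiv> fst p"
abbreviation uc :: "jet \<Rightarrow> real" where "uc p \<equiv> fst (snd p)"
abbreviation uj :: "nat \<Rightarrow> jet \<Rightarrow> complex" where "uj i p \<equiv> snd (snd p) i"

text \<open>\<open>p\<close> and \<open>p'\<close> have the same projection to \<open>M\<^sup>(\<^sup>k\<^sup>)\<close>.\<close>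
definition same_proj :: "nat \<Rightarrow> jet \<Rightarrow> jet \<Rightarrow> bool" where
  "same_proj k p p' \<longleftrightarrow> zc p = zc p' \<and> uc p = uc p' \<and> (\<forall>i\<le>k. uj i p = uj i p')"

definition dird :: "jet \<Rightarrow> (jet \<Rightarrow> complex) \<Rightarrow> jet \<Rightarrow> complex" where
  "dird v F p = vector_derivative (\<lambda>t. F (p + t *\<^sub>R v)) (at 0)"

text \<open>Existence and continuity of all iterated directional derivatives up to order \<open>n\<close>.\<close>
primrec Ck :: "nat \<Rightarrow> (jet \<Rightarrow> complex) \<Rightarrow> bool" where
  "Ck 0 F \<longleftrightarrow> continuous_on UNIV F"
| "Ck (Suc n) F \<longleftrightarrow> continuous_on UNIV F \<and>
     (\<forall>v. (\<forall>p. (\<lambda>t. F (p + t *\<^sub>R v)) differentiable (at (0::real))) \<and> Ck n (dird v F))"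

text \<open>Smooth complex functions: pullbacks of smooth functions from some \<open>M\<^sup>(\<^sup>k\<^sup>)\<close>.\<close>
definition Omega0 :: "(jet \<Rightarrow> complex) set" where
  "Omega0 = {F. (\<exists>k. \<forall>p p'. same_proj k p p' \<longrightarrow> F p = F p') \<and> (\<forall>n. Ck n F)}"

definition d_z :: "(jet \<Rightarrow> complex) \<Rightarrow> jet \<Rightarrow> complex" where
  "d_z F p = (dird (1, 0, 0) F p - \<i> * dird (\<i>, 0, 0) F p) / 2"

definition d_u :: "(jet \<Rightarrow> complex) \<Rightarrow> jet \<Rightarrow> complex" where
  "d_u F p = dird (0, 1, 0) F p"

definition d_uj :: "nat \<Rightarrow> (jet \<Rightarrow> complex) \<Rightarrow> jet \<Rightarrow> complex" where
  "d_uj i F p = (dird (0, 0, 0(i := 1)) F p - \<i> * dird (0, 0, 0(i := \<i>)) F p) / 2"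

definition d_ujbar :: "nat \<Rightarrow> (jet \<Rightarrow> complex) \<Rightarrow> jet \<Rightarrow> complex" where
  "d_ujbar i F p = (dird (0, 0, 0(i := 1)) F p + \<i> * dird (0, 0, 0(i := \<i>)) F p) / 2"

fun jetT :: "(real \<Rightarrow> real) \<Rightarrow> nat \<Rightarrow> jet \<Rightarrow> complex" where
  "jetT f 0 = (\<lambda>p. of_real (f (uc p)))"
| "jetT f (Suc i) = (\<lambda>p. \<Sum>j\<le>i. of_nat (i choose j) * uj (i - j) p * d_u (jetT f j) p)"

text \<open>The vector fields \<open>e\<^sub>-\<^sub>1\<close> and its conjugate, as derivations.  On a function of finitely many
  coordinates the series has only finitely many nonzero terms.\<close>
definition e_m1 :: "(real \<Rightarrow> real) \<Rightarrow> (jet \<Rightarrow> complex) \<Rightarrow> jet \<Rightarrow> complex" where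
  "e_m1 f F p = d_z F p + uj 0 p * d_u F p
     + (\<Sum>i. uj (Suc i) p * d_uj i F p) - (\<Sum>i. cnj (jetT f i p) * d_ujbar i F p)"

definition e_m1bar :: "(real \<Rightarrow> real) \<Rightarrow> (jet \<Rightarrow> complex) \<Rightarrow> jet \<Rightarrow> complex" where
  "e_m1bar f F = cnj \<circ> e_m1 f (cnj \<circ> F)"

section \<open>Differential forms of low degree\<close>

text \<open>
  A complex 1-form assigns to a point a real-linear, complex-valued functional on tangent vectors,
  a complex 2-form assigns to it an alternating form.  Degrees 0, 1 and 2 are all that is needed
  for cohomology in degree 1.
\<close>

type_synonym form1 = "jet \<Rightarrow> jet \<Rightarrow> complex"
type_synonym form2 = "jet \<Rightarrow> jet \<Rightarrow> jet \<Rightarrow> complex"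

definition Omega1 :: "form1 set" where
  "Omega1 = {\<alpha>. (\<forall>p. linear (\<alpha> p)) \<and>
     (\<exists>k. \<forall>p p' v v'. same_proj k p p' \<longrightarrow> same_proj k v v' \<longrightarrow> \<alpha> p v = \<alpha> p' v') \<and>
     (\<forall>v n. Ck n (\<lambda>p. \<alpha> p v))}"

definition smult1 :: "(jet \<Rightarrow> complex) \<Rightarrow> form1 \<Rightarrow> form1" where
  "smult1 g \<alpha> = (\<lambda>p v. g p * \<alpha> p v)"

definition smult2 :: "(jet \<Rightarrow> complex) \<Rightarrow> form2 \<Rightarrow> form2" where
  "smult2 g \<Omega> = (\<lambda>p v w. g p * \<Omega> p v w)"

definition cnj1 :: "form1 \<Rightarrow> form1" where
  "cnj1 \<alpha> = (\<lambda>p v. cnj (\<alpha> p v))"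

definition wedge :: "form1 \<Rightarrow> form1 \<Rightarrow> form2" where
  "wedge \<alpha> \<beta> = (\<lambda>p v w. \<alpha> p v * \<beta> p w - \<alpha> p w * \<beta> p v)"

definition ext_d0 :: "(jet \<Rightarrow> complex) \<Rightarrow> form1" where
  "ext_d0 F = (\<lambda>p v. dird v F p)"

text \<open>Cartan's formula for the constant, hence commuting, vector fields \<open>v\<close> and \<open>w\<close>.\<close>
definition ext_d1 :: "form1 \<Rightarrow> form2" where
  "ext_d1 \<alpha> = (\<lambda>p v w. dird v (\<lambda>p'. \<alpha> p' w) p - dird w (\<lambda>p'. \<alpha> p' v) p)"

definition interior :: "(jet \<Rightarrow> jet) \<Rightarrow> form2 \<Rightarrow> form1" where
  "interior X \<Omega> = (\<lambda>p w. \<Omega> p (X p) w)"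

definition zeta :: form1 where
  "zeta p v = zc v"

text \<open>\<open>omega_Suc f i\<close> is \<open>\<omega>\<^sub>i\<^sub>+\<^sub>1\<close>.\<close>
definition omega_Suc :: "(real \<Rightarrow> real) \<Rightarrow> nat \<Rightarrow> form1" where
  "omega_Suc f i p v = uj i v + jetT f i p * cnj (zeta p v)"

primrec eta :: "(real \<Rightarrow> real) \<Rightarrow> nat \<Rightarrow> form1" where
  "eta f 0 = (\<lambda>p v. of_real (uc v) - uj 0 p * zeta p v - cnj (uj 0 p) * cnj (zeta p v))"
| "eta f (Suc i) = (\<lambda>p v. omega_Suc f i p v - uj (Suc i) p * zeta p v)"

definition psi :: "(real \<Rightarrow> real) \<Rightarrow> form2" where
  "psi f = (\<lambda>p v w. of_real (Im (wedge zeta (omega_Suc f 0) p v w)))"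

text \<open>
  \<open>J\<close> preserves real forms, so it is the transpose of the endomorphism \<open>J_vec\<close> of the real tangent
  space that multiplies the \<open>\<zeta>\<close>- and \<open>\<eta>\<^sub>i\<close>-components by the imaginary unit (\<open>i \<ge> 1\<close>) and fixes the
  \<open>\<eta>\<^sub>0\<close>-component.  The lemmas below give its values on the coframe.
\<close>
definition J_vec :: "(real \<Rightarrow> real) \<Rightarrow> jet \<Rightarrow> jet \<Rightarrow> jet" where
  "J_vec f p v =
     (\<i> * zc v,
      Re (eta f 0 p v + uj 0 p * (\<i> * zc v) + cnj (uj 0 p * (\<i> * zc v))),
      \<lambda>i. \<i> * eta f (Suc i) p v + uj (Suc i) p * (\<i> * zc v) - jetT f i p * cnj (\<i> * zc v))"

definition J_op :: "(real \<Rightarrow> real) \<Rightarrow> form1 \<Rightarrow> form1" where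
  "J_op f \<alpha> = (\<lambda>p v. \<alpha> p (J_vec f p v))"

lemma J_op_add: "J_op f (\<alpha> + \<beta>) = J_op f \<alpha> + J_op f \<beta>"
  by (simp add: J_op_def fun_eq_iff)

lemma J_op_smult: "J_op f (smult1 g \<alpha>) = smult1 g (J_op f \<alpha>)"
  by (simp add: J_op_def smult1_def)

lemma J_op_zeta: "J_op f zeta = smult1 (\<lambda>_. \<i>) zeta"
  by (simp add: J_op_def smult1_def zeta_def J_vec_def fun_eq_iff)

lemma J_op_eta_0: "J_op f (eta f 0) = eta f 0"
  by (auto simp: J_op_def zeta_def J_vec_def fun_eq_iff complex_eq_iff)

lemma J_op_eta_Suc: "J_op f (eta f (Suc i)) = smult1 (\<lambda>_. \<i>) (eta f (Suc i))"
  by (simp add: J_op_def smult1_def zeta_def omega_Suc_def J_vec_def fun_eq_iff algebra_simps)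

lemma J_op_cnj1: "J_op f (cnj1 \<alpha>) = cnj1 (J_op f \<alpha>)"
  by (simp add: J_op_def cnj1_def)

section \<open>Characteristic cohomology in degree 1\<close>

text \<open>
  The parts of degree 1 and 2 of the differential ideal generated by \<open>\<eta>\<^sub>0\<close>, \<open>\<eta>\<^sub>i\<close> and their conjugates.
  All generators have degree 1, so the part of degree 0 is zero.
\<close>

inductive_set ideal1 :: "(real \<Rightarrow> real) \<Rightarrow> form1 set" for f where
  eta: "eta f i \<in> ideal1 f"
| eta_cnj: "cnj1 (eta f i) \<in> ideal1 f"
| add: "\<alpha> \<in> ideal1 f \<Longrightarrow> \<beta> \<in> ideal1 f \<Longrightarrow> \<alpha> + \<beta> \<in> ideal1 f"
| smult: "g \<in> Omega0 \<Longrightarrow> \<alpha> \<in> ideal1 f \<Longrightarrow> smult1 g \<alpha> \<in> ideal1 f"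

inductive_set ideal2 :: "(real \<Rightarrow> real) \<Rightarrow> form2 set" for f where
  wedge: "\<beta> \<in> Omega1 \<Longrightarrow> \<alpha> \<in> ideal1 f \<Longrightarrow> wedge \<beta> \<alpha> \<in> ideal2 f"
| ext_d: "\<alpha> \<in> ideal1 f \<Longrightarrow> ext_d1 \<alpha> \<in> ideal2 f"
| add: "\<Phi> \<in> ideal2 f \<Longrightarrow> \<Psi> \<in> ideal2 f \<Longrightarrow> \<Phi> + \<Psi> \<in> ideal2 f"
| smult: "g \<in> Omega0 \<Longrightarrow> \<Phi> \<in> ideal2 f \<Longrightarrow> smult2 g \<Phi> \<in> ideal2 f"

text \<open>Representatives in \<open>\<Omega>\<^sup>1\<close> of the cocycles and coboundaries of the quotient complex.\<close>

definition Z1 :: "(real \<Rightarrow> real) \<Rightarrow> form1 set" where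
  "Z1 f = {\<alpha> \<in> Omega1. ext_d1 \<alpha> \<in> ideal2 f}"

definition B1 :: "(real \<Rightarrow> real) \<Rightarrow> form1 set" where
  "B1 f = {ext_d0 F + \<theta> | F \<theta>. F \<in> Omega0 \<and> \<theta> \<in> ideal1 f}"

definition cohomologous :: "(real \<Rightarrow> real) \<Rightarrow> (form1 \<times> form1) set" where
  "cohomologous f = {(\<alpha>, \<beta>). \<alpha> \<in> Z1 f \<and> \<beta> \<in> Z1 f \<and> \<beta> - \<alpha> \<in> B1 f}"

definition H1bar :: "(real \<Rightarrow> real) \<Rightarrow> form1 set set" where
  "H1bar f = Z1 f // cohomologous f"

definition H1_class :: "(real \<Rightarrow> real) \<Rightarrow> form1 \<Rightarrow> form1 set" where
  "H1_class f \<alpha> = cohomologous f `` {\<alpha>}"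

definition H1_add :: "(real \<Rightarrow> real) \<Rightarrow> form1 set \<Rightarrow> form1 set \<Rightarrow> form1 set" where
  "H1_add f X Y = (\<Union>\<alpha>\<in>X. \<Union>\<beta>\<in>Y. H1_class f (\<alpha> + \<beta>))"

definition H1_scale :: "(real \<Rightarrow> real) \<Rightarrow> complex \<Rightarrow> form1 set \<Rightarrow> form1 set" where
  "H1_scale f c X = (\<Union>\<alpha>\<in>X. H1_class f (smult1 (\<lambda>_. c) \<alpha>))"

section \<open>Normal forms of conservation laws\<close>

definition rot :: "complex \<Rightarrow> jet \<Rightarrow> jet" where
  "rot l p = (inverse l * zc p, uc p, \<lambda>j. l ^ (j + 1) * uj j p)"

definition weighted_degree :: "(jet \<Rightarrow> complex) \<Rightarrow> int \<Rightarrow> bool" where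
  "weighted_degree F d \<longleftrightarrow> (\<forall>l. cmod l = 1 \<longrightarrow> (\<forall>p. F (rot l p) = l powi d * F p))"

definition V_space :: "(real \<Rightarrow> real) \<Rightarrow> int \<Rightarrow> (jet \<Rightarrow> complex) set" where
  "V_space f d = {P \<in> Omega0. weighted_degree P d \<and>
     (\<forall>p. e_m1bar f (e_m1 f P) p + of_real (deriv f (uc p)) * P p = 0) \<and>
     (\<forall>p. d_u P p = 0) \<and>
     (\<forall>i j p. d_ujbar j (d_uj i P) p = 0)}"

definition q_fun :: "jet \<Rightarrow> complex" where
  "q_fun p = zc p * uj 0 p - cnj (zc p) * cnj (uj 0 p)"

text \<open>Used for \<open>i \<ge> 1\<close> and \<open>j \<ge> 1\<close> only; the series is a finite sum.\<close>
definition B_coeff :: "(real \<Rightarrow> real) \<Rightarrow> nat \<Rightarrow> nat \<Rightarrow> (jet \<Rightarrow> complex) \<Rightarrow> jet \<Rightarrow> complex" where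
  "B_coeff f i j P p = \<i> * (\<Sum>m. (- 1) powi (int m - int i + 1)
     * of_nat ((m + i - 1) choose (i - 1)) * (e_m1 f ^^ m) (d_uj (m + i + j - 1) P) p)"

text \<open>In the double sum \<open>B_coeff f i j\<close> vanishes on a given \<open>P\<close> for all large \<open>j\<close>.\<close>
definition Phi :: "(real \<Rightarrow> real) \<Rightarrow> (jet \<Rightarrow> complex) \<Rightarrow> form2" where
  "Phi f P = (\<lambda>p v w. - (1/2) * wedge (eta f 0) (J_op f (ext_d0 P)) p v w + P p * psi f p v w
     + (\<Sum>j. \<Sum>i\<in>{1..<j}. B_coeff f i j P p * wedge (eta f i) (eta f j) p v w
          + cnj (B_coeff f i j (cnj \<circ> P) p) * wedge (cnj1 (eta f i)) (cnj1 (eta f j)) p v w))"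

text \<open>The derivative of the rotation flow at time 0, taken coordinatewise.\<close>
definition v_rot :: "jet \<Rightarrow> jet" where
  "v_rot p = (vector_derivative (\<lambda>t. zc (rot (exp (\<i> * of_real t)) p)) (at 0),
              vector_derivative (\<lambda>t. uc (rot (exp (\<i> * of_real t)) p)) (at 0),
              \<lambda>j. vector_derivative (\<lambda>t. uj j (rot (exp (\<i> * of_real t)) p)) (at 0))"

text \<open>\<open>h\<close> is the chosen antiderivative of \<open>f\<close>.\<close>
definition phi0 :: "(real \<Rightarrow> real) \<Rightarrow> (real \<Rightarrow> real) \<Rightarrow> form1" where
  "phi0 f h =
     (let G = (\<lambda>p. - (1/2) * (zc p * uj 0 p + cnj (zc p) * cnj (uj 0 p)));
          E = (\<lambda>p. - (1/2) * zc p * (uj 0 p)^2 + cnj (zc p) * of_real (h (uc p)))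
      in smult1 G (eta f 0) + smult1 E zeta + smult1 (cnj \<circ> E) (cnj1 zeta))"

text \<open>For \<open>d = 0\<close> the definition applies to the multiples \<open>P = c q\<close>, \<open>c \<in> \<complex>\<close>; as \<open>q \<noteq> 0\<close>, \<open>P\<close>
  determines \<open>c\<close>.\<close>
definition phi :: "(real \<Rightarrow> real) \<Rightarrow> (real \<Rightarrow> real) \<Rightarrow> int \<Rightarrow> (jet \<Rightarrow> complex) \<Rightarrow> form1" where
  "phi f h d P =
     (if d = 0 then smult1 (\<lambda>_. - \<i> * (THE c. P = (\<lambda>p. c * q_fun p))) (phi0 f h)
      else smult1 (\<lambda>_. 1 / (\<i> * of_int d)) (interior v_rot (Phi f P)))"

end

theory Submission
  imports Defs
begin

text \<open>
  Modulo the ideal, \<open>\<phi>\<^sub>P\<close> is the Green current \<open>c ((q e P - P e q) \<zeta> - (q e' P - P e' q) \<zeta>')\<close> of the two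
  symmetries \<open>q\<close> and \<open>P\<close>, where \<open>e' = e_m1bar f\<close>, \<open>\<zeta>'\<close> is the conjugate of \<open>\<zeta>\<close> and \<open>c = 1 / (2 \<i> d)\<close>; it is
  closed since \<open>e e' = e' e\<close>. If its class vanishes, both coefficients are total derivatives of one
  function \<open>F\<close>. The Euler operator \<open>\<Sum>(-e)\<^sup>j \<partial>\<^sub>u\<^sub>j\<close> maps \<open>e F\<close> to \<open>F\<^sub>u\<close>, as does its conjugate for \<open>e' F\<close>, which
  gives an identity for \<open>P\<close> alone. The symmetry equation makes the leading coefficient of \<open>P\<close> in the
  \<open>u\<^sub>j\<close> a function of \<open>z\<close> only, and the identity forces it to vanish; the argument depends on whether \<open>1\<close>, \<open>f\<close>,
  \<open>f\<^sub>u\<close> are linearly independent or \<open>f\<^sub>u = \<alpha> + \<beta> f\<close> with \<open>\<alpha> \<beta> \<noteq> 0\<close>. For a linear \<open>f\<close> the space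
  \<open>V\<^sub>0\<close> contains more than the multiples of \<open>q\<close>, so this case is excluded.
\<close>

section \<open>Calculus on the jet space\<close>

text \<open>The obstacle is that \<open>f\<close> is nearly arbitrary, so an identity can be split
  only by varying \<open>u\<close>. This works because P_u = 0 and the mixed derivatives vanish:
  every \<open>d_uj j P\<close> and \<open>d_uj j (e P)\<close> is independent of \<open>u\<close>
  and of all conjugate jets (the class \<open>hol\<close>), so the coefficients T^i carry the whole
  \<open>u\<close>-dependence and freezing \<open>u\<close> at several values gives several linear
  relations. The conjugate half of \<open>P\<close> is reached by running the same argument for the
  conjugate of \<open>P\<close>, which is again a symmetry. The function \<open>q_fun\<close> enters
  as the \<open>eta f 0\<close>-component, up to the factor \<open>\<i>\<close>, of the rotation
  field that is contracted into \<open>Phi f P\<close>. Its Green current with itself is zero, so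
  weight 0 requires the separate form \<open>phi0\<close>. The same degeneracy shows at order 0: the
  Euler identity leaves exactly the leading coefficients C z, those of multiples of
  \<open>q_fun\<close>, and only the weight d \<noteq> 0 removes them. Independence of
  \<open>f\<close> and \<open>f\<^sub>u\<close> is used through a nonzero Wronskian-type
  determinant, which drives the computation of the kernel of \<open>e_m1bar f\<close> on
  \<open>hol\<close>.\<close>

declare split_paired_All [simp del] split_paired_Ex [simp del]

definition smooth :: "(jet \<Rightarrow> complex) \<Rightarrow> bool" where
  "smooth F \<longleftrightarrow> (\<forall>n. Ck n F)"

definition of_order :: "nat \<Rightarrow> (jet \<Rightarrow> complex) \<Rightarrow> bool" where
  "of_order k F \<longleftrightarrow> (\<forall>p p'. same_proj k p p' \<longrightarrow> F p = F p')"

lemma Omega0_iff: "F \<in> Omega0 \<longleftrightarrow> (\<exists>k. of_order k F) \<and> smooth F"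
  by (simp add: Omega0_def of_order_def smooth_def)

text \<open>Shifting the index of \<open>Ck\<close> by one turns the recursion into a fixed point
  equation, so that smoothness can be unfolded without mentioning an order.\<close>

lemma smooth_iff:
  "smooth F \<longleftrightarrow> continuous_on UNIV F \<and>
     (\<forall>v. (\<forall>p. (\<lambda>t. F (p + t *\<^sub>R v)) differentiable (at (0::real))) \<and> smooth (dird v F))"
proof
  assume F: "smooth F"
  have C: "Ck (Suc n) F" for n using F unfolding smooth_def by blast
  have "continuous_on UNIV F" using C[of 0] by simp
  moreover have "(\<lambda>t. F (p + t *\<^sub>R v)) differentiable (at (0::real))" for v p
    using C[of 0] by simp
  moreover have "smooth (dird v F)" for v using C by (simp add: smooth_def)
  ultimately show "continuous_on UNIV F \<and>
     (\<forall>v. (\<forall>p. (\<lambda>t. F (p + t *\<^sub>R v)) differentiable (at (0::real))) \<and> smooth (dird v F))" by blast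
next
  assume A: "continuous_on UNIV F \<and>
     (\<forall>v. (\<forall>p. (\<lambda>t. F (p + t *\<^sub>R v)) differentiable (at (0::real))) \<and> smooth (dird v F))"
  have "Ck n F" for n
    using A by (cases n) (auto simp: smooth_def)
  then show "smooth F" by (simp add: smooth_def)
qed

lemma smooth_dird: "smooth F \<Longrightarrow> smooth (dird v F)"
  using smooth_iff by blast

lemma smooth_continuous: "smooth F \<Longrightarrow> continuous_on UNIV F"
  using smooth_iff by blast

lemma smooth_line:
  assumes "smooth F"
  shows "((\<lambda>t. F (p + t *\<^sub>R v)) has_vector_derivative dird v F (p + t *\<^sub>R v)) (at t)"
proof -
  have "(\<lambda>s. F ((p + t *\<^sub>R v) + s *\<^sub>R v)) differentiable (at (0::real))"
    using assms smooth_iff by blast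
  then have "((\<lambda>s. F ((p + t *\<^sub>R v) + s *\<^sub>R v)) has_vector_derivative dird v F (p + t *\<^sub>R v)) (at 0)"
    by (simp add: dird_def vector_derivative_works)
  then have "((\<lambda>s. F ((p + t *\<^sub>R v) + s *\<^sub>R v)) has_vector_derivative dird v F (p + t *\<^sub>R v)) (at (t - t))"
    by simp
  moreover have "((\<lambda>s. s - t) has_vector_derivative 1) (at t)"
    by (auto intro!: derivative_eq_intros)
  ultimately have "((\<lambda>s. F ((p + t *\<^sub>R v) + s *\<^sub>R v)) \<circ> (\<lambda>s. s - t)
      has_vector_derivative 1 *\<^sub>R dird v F (p + t *\<^sub>R v)) (at t)"
    by (intro vector_diff_chain_at) auto
  then show ?thesis by (simp add: o_def algebra_simps)
qed

lemma dird_eqI: "((\<lambda>t. F (p + t *\<^sub>R v)) has_vector_derivative D) (at 0) \<Longrightarrow> dird v F p = D"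
  by (simp add: dird_def vector_derivative_at)

lemma dird_add:
  assumes "smooth F" "smooth G"
  shows "dird v (\<lambda>p. F p + G p) = (\<lambda>p. dird v F p + dird v G p)"
proof (rule ext, rule dird_eqI)
  fix p
  show "((\<lambda>t. F (p + t *\<^sub>R v) + G (p + t *\<^sub>R v)) has_vector_derivative
      dird v F p + dird v G p) (at 0)"
    using has_vector_derivative_add[OF smooth_line[OF assms(1), of p v 0] smooth_line[OF assms(2), of p v 0]]
    by simp
qed

lemma dird_mult:
  assumes "smooth F" "smooth G"
  shows "dird v (\<lambda>p. F p * G p) = (\<lambda>p. F p * dird v G p + dird v F p * G p)"
proof (rule ext, rule dird_eqI)
  fix p
  show "((\<lambda>t. F (p + t *\<^sub>R v) * G (p + t *\<^sub>R v)) has_vector_derivative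
      F p * dird v G p + dird v F p * G p) (at 0)"
    using has_vector_derivative_mult[OF smooth_line[OF assms(1), of p v 0] smooth_line[OF assms(2), of p v 0]]
    by simp
qed

lemma dird_const [simp]: "dird v (\<lambda>p. c) = (\<lambda>p. 0)"
  by (auto intro!: ext dird_eqI derivative_eq_intros)

lemma dird_cnj:
  assumes "smooth F"
  shows "dird v (\<lambda>p. cnj (F p)) = (\<lambda>p. cnj (dird v F p))"
proof (rule ext, rule dird_eqI)
  fix p
  show "((\<lambda>t. cnj (F (p + t *\<^sub>R v))) has_vector_derivative cnj (dird v F p)) (at 0)"
    using has_vector_derivative_cnj[OF smooth_line[OF assms(1), of p v 0]] by simp
qed

lemma Ck_const: "Ck n (\<lambda>p. c)"
  by (induction n arbitrary: c) auto

lemma smooth_const [simp]: "smooth (\<lambda>p. c)"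
  by (simp add: smooth_def Ck_const)

lemma differentiable_smooth:
  assumes "smooth F" shows "(\<lambda>t. F (p + t *\<^sub>R v)) differentiable (at (0::real))"
  using assms smooth_iff by blast

lemma smooth_add:
  assumes "smooth F" "smooth G" shows "smooth (\<lambda>p. F p + G p)"
proof -
  have "Ck n (\<lambda>p. F p + G p)" if "smooth F" "smooth G" for n F G
    using that
  proof (induction n arbitrary: F G)
    case 0
    then show ?case by (simp add: continuous_on_add smooth_continuous)
  next
    case (Suc n)
    then show ?case
      by (simp add: continuous_on_add smooth_continuous differentiable_smooth dird_add smooth_dird)
  qed
  then show ?thesis using assms by (simp add: smooth_def)
qed

lemma smooth_cnj:
  assumes "smooth F" shows "smooth (\<lambda>p. cnj (F p))"
proof -
  have "Ck n (\<lambda>p. cnj (F p))" if "smooth F" for n F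
    using that
  proof (induction n arbitrary: F)
    case 0
    then show ?case by (simp add: continuous_on_cnj smooth_continuous)
  next
    case (Suc n)
    then show ?case
      by (simp add: continuous_on_cnj smooth_continuous differentiable_smooth dird_cnj smooth_dird
          differentiable_cnj_iff)
  qed
  then show ?thesis using assms by (simp add: smooth_def)
qed

lemma smooth_mult:
  assumes "smooth F" "smooth G" shows "smooth (\<lambda>p. F p * G p)"
proof -
  have "\<forall>F G. smooth F \<longrightarrow> smooth G \<longrightarrow> Ck n (\<lambda>p. F p * G p)" for n
  proof (induction n)
    case 0
    then show ?case by (simp add: continuous_on_mult smooth_continuous)
  next
    case (Suc n)
    \<comment> \<open>The derivative of a product is a sum of two products that the induction
      hypothesis only knows to be \<open>Ck n\<close>; \<open>smooth_add\<close> does not apply to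
      them.\<close>
    have C: "Ck n (\<lambda>p. A p + B p)" if "Ck n A" "Ck n B" for A B
      using that
    proof (induction n arbitrary: A B)
      case 0
      then show ?case by (auto intro!: continuous_on_add)
    next
      case (Suc n)
      have "dird v (\<lambda>p. A p + B p) = (\<lambda>p. dird v A p + dird v B p)" for v
      proof (rule ext, rule dird_eqI)
        fix p
        have "(\<lambda>t. A (p + t *\<^sub>R v)) differentiable (at (0::real))"
          "(\<lambda>t. B (p + t *\<^sub>R v)) differentiable (at (0::real))" using Suc.prems by auto
        then show "((\<lambda>t. A (p + t *\<^sub>R v) + B (p + t *\<^sub>R v)) has_vector_derivative dird v A p + dird v B p) (at 0)"
          by (simp add: dird_def has_vector_derivative_add vector_derivative_works)
      qed
      with Suc show ?case by (auto intro!: continuous_on_add differentiable_add)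
    qed
    show ?case using Suc
      by (simp add: continuous_on_mult smooth_continuous differentiable_smooth C dird_mult smooth_dird)
  qed
  then show ?thesis using assms by (simp add: smooth_def)
qed

lemma continuous_affine2:
  "continuous_on UNIV (\<lambda>(s, t). (p::jet) + s *\<^sub>R v + t *\<^sub>R w)"
proof -
  obtain a b c a' b' c' a'' b'' c'' where "p = (a, b, c)" "v = (a', b', c')" "w = (a'', b'', c'')"
    by (metis prod.exhaust)
  then show ?thesis
    by (auto simp: case_prod_unfold scaleR_fun_def
        intro!: continuous_intros continuous_on_coordinatewise_then_product)
qed

lemma smooth_continuous2:
  assumes "smooth F"
  shows "continuous_on UNIV (\<lambda>(s, t). F (p + s *\<^sub>R v + t *\<^sub>R w))"
proof -
  have "continuous_on UNIV (F \<circ> (\<lambda>(s, t). p + s *\<^sub>R v + t *\<^sub>R w))"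
    by (rule continuous_on_compose[OF continuous_affine2])
      (use smooth_continuous[OF assms] continuous_on_subset in blast)
  then show ?thesis by (simp add: o_def case_prod_unfold)
qed

text \<open>Differentiability is established on two-dimensional affine slices only, where continuity
  of one partial derivative suffices. Restricting to the diagonal of the slice then makes
  \<open>dird\<close> additive in its direction.\<close>

lemma smooth_plane:
  assumes "smooth F"
  shows "((\<lambda>(s, t). F (p + s *\<^sub>R v + t *\<^sub>R w)) has_derivative
     (\<lambda>(s', t'). s' *\<^sub>R dird v F p + t' *\<^sub>R dird w F p)) (at (0::real, 0::real))"
proof -
  let ?D = "\<lambda>s t. blinfun_scaleR_left (dird w F (p + s *\<^sub>R v + t *\<^sub>R w))"
  have "((\<lambda>(s, t). F (p + s *\<^sub>R v + t *\<^sub>R w)) has_derivative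
     (\<lambda>(s', t'). s' *\<^sub>R dird v F p + blinfun_apply (?D 0 0) t')) (at (0::real, 0::real) within UNIV \<times> UNIV)"
  proof (rule has_derivative_partialsI[where f = "\<lambda>s t. F (p + s *\<^sub>R v + t *\<^sub>R w)" and fy = ?D])
    show "((\<lambda>s. F (p + s *\<^sub>R v + 0 *\<^sub>R w)) has_derivative (\<lambda>s'. s' *\<^sub>R dird v F p)) (at (0::real))"
      using smooth_line[OF assms, of p v 0] by (simp add: has_vector_derivative_def)
    show "((\<lambda>t. F (p + s *\<^sub>R v + t *\<^sub>R w)) has_derivative blinfun_apply (?D s t)) (at t)" for s t
      using smooth_line[OF assms, of "p + s *\<^sub>R v" w t] by (simp add: has_vector_derivative_def)
    have "continuous_on UNIV (\<lambda>x. ?D (fst x) (snd x))"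
      using smooth_continuous2[OF smooth_dird[OF assms], of w p v w]
      by (auto intro!: continuous_intros bounded_linear.continuous_on[OF bounded_linear_blinfun_scaleR_left]
          simp: case_prod_unfold)
    then show "continuous (at (0, 0) within UNIV \<times> UNIV) (\<lambda>(s, t). ?D s t)"
      by (simp add: case_prod_unfold continuous_on_eq_continuous_at)
  qed auto
  then show ?thesis by simp
qed

lemma dird_plus:
  assumes "smooth F"
  shows "dird (v + w) F p = dird v F p + dird w F p"
proof (rule dird_eqI)
  have "((\<lambda>t. (t, t)) has_derivative (\<lambda>t. (t, t))) (at (0::real))"
    by (auto intro!: derivative_eq_intros)
  then have "((\<lambda>(s, t). F (p + s *\<^sub>R v + t *\<^sub>R w)) \<circ> (\<lambda>t. (t, t)) has_derivative
     (\<lambda>(s', t'). s' *\<^sub>R dird v F p + t' *\<^sub>R dird w F p) \<circ> (\<lambda>t. (t, t))) (at 0)"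
    by (rule diff_chain_at) (use smooth_plane[OF assms] in auto)
  then show "((\<lambda>t. F (p + t *\<^sub>R (v + w))) has_vector_derivative dird v F p + dird w F p) (at 0)"
    by (simp add: has_vector_derivative_def o_def scaleR_add_right add.assoc)
qed

lemma dird_scale:
  assumes "smooth F"
  shows "dird (c *\<^sub>R v) F p = c *\<^sub>R dird v F p"
proof (rule dird_eqI)
  have "((\<lambda>t. c * t) has_vector_derivative c) (at (0::real))"
    by (auto intro!: derivative_eq_intros)
  then have "((\<lambda>t. F (p + t *\<^sub>R v)) \<circ> (\<lambda>t. c * t) has_vector_derivative c *\<^sub>R dird v F p) (at 0)"
    by (rule vector_diff_chain_at) (use smooth_line[OF assms, of p v 0] in auto)
  then show "((\<lambda>t. F (p + t *\<^sub>R c *\<^sub>R v)) has_vector_derivative c *\<^sub>R dird v F p) (at 0)"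
    by (simp add: o_def mult.commute)
qed

lemma linear_dird: "smooth F \<Longrightarrow> linear (\<lambda>v. dird v F p)"
  by (rule linearI) (simp_all add: dird_plus dird_scale)

text \<open>Schwarz's theorem: the second difference over a square of side k equals k^2 times either
  mixed derivative at some interior point, by the mean value theorem in the two orders; then k tends
  to 0.\<close>

lemma mixed_partials_real:
  fixes \<phi> :: "real \<Rightarrow> real \<Rightarrow> real"
  assumes s: "\<And>s t. ((\<lambda>s. \<phi> s t) has_real_derivative \<phi>s s t) (at s)"
    and t: "\<And>s t. ((\<lambda>t. \<phi> s t) has_real_derivative \<phi>t s t) (at t)"
    and st: "\<And>s t. ((\<lambda>t. \<phi>s s t) has_real_derivative \<phi>st s t) (at t)"
    and ts: "\<And>s t. ((\<lambda>s. \<phi>t s t) has_real_derivative \<phi>ts s t) (at s)"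
    and cst: "continuous_on UNIV (\<lambda>(s, t). \<phi>st s t)"
    and cts: "continuous_on UNIV (\<lambda>(s, t). \<phi>ts s t)"
  shows "\<phi>st 0 0 = \<phi>ts 0 0"
proof -
  define h where "h n = inverse (real (Suc n))" for n
  have h: "h n > 0" for n by (simp add: h_def)
  have hlim: "h \<longlonglongrightarrow> 0" unfolding h_def by (rule LIMSEQ_inverse_real_of_nat)
  have "\<exists>a b c d. 0 < a \<and> a < k \<and> 0 < b \<and> b < k \<and> 0 < c \<and> c < k \<and> 0 < d \<and> d < k \<and> \<phi>st a b = \<phi>ts c d"
    if "k > 0" for k
  proof -
    let ?\<Delta> = "\<phi> k k - \<phi> k 0 - \<phi> 0 k + \<phi> 0 0"
    have "((\<lambda>s. \<phi> s k - \<phi> s 0) has_real_derivative \<phi>s s k - \<phi>s s 0) (at s)" for s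
      by (intro DERIV_diff s)
    from MVT2[OF that this] obtain a where a: "0 < a" "a < k" "?\<Delta> = k * (\<phi>s a k - \<phi>s a 0)" by (force simp: algebra_simps)
    from MVT2[OF that st] obtain b where b: "0 < b" "b < k" "\<phi>s a k - \<phi>s a 0 = k * \<phi>st a b" by force
    have "((\<lambda>t. \<phi> k t - \<phi> 0 t) has_real_derivative \<phi>t k t - \<phi>t 0 t) (at t)" for t
      by (intro DERIV_diff t)
    from MVT2[OF that this] obtain d where d: "0 < d" "d < k" "?\<Delta> = k * (\<phi>t k d - \<phi>t 0 d)" by (force simp: algebra_simps)
    from MVT2[OF that ts] obtain c where c: "0 < c" "c < k" "\<phi>t k d - \<phi>t 0 d = k * \<phi>ts c d" by force
    have "k * (k * \<phi>st a b) = k * (k * \<phi>ts c d)" using a b c d by simp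
    then have "\<phi>st a b = \<phi>ts c d" using that by simp
    then show ?thesis using a b c d by blast
  qed
  from this[OF h] obtain a b c d where X:
    "\<And>n. 0 < a n \<and> a n < h n \<and> 0 < b n \<and> b n < h n \<and> 0 < c n \<and> c n < h n \<and> 0 < d n \<and> d n < h n \<and> \<phi>st (a n) (b n) = \<phi>ts (c n) (d n)"
    by metis
  have lim: "x \<longlonglongrightarrow> 0" if "\<And>n. 0 < x n \<and> x n < h n" for x
    by (rule tendsto_sandwich[OF _ _ tendsto_const hlim])
      (use that less_imp_le in \<open>auto intro!: always_eventually\<close>)
  have "(\<lambda>n. (a n, b n)) \<longlonglongrightarrow> (0, 0)" "(\<lambda>n. (c n, d n)) \<longlonglongrightarrow> (0, 0)"
    by (intro tendsto_Pair lim; use X in blast)+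
  then have "(\<lambda>n. \<phi>st (a n) (b n)) \<longlonglongrightarrow> \<phi>st 0 0" "(\<lambda>n. \<phi>ts (c n) (d n)) \<longlonglongrightarrow> \<phi>ts 0 0"
    using continuous_on_tendsto_compose[OF cst, of "\<lambda>n. (a n, b n)" "(0, 0)" sequentially]
      continuous_on_tendsto_compose[OF cts, of "\<lambda>n. (c n, d n)" "(0, 0)" sequentially] by auto
  then show ?thesis using X LIMSEQ_unique by auto
qed

lemma dird_commute:
  assumes F: "smooth F"
  shows "dird v (dird w F) = dird w (dird v F)"
proof
  fix p
  \<comment> \<open>The mean value theorem is real, so the claim is tested with a real functional g,
    later Re and Im.\<close>
  have *: "g (dird w (dird v F) p) = g (dird v (dird w F) p)"
    if g: "bounded_linear g" for g :: "complex \<Rightarrow> real"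
  proof -
    let ?\<phi> = "\<lambda>H s t. g (H (p + s *\<^sub>R v + t *\<^sub>R w))"
    have D1: "((\<lambda>s. ?\<phi> H s t) has_real_derivative ?\<phi> (dird v H) s t) (at s)" if "smooth H" for H s t
      using bounded_linear.has_vector_derivative[OF g smooth_line[OF that, of "p + t *\<^sub>R w" v s]]
      by (simp add: has_real_derivative_iff_has_vector_derivative algebra_simps)
    have D2: "((\<lambda>t. ?\<phi> H s t) has_real_derivative ?\<phi> (dird w H) s t) (at t)" if "smooth H" for H s t
      using bounded_linear.has_vector_derivative[OF g smooth_line[OF that, of "p + s *\<^sub>R v" w t]]
      by (simp add: has_real_derivative_iff_has_vector_derivative)
    have C: "continuous_on UNIV (\<lambda>(s, t). ?\<phi> H s t)" if "smooth H" for H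
      using bounded_linear.continuous_on[OF g smooth_continuous2[OF that, of p v w]]
      by (simp add: case_prod_unfold)
    show ?thesis
      using mixed_partials_real[where \<phi> = "?\<phi> F" and \<phi>s = "?\<phi> (dird v F)" and \<phi>t = "?\<phi> (dird w F)"
          and \<phi>st = "?\<phi> (dird w (dird v F))" and \<phi>ts = "?\<phi> (dird v (dird w F))"]
        D1 D2 C F smooth_dird by simp
  qed
  from *[OF bounded_linear_Re] *[OF bounded_linear_Im]
  show "dird v (dird w F) p = dird w (dird v F) p" by (simp add: complex_eq_iff)
qed

section \<open>Functions of finite order and derivations of \<open>Omega0\<close>\<close>

lemma of_order_mono: "of_order k F \<Longrightarrow> k \<le> l \<Longrightarrow> of_order l F"
  unfolding of_order_def same_proj_def by (meson order_trans)

lemma of_order_const: "of_order k (\<lambda>p. c)"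
  by (simp add: of_order_def)

lemma of_order_comp2:
  "of_order k F \<Longrightarrow> of_order k G \<Longrightarrow> of_order k (\<lambda>p. h (F p) (G p))"
  unfolding of_order_def by metis

lemma of_order_dird: "of_order k F \<Longrightarrow> of_order k (dird v F)"
  unfolding of_order_def dird_def
proof (intro allI impI)
  fix p p' assume F: "\<forall>p p'. same_proj k p p' \<longrightarrow> F p = F p'" and p: "same_proj k p p'"
  have "F (p + t *\<^sub>R v) = F (p' + t *\<^sub>R v)" for t
    using F p by (simp add: same_proj_def scaleR_fun_def)
  then show "vector_derivative (\<lambda>t. F (p + t *\<^sub>R v)) (at 0) = vector_derivative (\<lambda>t. F (p' + t *\<^sub>R v)) (at 0)"
    by simp
qed

lemma dird_cong_order: "of_order k F \<Longrightarrow> same_proj k v v' \<Longrightarrow> dird v F = dird v' F"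
  unfolding of_order_def dird_def
proof (rule ext)
  fix p assume F: "\<forall>p p'. same_proj k p p' \<longrightarrow> F p = F p'" and p: "same_proj k v v'"
  have "F (p + t *\<^sub>R v) = F (p + t *\<^sub>R v')" for t
    using F p by (simp add: same_proj_def scaleR_fun_def)
  then show "vector_derivative (\<lambda>t. F (p + t *\<^sub>R v)) (at 0) = vector_derivative (\<lambda>t. F (p + t *\<^sub>R v')) (at 0)"
    by simp
qed

lemma dird_0 [simp]: "dird 0 F p = 0"
  by (rule dird_eqI) simp

lemma Omega0_smooth: "F \<in> Omega0 \<Longrightarrow> smooth F"
  by (simp add: Omega0_iff)

lemma Omega0_const: "(\<lambda>p. c) \<in> Omega0"
  by (auto simp: Omega0_iff of_order_const)

lemma Omega0_comp2:
  assumes "F \<in> Omega0" "G \<in> Omega0" "smooth (\<lambda>p. h (F p) (G p))"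
  shows "(\<lambda>p. h (F p) (G p)) \<in> Omega0"
proof -
  obtain k l where "of_order k F" "of_order l G" using assms by (auto simp: Omega0_iff)
  then have "of_order (max k l) F" "of_order (max k l) G" by (auto intro: of_order_mono)
  with assms(3) show ?thesis unfolding Omega0_iff using of_order_comp2 by blast
qed

lemma Omega0_add: "F \<in> Omega0 \<Longrightarrow> G \<in> Omega0 \<Longrightarrow> (\<lambda>p. F p + G p) \<in> Omega0"
  by (rule Omega0_comp2) (auto simp: Omega0_smooth smooth_add)

lemma Omega0_mult: "F \<in> Omega0 \<Longrightarrow> G \<in> Omega0 \<Longrightarrow> (\<lambda>p. F p * G p) \<in> Omega0"
  by (rule Omega0_comp2) (auto simp: Omega0_smooth smooth_mult)

lemma Omega0_cnj: "F \<in> Omega0 \<Longrightarrow> (\<lambda>p. cnj (F p)) \<in> Omega0"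
  by (rule Omega0_comp2[where h = "\<lambda>a b. cnj a" and G = F]) (auto simp: Omega0_smooth smooth_cnj)

lemma Omega0_uminus: "F \<in> Omega0 \<Longrightarrow> (\<lambda>p. - F p) \<in> Omega0"
  using Omega0_mult[OF Omega0_const[of "-1"]] by simp

lemma Omega0_diff: "F \<in> Omega0 \<Longrightarrow> G \<in> Omega0 \<Longrightarrow> (\<lambda>p. F p - G p) \<in> Omega0"
  using Omega0_add[OF _ Omega0_uminus] by simp

lemma Omega0_divide: "F \<in> Omega0 \<Longrightarrow> (\<lambda>p. F p / c) \<in> Omega0"
  using Omega0_mult[OF _ Omega0_const[of "1/c"]] by simp

lemma Omega0_power: "F \<in> Omega0 \<Longrightarrow> (\<lambda>p. F p ^ n) \<in> Omega0"
  by (induction n) (auto intro: Omega0_mult Omega0_const)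

lemma Omega0_sum: "(\<And>i. i \<in> A \<Longrightarrow> F i \<in> Omega0) \<Longrightarrow> (\<lambda>p. \<Sum>i\<in>A. F i p) \<in> Omega0"
  by (induction A rule: infinite_finite_induct) (simp_all add: Omega0_add Omega0_const)

lemma Omega0_dird: "F \<in> Omega0 \<Longrightarrow> dird v F \<in> Omega0"
  using of_order_dird smooth_dird unfolding Omega0_iff by blast

text \<open>All the partial derivatives in use are complex combinations of directional derivatives.\<close>
definition derivation :: "((jet \<Rightarrow> complex) \<Rightarrow> jet \<Rightarrow> complex) \<Rightarrow> bool" where
  "derivation D \<longleftrightarrow> (\<exists>a b v w. \<forall>F. D F = (\<lambda>p. a * dird v F p + b * dird w F p))"

lemma derivation_Omega0: "derivation D \<Longrightarrow> F \<in> Omega0 \<Longrightarrow> D F \<in> Omega0"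
  unfolding derivation_def using Omega0_dird
  by (auto intro!: Omega0_add Omega0_mult Omega0_const)

lemma derivation_of_order: "derivation D \<Longrightarrow> of_order k F \<Longrightarrow> of_order k (D F)"
  unfolding derivation_def
  by (auto intro!: of_order_comp2[where h = "\<lambda>x y. a * x + b * y" for a b] of_order_dird)

lemma derivation_const: "derivation D \<Longrightarrow> D (\<lambda>p. c) = (\<lambda>p. 0)"
  by (auto simp: derivation_def)

lemma derivation_add:
  "derivation D \<Longrightarrow> F \<in> Omega0 \<Longrightarrow> G \<in> Omega0 \<Longrightarrow> D (\<lambda>p. F p + G p) = (\<lambda>p. D F p + D G p)"
  by (auto simp: derivation_def dird_add Omega0_smooth algebra_simps)

lemma derivation_mult:
  "derivation D \<Longrightarrow> F \<in> Omega0 \<Longrightarrow> G \<in> Omega0 \<Longrightarrow>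
     D (\<lambda>p. F p * G p) = (\<lambda>p. F p * D G p + D F p * G p)"
  by (auto simp: derivation_def dird_mult Omega0_smooth algebra_simps)

lemma derivation_cmult:
  "derivation D \<Longrightarrow> F \<in> Omega0 \<Longrightarrow> D (\<lambda>p. c * F p) = (\<lambda>p. c * D F p)"
  using derivation_mult[OF _ Omega0_const, of D F c] by (simp add: derivation_const[of D])

lemma derivation_uminus:
  "derivation D \<Longrightarrow> F \<in> Omega0 \<Longrightarrow> D (\<lambda>p. - F p) = (\<lambda>p. - D F p)"
  using derivation_cmult[of D F "-1"] by simp

lemma derivation_diff:
  "derivation D \<Longrightarrow> F \<in> Omega0 \<Longrightarrow> G \<in> Omega0 \<Longrightarrow> D (\<lambda>p. F p - G p) = (\<lambda>p. D F p - D G p)"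
  using derivation_add[of D F "\<lambda>p. - G p"] by (simp add: derivation_uminus[of D] Omega0_uminus)

lemma derivation_power2:
  "derivation D \<Longrightarrow> F \<in> Omega0 \<Longrightarrow> D (\<lambda>p. (F p)\<^sup>2) = (\<lambda>p. 2 * F p * D F p)"
  by (simp add: power2_eq_square derivation_mult[of D] algebra_simps)

lemma derivation_sum:
  "derivation D \<Longrightarrow> (\<And>i. i \<in> A \<Longrightarrow> F i \<in> Omega0) \<Longrightarrow>
     D (\<lambda>p. \<Sum>i\<in>A. F i p) = (\<lambda>p. \<Sum>i\<in>A. D (F i) p)"
  by (induction A rule: infinite_finite_induct)
     (simp_all add: derivation_const[of D] derivation_add[of D] Omega0_sum)

lemma derivation_commute:
  assumes "derivation D" "derivation E" "F \<in> Omega0"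
  shows "D (E F) = E (D F)"
proof -
  obtain a b v w where D: "\<And>F. D F = (\<lambda>p. a * dird v F p + b * dird w F p)"
    using assms unfolding derivation_def by blast
  obtain a' b' v' w' where E: "\<And>F. E F = (\<lambda>p. a' * dird v' F p + b' * dird w' F p)"
    using assms unfolding derivation_def by blast
  have F: "smooth F" "\<And>v. smooth (dird v F)" using assms by (auto simp: Omega0_smooth smooth_dird)
  show ?thesis
    unfolding D E using F
    by (simp add: dird_add dird_mult smooth_mult dird_commute[OF F(1), of v' v] dird_commute[OF F(1), of w' v]
        dird_commute[OF F(1), of v' w] dird_commute[OF F(1), of w' w] algebra_simps)
qed

definition d_zbar :: "(jet \<Rightarrow> complex) \<Rightarrow> jet \<Rightarrow> complex" where
  "d_zbar F p = (dird (1, 0, 0) F p + \<i> * dird (\<i>, 0, 0) F p) / 2"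

lemma derivation_partial [simp]:
  "derivation d_z" "derivation d_zbar" "derivation d_u" "derivation (d_uj i)" "derivation (d_ujbar i)"
proof -
  have I: "derivation D" if "\<And>F p. D F p = a * dird v F p + b * dird w F p" for D a v b w
    unfolding derivation_def using that by blast
  show "derivation d_z" by (rule I[where a = "1/2" and b = "-\<i>/2" and v = "(1, 0, 0)" and w = "(\<i>, 0, 0)"]) (simp add: d_z_def diff_divide_distrib)
  show "derivation d_zbar" by (rule I[where a = "1/2" and b = "\<i>/2" and v = "(1, 0, 0)" and w = "(\<i>, 0, 0)"]) (simp add: d_zbar_def add_divide_distrib)
  show "derivation d_u" by (rule I[where a = "1" and b = "0"]) (simp add: d_u_def)
  show "derivation (d_uj i)" by (rule I[where a = "1/2" and b = "-\<i>/2" and v = "(0, 0, 0(i := 1))" and w = "(0, 0, 0(i := \<i>))"]) (simp add: d_uj_def diff_divide_distrib)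
  show "derivation (d_ujbar i)" by (rule I[where a = "1/2" and b = "\<i>/2" and v = "(0, 0, 0(i := 1))" and w = "(0, 0, 0(i := \<i>))"]) (simp add: d_ujbar_def add_divide_distrib)
qed

lemma d_cnj:
  assumes "F \<in> Omega0"
  shows "d_z (\<lambda>p. cnj (F p)) = (\<lambda>p. cnj (d_zbar F p))"
    "d_zbar (\<lambda>p. cnj (F p)) = (\<lambda>p. cnj (d_z F p))"
    "d_u (\<lambda>p. cnj (F p)) = (\<lambda>p. cnj (d_u F p))"
    "d_uj i (\<lambda>p. cnj (F p)) = (\<lambda>p. cnj (d_ujbar i F p))"
    "d_ujbar i (\<lambda>p. cnj (F p)) = (\<lambda>p. cnj (d_uj i F p))"
  using Omega0_smooth[OF assms]
  by (auto simp: d_z_def d_zbar_def d_u_def d_uj_def d_ujbar_def dird_cnj fun_eq_iff)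

lemma d_uj_order:
  assumes "of_order k F" "k < i"
  shows "d_uj i F = (\<lambda>p. 0)" "d_ujbar i F = (\<lambda>p. 0)"
proof -
  have "dird (0, 0, 0(i := c)) F = dird 0 F" for c
    by (rule dird_cong_order[OF assms(1)]) (use assms(2) in \<open>auto simp: same_proj_def\<close>)
  then show "d_uj i F = (\<lambda>p. 0)" "d_ujbar i F = (\<lambda>p. 0)"
    by (auto simp: d_uj_def d_ujbar_def)
qed

text \<open>Up to order k a tangent vector agrees with a finite combination of coordinate vectors,
  and F sees nothing beyond. The bound N is free so that sums belonging to different functions can
  share their range.\<close>

lemma dird_decomp:
  assumes F: "smooth F" "of_order k F" and "k \<le> N"
  shows "dird v F p = zc v * d_z F p + cnj (zc v) * d_zbar F p + of_real (uc v) * d_u F p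
     + (\<Sum>i\<le>N. uj i v * d_uj i F p + cnj (uj i v) * d_ujbar i F p)"
proof -
  interpret linear "\<lambda>v. dird v F p" by (rule linear_dird[OF F(1)])
  have basis: "(0, 0, (0::nat \<Rightarrow> complex)(i := c)) = Re c *\<^sub>R (0, 0, 0(i := 1)) + Im c *\<^sub>R (0, 0, 0(i := \<i>))" for i c
    by (auto simp: scaleR_fun_def fun_eq_iff complex_eq_iff)
  have U: "dird (0, 0, 0(i := c)) F p = c * d_uj i F p + cnj c * d_ujbar i F p" for i c
    unfolding basis[of i c] add scale d_uj_def d_ujbar_def
    by (simp add: complex_eq_iff algebra_simps) (simp add: field_simps)
  have basis_z: "(c, 0, 0) = Re c *\<^sub>R (1, 0, 0) + Im c *\<^sub>R (\<i>, 0, 0 :: nat \<Rightarrow> complex)" for c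
    by (auto simp: scaleR_fun_def fun_eq_iff complex_eq_iff)
  have Z: "dird (c, 0, 0) F p = c * d_z F p + cnj c * d_zbar F p" for c
    unfolding basis_z[of c] add scale d_z_def d_zbar_def
    by (simp add: complex_eq_iff algebra_simps) (simp add: field_simps)
  have "(0, r, 0) = r *\<^sub>R (0, 1, 0 :: nat \<Rightarrow> complex)" for r
    by (auto simp: scaleR_fun_def)
  then have R: "dird (0, r, 0) F p = of_real r * d_u F p" for r
    using scale[of r "(0, 1, 0)"] by (simp add: d_u_def scaleR_conv_of_real)
  let ?w = "(zc v, 0, 0) + (0, uc v, 0) + (\<Sum>i\<le>N. (0, 0, 0(i := uj i v)))"
  have fs: "(\<Sum>i\<in>A. G i) j = (\<Sum>i\<in>A. G i j)" for A :: "nat set" and G :: "nat \<Rightarrow> nat \<Rightarrow> complex" and j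
    by (induction A rule: infinite_finite_induct) auto
  have s: "fst (\<Sum>i\<in>A. (0, 0, G i)) = 0 \<and> fst (snd (\<Sum>i\<in>A. (0, 0, G i))) = 0 \<and>
      snd (snd (\<Sum>i\<in>A. (0, 0, G i))) = (\<Sum>i\<in>A. G i)" for A :: "nat set" and G :: "nat \<Rightarrow> nat \<Rightarrow> complex"
    by (induction A rule: infinite_finite_induct) auto
  have "same_proj k v ?w"
    using assms(3) by (auto simp: same_proj_def s fs fun_upd_apply if_distrib cong: if_cong)
  from dird_cong_order[OF F(2) this] have "dird v F p = dird ?w F p" by simp
  also have "\<dots> = zc v * d_z F p + cnj (zc v) * d_zbar F p + of_real (uc v) * d_u F p
     + (\<Sum>i\<le>N. uj i v * d_uj i F p + cnj (uj i v) * d_ujbar i F p)"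
    by (simp only: add sum Z R U)
  finally show ?thesis .
qed

section \<open>Coordinate functions and functions of \<open>u\<close>\<close>

lemma smooth_linear_coord:
  assumes "continuous_on UNIV F" "\<And>v. dird v F = (\<lambda>p. L v)"
    "\<And>p v. (\<lambda>t. F (p + t *\<^sub>R v)) differentiable (at (0::real))"
  shows "smooth F"
  using assms by (subst smooth_iff) simp

lemma coord_line:
  "((\<lambda>t. fst ((p::jet) + t *\<^sub>R v)) has_vector_derivative zc v) (at 0)"
  "((\<lambda>t. uj i (p + t *\<^sub>R v)) has_vector_derivative uj i v) (at 0)"
proof -
  have "((\<lambda>t. a + t *\<^sub>R b) has_vector_derivative b) (at (0::real))" for a b :: complex
    by (auto intro!: derivative_eq_intros)
  then show "((\<lambda>t. fst ((p::jet) + t *\<^sub>R v)) has_vector_derivative zc v) (at 0)"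
    "((\<lambda>t. uj i (p + t *\<^sub>R v)) has_vector_derivative uj i v) (at 0)"
    by (simp_all add: scaleR_fun_def)
qed

lemma dird_coord:
  "dird v fst = (\<lambda>p. zc v)" "dird v (\<lambda>p. uj i p) = (\<lambda>p. uj i v)"
proof -
  have "dird v fst p = zc v" "dird v (\<lambda>p. uj i p) p = uj i v" for p
    by (rule dird_eqI[OF coord_line(1)[of p v]], rule dird_eqI[OF coord_line(2)[where i = i and p = p and v = v]])
  then show "dird v fst = (\<lambda>p. zc v)" "dird v (\<lambda>p. uj i p) = (\<lambda>p. uj i v)" by blast+
qed

lemma Omega0_fst: "fst \<in> Omega0"
proof -
  have "of_order 0 fst" by (simp add: of_order_def same_proj_def)
  moreover have "smooth fst"
  proof (rule smooth_linear_coord[where L = zc])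
    show "(\<lambda>t. fst ((p::jet) + t *\<^sub>R v)) differentiable (at (0::real))" for p v
      using coord_line(1) by (rule differentiableI_vector)
  qed (auto intro!: continuous_intros simp: dird_coord)
  ultimately show ?thesis by (auto simp: Omega0_iff)
qed

lemma Omega0_uj: "(\<lambda>p. uj i p) \<in> Omega0"
proof -
  have "of_order i (\<lambda>p. uj i p)" by (simp add: of_order_def same_proj_def)
  moreover have "smooth (\<lambda>p. uj i p)"
  proof (rule smooth_linear_coord[where L = "uj i"])
    show "(\<lambda>t. uj i ((p::jet) + t *\<^sub>R v)) differentiable (at (0::real))" for p v
      using coord_line(2) by (rule differentiableI_vector)
    show "continuous_on UNIV (\<lambda>p::jet. uj i p)"
    proof -
      have "continuous_on UNIV (\<lambda>p::jet. snd (snd p))" by (intro continuous_intros)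
      from continuous_on_product_then_coordinatewise[OF this] show ?thesis .
    qed
  qed (auto simp: dird_coord)
  ultimately show ?thesis by (auto simp: Omega0_iff)
qed

lemma smooth_real_function:
  assumes "\<forall>n. (deriv ^^ n) g differentiable_on UNIV"
  shows "\<forall>n. (deriv ^^ n) (deriv g) differentiable_on UNIV"
    "(g has_real_derivative deriv g x) (at x)"
proof -
  show "\<forall>n. (deriv ^^ n) (deriv g) differentiable_on UNIV"
    using assms by (metis funpow_Suc_right o_apply)
  have "g differentiable_on UNIV" using spec[OF assms, of 0] by simp
  then show "(g has_real_derivative deriv g x) (at x)"
    by (simp add: differentiable_on_def DERIV_deriv_iff_real_differentiable)
qed

lemma dird_of_real_u:
  assumes "\<And>x. (g has_real_derivative g' x) (at x)"
  shows "dird v (\<lambda>p. of_real (g (uc p))) = (\<lambda>p. of_real (uc v) * of_real (g' (uc p)))"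
    "(\<lambda>t. complex_of_real (g (uc (p + t *\<^sub>R v)))) differentiable (at (0::real))"
proof -
  have D: "((\<lambda>t. complex_of_real (g (uc (p + t *\<^sub>R v)))) has_vector_derivative
      of_real (uc v) * of_real (g' (uc p))) (at 0)" for p
  proof -
    have "((\<lambda>t. uc p + t * uc v) has_real_derivative uc v) (at 0)"
      by (auto intro!: derivative_eq_intros)
    then have "((\<lambda>t. g (uc p + t * uc v)) has_real_derivative g' (uc p) * uc v) (at 0)"
      using DERIV_chain2[of g "g' (uc p)" "\<lambda>t. uc p + t * uc v" 0 "uc v" UNIV] assms[of "uc p"] by simp
    then show ?thesis
      using has_vector_derivative_of_real by (fastforce simp: mult.commute)
  qed
  show "dird v (\<lambda>p. of_real (g (uc p))) = (\<lambda>p. of_real (uc v) * of_real (g' (uc p)))"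
    using D by (auto intro!: ext dird_eqI)
  show "(\<lambda>t. complex_of_real (g (uc (p + t *\<^sub>R v)))) differentiable (at (0::real))"
    using D[of p] by (rule differentiableI_vector)
qed

lemma Omega0_of_real_u:
  assumes "\<forall>n. (deriv ^^ n) g differentiable_on UNIV"
  shows "(\<lambda>p. of_real (g (uc p))) \<in> Omega0"
proof -
  have C: "continuous_on UNIV (\<lambda>p::jet. complex_of_real (g (uc p)))" if "\<forall>n. (deriv ^^ n) g differentiable_on UNIV" for g
  proof -
    have "continuous_on UNIV g" using spec[OF that, of 0] differentiable_imp_continuous_on by auto
    then have "continuous_on UNIV (g \<circ> (\<lambda>p::jet. uc p))"
      by (intro continuous_on_compose continuous_intros) (auto intro: continuous_on_subset)
    then show ?thesis by (auto simp: o_def intro!: continuous_intros)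
  qed
  \<comment> \<open>The factor c keeps the claim stable under \<open>dird v\<close>, which
    multiplies by \<open>uc v\<close> and replaces g by its derivative.\<close>
  have "Ck n (\<lambda>p. c * of_real (g (uc p)))" if "\<forall>n. (deriv ^^ n) g differentiable_on UNIV" for n c g
    using that
  proof (induction n arbitrary: c g)
    case 0
    then show ?case using C by (auto intro!: continuous_intros)
  next
    case (Suc n)
    note D = smooth_real_function(2)[OF Suc.prems]
    have eq: "dird v (\<lambda>p. c * of_real (g (uc p))) = (\<lambda>p. (c * of_real (uc v)) * of_real (deriv g (uc p)))" for v
    proof (rule ext, rule dird_eqI)
      fix p
      have "((\<lambda>t. complex_of_real (g (uc (p + t *\<^sub>R v)))) has_vector_derivative
          dird v (\<lambda>p. of_real (g (uc p))) p) (at 0)"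
        using dird_of_real_u(2)[OF D] unfolding dird_def by (simp only: vector_derivative_works)
      from has_vector_derivative_mult_right[OF this, of c]
      show "((\<lambda>t. c * complex_of_real (g (uc (p + t *\<^sub>R v)))) has_vector_derivative
         (c * of_real (uc v)) * of_real (deriv g (uc p))) (at 0)"
        by (simp add: dird_of_real_u(1)[OF D] mult.assoc)
    qed
    have "(\<lambda>t. c * complex_of_real (g (uc (p + t *\<^sub>R v)))) differentiable (at (0::real))" for p v
      using dird_of_real_u(2)[OF D] by (intro differentiable_mult) auto
    moreover have "Ck n (dird v (\<lambda>p. c * of_real (g (uc p))))" for v
      unfolding eq by (rule Suc.IH[OF smooth_real_function(1)[OF Suc.prems]])
    ultimately show ?case using C[OF Suc.prems] by (auto intro!: continuous_intros)
  qed
  from this[OF assms, where c = 1] have "smooth (\<lambda>p. of_real (g (uc p)))" by (simp add: smooth_def)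
  moreover have "of_order 0 (\<lambda>p. of_real (g (uc p)))" by (simp add: of_order_def same_proj_def)
  ultimately show ?thesis by (auto simp: Omega0_iff)
qed

lemmas Omega0_intros = Omega0_const Omega0_add Omega0_mult Omega0_cnj Omega0_uminus Omega0_diff
  Omega0_divide Omega0_power Omega0_sum Omega0_fst Omega0_uj
  derivation_Omega0[OF derivation_partial(1)] derivation_Omega0[OF derivation_partial(2)]
  derivation_Omega0[OF derivation_partial(3)] derivation_Omega0[OF derivation_partial(4)]
  derivation_Omega0[OF derivation_partial(5)]

lemma partial_coord [simp]:
  "d_z fst = (\<lambda>p. 1)" "d_zbar fst = (\<lambda>p. 0)" "d_u fst = (\<lambda>p. 0)" "d_uj i fst = (\<lambda>p. 0)" "d_ujbar i fst = (\<lambda>p. 0)"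
  "d_z (\<lambda>p. uj j p) = (\<lambda>p. 0)" "d_zbar (\<lambda>p. uj j p) = (\<lambda>p. 0)" "d_u (\<lambda>p. uj j p) = (\<lambda>p. 0)"
  "d_uj i (\<lambda>p. uj j p) = (\<lambda>p. if i = j then 1 else 0)" "d_ujbar i (\<lambda>p. uj j p) = (\<lambda>p. 0)"
  by (auto simp: d_z_def d_zbar_def d_u_def d_uj_def d_ujbar_def dird_coord)

lemma partial_of_real_u:
  assumes "\<And>x. (g has_real_derivative g' x) (at x)"
  shows "d_z (\<lambda>p. of_real (g (uc p))) = (\<lambda>p. 0)" "d_zbar (\<lambda>p. of_real (g (uc p))) = (\<lambda>p. 0)"
    "d_u (\<lambda>p. of_real (g (uc p))) = (\<lambda>p. of_real (g' (uc p)))"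
    "d_uj i (\<lambda>p. of_real (g (uc p))) = (\<lambda>p. 0)" "d_ujbar i (\<lambda>p. of_real (g (uc p))) = (\<lambda>p. 0)"
  by (auto simp: d_z_def d_zbar_def d_u_def d_uj_def d_ujbar_def dird_of_real_u(1)[OF assms])

lemmas partial_const [simp] = derivation_partial[THEN derivation_const]
lemmas partial_add = derivation_partial[THEN derivation_add]
lemmas partial_diff = derivation_partial[THEN derivation_diff]
lemmas partial_uminus = derivation_partial[THEN derivation_uminus]
lemmas partial_mult = derivation_partial[THEN derivation_mult]
lemmas partial_power2 = derivation_partial[THEN derivation_power2]
lemmas partial_sum = derivation_partial[THEN derivation_sum]
lemmas partial_rules = partial_add partial_diff partial_uminus partial_mult partial_power2 partial_sum d_cnj

section \<open>The total derivatives\<close>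

text \<open>One index type for all coordinate derivations turns both total derivatives into uniform
  sums of coefficient times derivation, so commutators follow from a single product rule.\<close>

datatype dir = DZ | DZb | DU | DJ nat | DJb nat

fun partial :: "dir \<Rightarrow> (jet \<Rightarrow> complex) \<Rightarrow> jet \<Rightarrow> complex" where
  "partial DZ = d_z" | "partial DZb = d_zbar" | "partial DU = d_u"
| "partial (DJ i) = d_uj i" | "partial (DJb i) = d_ujbar i"

definition dirs :: "nat \<Rightarrow> dir set" where
  "dirs N = {DZ, DZb, DU} \<union> DJ ` {..N} \<union> DJb ` {..N}"

lemma derivation_partial_dir [simp]: "derivation (partial a)"
  by (cases a) simp_all

lemma sum_dirs:
  "(\<Sum>a\<in>dirs N. g a) = g DZ + g DZb + g DU + (\<Sum>i\<le>N. g (DJ i)) + (\<Sum>i\<le>N. g (DJb i) :: complex)"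
proof -
  have "(\<Sum>a\<in>dirs N. g a) = (\<Sum>a\<in>{DZ, DZb, DU}. g a) + (\<Sum>a\<in>DJ ` {..N}. g a) + (\<Sum>a\<in>DJb ` {..N}. g a)"
    unfolding dirs_def by (subst sum.union_disjoint; (subst sum.union_disjoint)?) auto
  then show ?thesis by (simp add: sum.reindex inj_on_def add.assoc)
qed

text \<open>The horizontal vector over a: the real tangent vector a e + conjugate(a) e', on which
  every \<open>eta f i\<close> vanishes. Evaluating a form on it reads off the form modulo the
  ideal.\<close>

definition hvec :: "(real \<Rightarrow> real) \<Rightarrow> jet \<Rightarrow> complex \<Rightarrow> jet" where
  "hvec f p a = (a, Re (uj 0 p * a + cnj (uj 0 p * a)), \<lambda>i. uj (Suc i) p * a - jetT f i p * cnj a)"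

fun e_coeff :: "(real \<Rightarrow> real) \<Rightarrow> dir \<Rightarrow> jet \<Rightarrow> complex" where
  "e_coeff f DZ = (\<lambda>p. 1)" | "e_coeff f DZb = (\<lambda>p. 0)" | "e_coeff f DU = (\<lambda>p. uj 0 p)"
| "e_coeff f (DJ i) = (\<lambda>p. uj (Suc i) p)" | "e_coeff f (DJb i) = (\<lambda>p. - cnj (jetT f i p))"

fun ebar_coeff :: "(real \<Rightarrow> real) \<Rightarrow> dir \<Rightarrow> jet \<Rightarrow> complex" where
  "ebar_coeff f DZ = (\<lambda>p. 0)" | "ebar_coeff f DZb = (\<lambda>p. 1)" | "ebar_coeff f DU = (\<lambda>p. cnj (uj 0 p))"
| "ebar_coeff f (DJ i) = (\<lambda>p. - jetT f i p)" | "ebar_coeff f (DJb i) = (\<lambda>p. cnj (uj (Suc i) p))"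

lemma suminf_order:
  assumes "of_order k F" "k \<le> N"
  shows "(\<Sum>i. g i * d_uj i F p) = (\<Sum>i\<le>N. g i * d_uj i F p)"
    "(\<Sum>i. g i * d_ujbar i F p) = (\<Sum>i\<le>N. g i * d_ujbar i F p)"
proof -
  have "k < i" if "i \<notin> {..N}" for i using that assms(2) by auto
  then show "(\<Sum>i. g i * d_uj i F p) = (\<Sum>i\<le>N. g i * d_uj i F p)"
    "(\<Sum>i. g i * d_ujbar i F p) = (\<Sum>i\<le>N. g i * d_ujbar i F p)"
    by (intro suminf_finite; simp add: d_uj_order[OF assms(1)])+
qed

lemma e_m1_sum:
  assumes "of_order k F" "k \<le> N"
  shows "e_m1 f F p = d_z F p + uj 0 p * d_u F p + (\<Sum>i\<le>N. uj (Suc i) p * d_uj i F p)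
      - (\<Sum>i\<le>N. cnj (jetT f i p) * d_ujbar i F p)"
  by (simp only: e_m1_def suminf_order[OF assms])

lemma e_m1_dirs:
  assumes "of_order k F" "k \<le> N"
  shows "e_m1 f F p = (\<Sum>a\<in>dirs N. e_coeff f a p * partial a F p)"
  by (simp add: e_m1_sum[OF assms] sum_dirs sum_negf)

lemma e_m1bar_sum:
  assumes "of_order k F" "k \<le> N" "F \<in> Omega0"
  shows "e_m1bar f F p = d_zbar F p + cnj (uj 0 p) * d_u F p + (\<Sum>i\<le>N. cnj (uj (Suc i) p) * d_ujbar i F p)
      - (\<Sum>i\<le>N. jetT f i p * d_uj i F p)"
proof -
  have "of_order k (\<lambda>p. cnj (F p))" using assms(1) by (auto simp: of_order_def)
  from e_m1_sum[OF this assms(2), of f p] show ?thesis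
    by (simp add: e_m1bar_def o_def d_cnj[OF assms(3)])
qed

lemma e_m1bar_dirs:
  assumes "of_order k F" "k \<le> N" "F \<in> Omega0"
  shows "e_m1bar f F p = (\<Sum>a\<in>dirs N. ebar_coeff f a p * partial a F p)"
  by (simp add: e_m1bar_sum[OF assms] sum_dirs sum_negf)

lemma dird_hvec:
  assumes "F \<in> Omega0"
  shows "dird (hvec f p a) F p = a * e_m1 f F p + cnj a * e_m1bar f F p"
proof -
  obtain k where k: "of_order k F" and s: "smooth F" using assms by (auto simp: Omega0_iff)
  have "complex_of_real (Re (uj 0 p * a + cnj (uj 0 p * a))) = uj 0 p * a + cnj (uj 0 p * a)"
    by (simp add: complex_eq_iff)
  then show ?thesis
    unfolding dird_decomp[OF s k order_refl] e_m1_sum[OF k order_refl] e_m1bar_sum[OF k order_refl assms] hvec_def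
    by (simp add: algebra_simps sum.distrib sum_subtractf sum_distrib_left)
qed

text \<open>Pointwise, both total derivatives combine just two directional derivatives, so linearity
  and the Leibniz rule are inherited from \<open>dird\<close> without truncating any series.\<close>

lemma e_m1_dird:
  assumes "F \<in> Omega0"
  shows "e_m1 f F p = (dird (hvec f p 1) F p - \<i> * dird (hvec f p \<i>) F p) / 2"
    "e_m1bar f F p = (dird (hvec f p 1) F p + \<i> * dird (hvec f p \<i>) F p) / 2"
  by (simp_all add: dird_hvec[OF assms] algebra_simps)

lemma e_m1_const [simp]: "e_m1 f (\<lambda>p. c) = (\<lambda>p. 0)" "e_m1bar f (\<lambda>p. c) = (\<lambda>p. 0)"
  by (simp_all add: fun_eq_iff e_m1_dird Omega0_const)

lemma e_m1_add:
  assumes "F \<in> Omega0" "G \<in> Omega0"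
  shows "e_m1 f (\<lambda>p. F p + G p) = (\<lambda>p. e_m1 f F p + e_m1 f G p)"
    "e_m1bar f (\<lambda>p. F p + G p) = (\<lambda>p. e_m1bar f F p + e_m1bar f G p)"
  using assms by (simp_all add: fun_eq_iff e_m1_dird Omega0_add dird_add Omega0_smooth field_simps)

lemma e_m1_mult:
  assumes "F \<in> Omega0" "G \<in> Omega0"
  shows "e_m1 f (\<lambda>p. F p * G p) = (\<lambda>p. F p * e_m1 f G p + e_m1 f F p * G p)"
    "e_m1bar f (\<lambda>p. F p * G p) = (\<lambda>p. F p * e_m1bar f G p + e_m1bar f F p * G p)"
  using assms by (simp_all add: fun_eq_iff e_m1_dird Omega0_mult dird_mult Omega0_smooth field_simps)

lemma e_m1_cmult:
  assumes "F \<in> Omega0"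
  shows "e_m1 f (\<lambda>p. c * F p) = (\<lambda>p. c * e_m1 f F p)" "e_m1bar f (\<lambda>p. c * F p) = (\<lambda>p. c * e_m1bar f F p)"
  using e_m1_mult[OF Omega0_const assms] by auto

lemma e_m1_uminus:
  assumes "F \<in> Omega0"
  shows "e_m1 f (\<lambda>p. - F p) = (\<lambda>p. - e_m1 f F p)" "e_m1bar f (\<lambda>p. - F p) = (\<lambda>p. - e_m1bar f F p)"
  using e_m1_cmult[OF assms, of f "-1"] by auto

lemma e_m1_diff:
  assumes "F \<in> Omega0" "G \<in> Omega0"
  shows "e_m1 f (\<lambda>p. F p - G p) = (\<lambda>p. e_m1 f F p - e_m1 f G p)"
    "e_m1bar f (\<lambda>p. F p - G p) = (\<lambda>p. e_m1bar f F p - e_m1bar f G p)"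
  using e_m1_add[OF assms(1) Omega0_uminus[OF assms(2)]] by (simp_all add: e_m1_uminus assms)

lemma e_m1_sum_fun:
  assumes "\<And>i. i \<in> A \<Longrightarrow> F i \<in> Omega0"
  shows "e_m1 f (\<lambda>p. \<Sum>i\<in>A. F i p) = (\<lambda>p. \<Sum>i\<in>A. e_m1 f (F i) p)"
    "e_m1bar f (\<lambda>p. \<Sum>i\<in>A. F i p) = (\<lambda>p. \<Sum>i\<in>A. e_m1bar f (F i) p)"
  using assms
  by (induction A rule: infinite_finite_induct) (simp_all add: e_m1_add Omega0_sum)

lemma e_m1_cnj:
  "e_m1 f (\<lambda>p. cnj (F p)) = (\<lambda>p. cnj (e_m1bar f F p))" "e_m1bar f (\<lambda>p. cnj (F p)) = (\<lambda>p. cnj (e_m1 f F p))"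
  by (simp_all add: e_m1bar_def o_def)

lemmas e_m1_rules = e_m1_add e_m1_diff e_m1_uminus e_m1_mult e_m1_sum_fun e_m1_cnj

definition nobar :: "(jet \<Rightarrow> complex) set" where
  "nobar = {F \<in> Omega0. \<forall>i. d_ujbar i F = (\<lambda>p. 0)}"

text \<open>Holomorphy concerns the jet variables only; dependence on the conjugate of z stays
  allowed. Independence of \<open>u\<close> is what later permits freezing it.\<close>

definition hol :: "(jet \<Rightarrow> complex) set" where
  "hol = {F \<in> nobar. d_u F = (\<lambda>p. 0)}"

lemma nobarD: "F \<in> nobar \<Longrightarrow> F \<in> Omega0" "F \<in> nobar \<Longrightarrow> d_ujbar i F = (\<lambda>p. 0)"
  by (auto simp: nobar_def)

lemma holD: "F \<in> hol \<Longrightarrow> F \<in> nobar" "F \<in> hol \<Longrightarrow> F \<in> Omega0" "F \<in> hol \<Longrightarrow> d_u F = (\<lambda>p. 0)"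
    "F \<in> hol \<Longrightarrow> d_ujbar i F = (\<lambda>p. 0)"
  by (auto simp: hol_def nobar_def)

lemma nobar_const: "(\<lambda>p. c) \<in> nobar" by (simp add: nobar_def Omega0_const)
lemma hol_const: "(\<lambda>p. c) \<in> hol" by (simp add: hol_def nobar_const)

lemma nobar_add: "F \<in> nobar \<Longrightarrow> G \<in> nobar \<Longrightarrow> (\<lambda>p. F p + G p) \<in> nobar"
  by (simp add: nobar_def Omega0_intros partial_rules)
lemma nobar_mult: "F \<in> nobar \<Longrightarrow> G \<in> nobar \<Longrightarrow> (\<lambda>p. F p * G p) \<in> nobar"
  by (simp add: nobar_def Omega0_intros partial_rules)
lemma hol_add: "F \<in> hol \<Longrightarrow> G \<in> hol \<Longrightarrow> (\<lambda>p. F p + G p) \<in> hol"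
  by (simp add: hol_def nobar_add partial_rules nobarD)
lemma hol_mult: "F \<in> hol \<Longrightarrow> G \<in> hol \<Longrightarrow> (\<lambda>p. F p * G p) \<in> hol"
  by (simp add: hol_def nobar_mult partial_rules nobarD)
lemma hol_uminus: "F \<in> hol \<Longrightarrow> (\<lambda>p. - F p) \<in> hol"
  using hol_mult[OF hol_const[of "-1"]] by simp
lemma hol_diff: "F \<in> hol \<Longrightarrow> G \<in> hol \<Longrightarrow> (\<lambda>p. F p - G p) \<in> hol"
  using hol_add[OF _ hol_uminus] by simp
lemma nobar_sum: "(\<And>i. i \<in> A \<Longrightarrow> F i \<in> nobar) \<Longrightarrow> (\<lambda>p. \<Sum>i\<in>A. F i p) \<in> nobar"
  by (induction A rule: infinite_finite_induct) (simp_all add: nobar_add nobar_const)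
lemma hol_sum: "(\<And>i. i \<in> A \<Longrightarrow> F i \<in> hol) \<Longrightarrow> (\<lambda>p. \<Sum>i\<in>A. F i p) \<in> hol"
  by (induction A rule: infinite_finite_induct) (simp_all add: hol_add hol_const)
lemma hol_uj: "(\<lambda>p. uj i p) \<in> hol"
  by (simp add: hol_def nobar_def Omega0_intros)
lemma hol_power: "F \<in> hol \<Longrightarrow> (\<lambda>p. F p ^ n) \<in> hol"
  by (induction n) (simp_all add: hol_mult hol_const)

lemma nobar_partial: "F \<in> nobar \<Longrightarrow> partial a F \<in> nobar"
proof -
  assume F: "F \<in> nobar"
  have "d_ujbar i (partial a F) = partial a (d_ujbar i F)" for i
    by (rule derivation_commute) (use F nobarD in auto)
  then show ?thesis
    using F by (simp add: nobar_def derivation_Omega0 derivation_const[of "partial a"])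
qed

lemma hol_partial_dir: "F \<in> hol \<Longrightarrow> partial a F \<in> hol"
proof -
  assume F: "F \<in> hol"
  have "d_u (partial a F) = partial a (d_u F)"
    by (rule derivation_commute) (use F holD in auto)
  then show ?thesis
    using F by (simp add: hol_def nobar_partial derivation_const[of "partial a"])
qed

lemma hol_partial: "F \<in> hol \<Longrightarrow> d_z F \<in> hol" "F \<in> hol \<Longrightarrow> d_zbar F \<in> hol" "F \<in> hol \<Longrightarrow> d_uj i F \<in> hol"
  using hol_partial_dir[of F DZ] hol_partial_dir[of F DZb] hol_partial_dir[of F "DJ i"] by auto

lemma e_m1_nobar_sum:
  assumes "F \<in> nobar" "of_order k F" "k \<le> N"
  shows "e_m1 f F p = d_z F p + uj 0 p * d_u F p + (\<Sum>i\<le>N. uj (Suc i) p * d_uj i F p)"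
  by (simp add: e_m1_sum[OF assms(2,3)] nobarD[OF assms(1)])

text \<open>The conjugate coefficients of e multiply only derivatives in conjugate jets, which
  vanish here. The operator e' has no such property, since its coefficient of \<open>d_u\<close> is
  a conjugate jet.\<close>

lemma nobar_e_m1: assumes "F \<in> nobar" shows "e_m1 f F \<in> nobar"
proof -
  obtain k where k: "of_order k F" using assms by (auto simp: nobar_def Omega0_iff)
  have "e_m1 f F = (\<lambda>p. d_z F p + uj 0 p * d_u F p + (\<Sum>i\<le>k. uj (Suc i) p * d_uj i F p))"
    using e_m1_nobar_sum[OF assms k] by auto
  moreover have "d_z F \<in> nobar" "d_u F \<in> nobar" "d_uj i F \<in> nobar" for i
    using nobar_partial[OF assms, of DZ] nobar_partial[OF assms, of DU] nobar_partial[OF assms, of "DJ i"] by auto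
  ultimately show ?thesis by (simp add: nobar_add nobar_mult nobar_sum holD(1)[OF hol_uj])
qed

lemma hol_e_m1: assumes "F \<in> hol" shows "e_m1 f F \<in> hol"
proof -
  obtain k where k: "of_order k F" using assms by (auto simp: hol_def nobar_def Omega0_iff)
  have "e_m1 f F = (\<lambda>p. d_z F p + (\<Sum>i\<le>k. uj (Suc i) p * d_uj i F p))"
    using e_m1_nobar_sum[OF holD(1)[OF assms] k] holD(3)[OF assms] by auto
  then show ?thesis using assms by (simp add: hol_add hol_mult hol_sum hol_uj hol_partial)
qed

section \<open>The coefficients T^i and the commutation rules of e and e'\<close>

locale poisson =
  fixes f :: "real \<Rightarrow> real"
  assumes smooth_f: "\<forall>n. (deriv ^^ n) f differentiable_on UNIV"
begin

abbreviation e where "e \<equiv> e_m1 f"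
abbreviation eb where "eb \<equiv> e_m1bar f"
abbreviation T where "T \<equiv> jetT f"
abbreviation fu :: "jet \<Rightarrow> complex" where "fu \<equiv> \<lambda>p. of_real (deriv f (uc p))"

lemmas DERIV_f = smooth_real_function(2)[OF smooth_f]
lemmas DERIV_f' = smooth_real_function(2)[OF smooth_real_function(1)[OF smooth_f]]
lemmas partial_f = partial_of_real_u[OF DERIV_f]
lemmas partial_f' = partial_of_real_u[OF DERIV_f']

lemma Omega0_f: "(\<lambda>p. of_real (f (uc p))) \<in> Omega0" "fu \<in> Omega0"
  "(\<lambda>p. of_real (deriv (deriv f) (uc p))) \<in> Omega0"
  using smooth_f smooth_real_function(1) by (blast intro: Omega0_of_real_u)+

lemma T_0: "T 0 \<in> nobar" "d_u (T 0) = fu"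
  by (simp_all add: nobar_def Omega0_f partial_f)

lemma T_0_cnj: "cnj (T 0 p) = T 0 p"
  by simp

lemma T_nobar: "T i \<in> nobar"
proof (induction i rule: less_induct)
  case (less i)
  show ?case
  proof (cases i)
    case (Suc n)
    have "d_u (T j) \<in> nobar" if "j \<le> n" for j
      using nobar_partial[OF less[of j], of DU] that Suc by simp
    then show ?thesis unfolding Suc jetT.simps
      by (intro nobar_sum nobar_mult nobar_const holD(1)[OF hol_uj]) auto
  qed (use T_0 in metis)
qed

lemma T_Omega0: "T i \<in> Omega0"
  using T_nobar nobarD by blast

lemma T_u_Omega0: "d_u (T i) \<in> Omega0" "d_u (d_u (T i)) \<in> Omega0"
  using T_Omega0 by (auto intro: Omega0_intros)

lemma T_partial_Suc:
  assumes "derivation D"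
  shows "D (T (Suc i)) = (\<lambda>p. \<Sum>j\<le>i. of_nat (i choose j) *
     (uj (i - j) p * d_u (D (T j)) p + D (\<lambda>p. uj (i - j) p) p * d_u (T j) p))"
proof -
  have "D (\<lambda>p. of_nat (i choose j) * uj (i - j) p * d_u (T j) p) =
      (\<lambda>p. of_nat (i choose j) * (uj (i - j) p * d_u (D (T j)) p + D (\<lambda>p. uj (i - j) p) p * d_u (T j) p))" for j
    using derivation_commute[OF assms derivation_partial(3) T_Omega0]
    by (simp add: mult.assoc derivation_cmult[OF assms] derivation_mult[OF assms] Omega0_intros T_u_Omega0)
  then show ?thesis
    by (simp add: derivation_sum[OF assms] Omega0_intros T_u_Omega0)
qed

lemma T_partial_0 [simp]:
  "d_z (T i) = (\<lambda>p. 0)" "d_zbar (T i) = (\<lambda>p. 0)" "d_ujbar j (T i) = (\<lambda>p. 0)"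
proof -
  show "d_ujbar j (T i) = (\<lambda>p. 0)" using nobarD T_nobar by blast
  show "d_z (T i) = (\<lambda>p. 0)"
  proof (induction i rule: less_induct)
    case (less i)
    then show ?case by (cases i) (simp_all add: T_partial_Suc partial_f del: jetT.simps(2))
  qed
  show "d_zbar (T i) = (\<lambda>p. 0)"
  proof (induction i rule: less_induct)
    case (less i)
    then show ?case by (cases i) (simp_all add: T_partial_Suc partial_f del: jetT.simps(2))
  qed
qed

lemma T_uj_high: "i \<le> j \<Longrightarrow> d_uj j (T i) = (\<lambda>p. 0)"
proof (induction i rule: less_induct)
  case (less i)
  show ?case
  proof (cases i)
    case (Suc n)
    have "d_uj j (T l) = (\<lambda>p. 0)" "j \<noteq> n - l" if "l \<le> n" for l
      using less.prems Suc that by (auto intro!: less.IH simp del: jetT.simps)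
    then show ?thesis unfolding Suc by (simp add: T_partial_Suc del: jetT.simps)
  qed (simp add: partial_f)
qed

text \<open>In the recursion for T^(i+1) the coordinate u_i appears only as the factor in the
  summand j = 0, because T^j with j \<le> i does not involve it.\<close>

lemma T_uj_top: "d_uj i (T (Suc i)) = fu"
proof -
  have "d_uj i (T (Suc i)) p = (\<Sum>j\<le>i. if j = 0 then fu p else 0)" for p
    unfolding T_partial_Suc[OF derivation_partial(4)] using T_0(2)
    by (intro sum.cong refl) (auto simp: T_uj_high simp del: jetT.simps)
  then show ?thesis by auto
qed

lemma Omega0_e: "F \<in> Omega0 \<Longrightarrow> e F \<in> Omega0"
proof -
  assume F: "F \<in> Omega0"
  then obtain k where k: "of_order k F" by (auto simp: Omega0_iff)
  have "e F = (\<lambda>p. d_z F p + uj 0 p * d_u F p + (\<Sum>i\<le>k. uj (Suc i) p * d_uj i F p)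
      - (\<Sum>i\<le>k. cnj (T i p) * d_ujbar i F p))"
    using e_m1_sum[OF k] by auto
  then show ?thesis using F by (simp add: Omega0_intros T_Omega0)
qed

lemma Omega0_eb: "F \<in> Omega0 \<Longrightarrow> eb F \<in> Omega0"
  unfolding e_m1bar_def using Omega0_e Omega0_cnj by (simp add: o_def)

lemma e_coeff_Omega0: "e_coeff f a \<in> Omega0" "ebar_coeff f a \<in> Omega0"
  by (cases a; simp add: Omega0_intros T_Omega0)+

text \<open>D commutes with the coordinate derivations, so its commutator with a total derivative
  differentiates the coefficients only.\<close>

lemma derivation_e:
  assumes D: "derivation D" and F: "F \<in> Omega0" "of_order k F" "k \<le> N"
  shows "D (e F) = (\<lambda>p. e (D F) p + (\<Sum>a\<in>dirs N. D (e_coeff f a) p * partial a F p))"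
    "D (eb F) = (\<lambda>p. eb (D F) p + (\<Sum>a\<in>dirs N. D (ebar_coeff f a) p * partial a F p))"
proof -
  have P: "partial a F \<in> Omega0" for a using F by (simp add: derivation_Omega0)
  note o = derivation_of_order[OF D F(2)]
  have "e F = (\<lambda>p. \<Sum>a\<in>dirs N. e_coeff f a p * partial a F p)"
    using e_m1_dirs[OF F(2,3)] by auto
  then show "D (e F) = (\<lambda>p. e (D F) p + (\<Sum>a\<in>dirs N. D (e_coeff f a) p * partial a F p))"
    by (simp add: derivation_sum[OF D] derivation_mult[OF D] P e_coeff_Omega0 Omega0_mult e_m1_dirs[OF o F(3)]
        derivation_commute[OF derivation_partial_dir D F(1)] sum.distrib)
  have "eb F = (\<lambda>p. \<Sum>a\<in>dirs N. ebar_coeff f a p * partial a F p)"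
    using e_m1bar_dirs[OF F(2,3,1)] by auto
  then show "D (eb F) = (\<lambda>p. eb (D F) p + (\<Sum>a\<in>dirs N. D (ebar_coeff f a) p * partial a F p))"
    by (simp add: derivation_sum[OF D] derivation_mult[OF D] P e_coeff_Omega0 Omega0_mult
        e_m1bar_dirs[OF o F(3) derivation_Omega0[OF D F(1)]]
        derivation_commute[OF derivation_partial_dir D F(1)] sum.distrib)
qed

lemma d_z_e: "F \<in> Omega0 \<Longrightarrow> d_z (e F) = e (d_z F)" "F \<in> Omega0 \<Longrightarrow> d_zbar (e F) = e (d_zbar F)"
proof -
  assume F: "F \<in> Omega0"
  then obtain k where k: "of_order k F" by (auto simp: Omega0_iff)
  show "d_z (e F) = e (d_z F)" "d_zbar (e F) = e (d_zbar F)"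
    by (simp_all add: derivation_e[OF _ F k order_refl] sum_dirs partial_rules T_Omega0 Omega0_intros)
qed

text \<open>Among the coefficients of e only that of \<open>d_uj j\<close> involves u_(j+1), and
  only that of \<open>d_u\<close> involves u_0. The resulting index shift makes the Euler sum
  telescope.\<close>

lemma d_uj_e:
  assumes "F \<in> Omega0"
  shows "d_uj (Suc j) (e F) = (\<lambda>p. e (d_uj (Suc j) F) p + d_uj j F p)"
    "d_uj 0 (e F) = (\<lambda>p. e (d_uj 0 F) p + d_u F p)"
proof -
  obtain k where "of_order k F" using assms by (auto simp: Omega0_iff)
  then have k: "of_order (max k j) F" by (auto intro: of_order_mono)
  show "d_uj (Suc j) (e F) = (\<lambda>p. e (d_uj (Suc j) F) p + d_uj j F p)"
    by (simp add: derivation_e[OF _ assms k order_refl] sum_dirs partial_rules T_Omega0 Omega0_intros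
        if_distrib[where f = "\<lambda>x. x * _"] cong: if_cong)
  show "d_uj 0 (e F) = (\<lambda>p. e (d_uj 0 F) p + d_u F p)"
    by (simp add: derivation_e[OF _ assms k order_refl] sum_dirs partial_rules T_Omega0 Omega0_intros)
qed

text \<open>The \<open>u\<close>-dependence of e sits in the conjugates of T^i, which multiply
  derivatives in conjugate jets.\<close>

lemma d_u_e_nobar: "F \<in> nobar \<Longrightarrow> d_u (e F) = e (d_u F)"
proof -
  assume F: "F \<in> nobar"
  then obtain k where k: "of_order k F" by (auto simp: nobar_def Omega0_iff)
  show "d_u (e F) = e (d_u F)"
    by (simp add: derivation_e[OF _ nobarD(1)[OF F] k order_refl] sum_dirs partial_rules T_Omega0 Omega0_intros
        nobarD(2)[OF F])
qed

lemma d_uj_eb: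
  assumes "F \<in> Omega0" "of_order k F" "k \<le> N"
  shows "d_uj j (eb F) = (\<lambda>p. eb (d_uj j F) p - (\<Sum>i\<le>N. d_uj j (T i) p * d_uj i F p))"
  by (simp add: derivation_e[OF _ assms] sum_dirs partial_rules T_Omega0 Omega0_intros sum_negf)

text \<open>Hence T^i is e^i f: the defining recursion is the Leibniz expansion of e^i (u_0 f_u),
  and the inductive step is Pascal's rule.\<close>

lemma e_T: "e (T i) = T (Suc i)"
proof (induction i rule: less_induct)
  case (less i)
  show ?case
  proof (cases i)
    case 0
    have "of_order 0 (T 0)" by (simp add: of_order_def same_proj_def)
    from e_m1_nobar_sum[OF T_0(1) this order_refl, of f] show ?thesis
      unfolding 0 by (simp add: fun_eq_iff partial_f)
  next
    case (Suc n)
    have IH: "e (d_u (T j)) = d_u (T (Suc j))" if "j \<le> n" for j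
      using less[of j] d_u_e_nobar[OF T_nobar[of j]] that Suc by simp
    have u: "e (\<lambda>p. uj l p) = (\<lambda>p. uj (Suc l) p)" for l
    proof -
      have "of_order l (\<lambda>p. uj l p)" by (simp add: of_order_def same_proj_def)
      from e_m1_nobar_sum[OF holD(1)[OF hol_uj] this order_refl, of f] show ?thesis
        by (simp add: fun_eq_iff if_distrib[where f = "\<lambda>x. _ * x"] cong: if_cong)
    qed
    have "e (T (Suc n)) p = T (Suc (Suc n)) p" for p
    proof -
      let ?c = "\<lambda>n j. complex_of_nat (n choose j)"
      have "e (T (Suc n)) p = (\<Sum>j\<le>n. ?c n j * (uj (n - j) p * d_u (T (Suc j)) p + uj (Suc (n - j)) p * d_u (T j) p))"
        by (simp add: e_m1_rules mult.assoc e_m1_cmult T_u_Omega0 Omega0_intros IH u del: jetT.simps(2)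
             add: jetT.simps(2)[of f n])
      also have "\<dots> = (\<Sum>j\<le>n. ?c n j * uj (n - j) p * d_u (T (Suc j)) p)
          + (\<Sum>j\<le>n. ?c n j * uj (Suc n - j) p * d_u (T j) p)"
        by (simp add: algebra_simps sum.distrib Suc_diff_le)
      also have "(\<Sum>j\<le>n. ?c n j * uj (Suc n - j) p * d_u (T j) p) = (\<Sum>j\<le>Suc n. ?c n j * uj (Suc n - j) p * d_u (T j) p)"
        by simp
      also have "\<dots> = uj (Suc n) p * d_u (T 0) p + (\<Sum>j\<le>n. ?c n (Suc j) * uj (n - j) p * d_u (T (Suc j)) p)"
        by (simp only: sum.atMost_Suc_shift) simp
      also have "(\<Sum>j\<le>n. ?c n j * uj (n - j) p * d_u (T (Suc j)) p) +
           (uj (Suc n) p * d_u (T 0) p + (\<Sum>j\<le>n. ?c n (Suc j) * uj (n - j) p * d_u (T (Suc j)) p))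
         = uj (Suc n) p * d_u (T 0) p + (\<Sum>j\<le>n. ?c (Suc n) (Suc j) * uj (n - j) p * d_u (T (Suc j)) p)"
        by (simp add: algebra_simps sum.distrib)
      also have "\<dots> = (\<Sum>j\<le>Suc n. ?c (Suc n) j * uj (Suc n - j) p * d_u (T j) p)"
        by (simp only: sum.atMost_Suc_shift) simp
      also have "\<dots> = T (Suc (Suc n)) p" by (simp only: jetT.simps(2))
      finally show ?thesis .
    qed
    then show ?thesis unfolding Suc by auto
  qed
qed

lemma e_uj: "e (\<lambda>p. uj l p) = (\<lambda>p. uj (Suc l) p)" "eb (\<lambda>p. uj l p) = (\<lambda>p. - T l p)"
proof -
  have o: "of_order l (\<lambda>p. uj l p)" by (simp add: of_order_def same_proj_def)
  from e_m1_sum[OF o order_refl, of f] show "e (\<lambda>p. uj l p) = (\<lambda>p. uj (Suc l) p)"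
    by (simp add: fun_eq_iff if_distrib[where f = "\<lambda>x. _ * x"] cong: if_cong)
  from e_m1bar_sum[OF o order_refl Omega0_uj, of f] show "eb (\<lambda>p. uj l p) = (\<lambda>p. - T l p)"
    by (simp add: fun_eq_iff if_distrib[where f = "\<lambda>x. _ * x"] cong: if_cong)
qed

lemma e_fst: "e fst = (\<lambda>p. 1)" "eb fst = (\<lambda>p. 0)"
proof -
  have o: "of_order 0 fst" by (simp add: of_order_def same_proj_def)
  show "e fst = (\<lambda>p. 1)" "eb fst = (\<lambda>p. 0)"
    using e_m1_sum[OF o order_refl, of f] e_m1bar_sum[OF o order_refl Omega0_fst, of f] by (auto simp: fun_eq_iff)
qed

lemma e_f:
  assumes "\<And>x. (g has_real_derivative g' x) (at x)" "(\<lambda>p. of_real (g (uc p))) \<in> Omega0"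
  shows "e (\<lambda>p. of_real (g (uc p))) = (\<lambda>p. uj 0 p * of_real (g' (uc p)))"
    "eb (\<lambda>p. of_real (g (uc p))) = (\<lambda>p. cnj (uj 0 p) * of_real (g' (uc p)))"
proof -
  have o: "of_order 0 (\<lambda>p. of_real (g (uc p)))" by (simp add: of_order_def same_proj_def)
  show "e (\<lambda>p. of_real (g (uc p))) = (\<lambda>p. uj 0 p * of_real (g' (uc p)))"
    "eb (\<lambda>p. of_real (g (uc p))) = (\<lambda>p. cnj (uj 0 p) * of_real (g' (uc p)))"
    using e_m1_sum[OF o order_refl, of f] e_m1bar_sum[OF o order_refl assms(2), of f]
    by (auto simp: fun_eq_iff partial_of_real_u[OF assms(1)])
qed

text \<open>Second-order terms agree by symmetry of derivatives. First-order terms agree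
  coefficientwise, by \<open>e_T\<close> and, for \<open>DU\<close>, because f is real.\<close>

lemma e_eb_commute:
  assumes F: "F \<in> Omega0"
  shows "e (eb F) = eb (e F)"
proof
  fix p
  obtain k where k: "of_order k F" using F by (auto simp: Omega0_iff)
  have P: "partial a F \<in> Omega0" "of_order k (partial a F)" for a
    using F k by (simp_all add: derivation_Omega0 derivation_of_order)
  have c: "e (ebar_coeff f a) = eb (e_coeff f a)" for a
    by (cases a) (simp_all add: e_uj e_T e_m1_uminus e_m1_cnj T_Omega0 Omega0_intros T_0_cnj del: jetT.simps)
  have E: "e F = (\<lambda>p. \<Sum>a\<in>dirs k. e_coeff f a p * partial a F p)"
    "eb F = (\<lambda>p. \<Sum>a\<in>dirs k. ebar_coeff f a p * partial a F p)"
    using e_m1_dirs[OF k order_refl] e_m1bar_dirs[OF k order_refl F] by auto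
  have "e (eb F) p = (\<Sum>b\<in>dirs k. ebar_coeff f b p * e (partial b F) p)
      + (\<Sum>b\<in>dirs k. e (ebar_coeff f b) p * partial b F p)"
    unfolding E(2) by (simp add: e_m1_rules Omega0_mult e_coeff_Omega0 P sum.distrib)
  also have "(\<Sum>b\<in>dirs k. ebar_coeff f b p * e (partial b F) p)
      = (\<Sum>b\<in>dirs k. \<Sum>a\<in>dirs k. ebar_coeff f b p * e_coeff f a p * partial a (partial b F) p)"
    by (simp add: e_m1_dirs[OF P(2) order_refl] sum_distrib_left mult.assoc)
  also have "\<dots> = (\<Sum>a\<in>dirs k. \<Sum>b\<in>dirs k. ebar_coeff f b p * e_coeff f a p * partial b (partial a F) p)"
    by (subst sum.swap) (simp add: derivation_commute[OF derivation_partial_dir derivation_partial_dir F])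
  also have "\<dots> = (\<Sum>a\<in>dirs k. e_coeff f a p * eb (partial a F) p)"
    by (simp add: e_m1bar_dirs[OF P(2) order_refl P(1)] sum_distrib_left mult.assoc mult.left_commute)
  also have "(\<Sum>a\<in>dirs k. e_coeff f a p * eb (partial a F) p) + (\<Sum>b\<in>dirs k. e (ebar_coeff f b) p * partial b F p) = eb (e F) p"
    unfolding E(1) by (simp add: e_m1_rules Omega0_mult e_coeff_Omega0 P sum.distrib c)
  finally show "e (eb F) p = eb (e F) p" .
qed

end

section \<open>Cohomology classes and their symbols\<close>

lemma Omega1_linear: "\<alpha> \<in> Omega1 \<Longrightarrow> linear (\<alpha> p)"
  by (simp add: Omega1_def)

lemma Omega1_smooth: "\<alpha> \<in> Omega1 \<Longrightarrow> smooth (\<lambda>p. \<alpha> p v)"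
  by (simp add: Omega1_def smooth_def)

lemma Omega1_iff:
  "\<alpha> \<in> Omega1 \<longleftrightarrow> (\<forall>p. linear (\<alpha> p)) \<and>
     (\<exists>k. \<forall>p p' v v'. same_proj k p p' \<longrightarrow> same_proj k v v' \<longrightarrow> \<alpha> p v = \<alpha> p' v') \<and>
     (\<forall>v. smooth (\<lambda>p. \<alpha> p v))"
  by (simp add: Omega1_def smooth_def)

lemma Omega1I:
  assumes "\<And>p. linear (\<alpha> p)"
    "\<And>p p' v v'. same_proj k p p' \<Longrightarrow> same_proj k v v' \<Longrightarrow> \<alpha> p v = \<alpha> p' v'"
    "\<And>v. smooth (\<lambda>p. \<alpha> p v)"
  shows "\<alpha> \<in> Omega1"
  using assms unfolding Omega1_iff by blast

lemma Omega1_add: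
  assumes "\<alpha> \<in> Omega1" "\<beta> \<in> Omega1" shows "\<alpha> + \<beta> \<in> Omega1"
proof -
  obtain k l where
    k: "\<And>p p' v v'. same_proj k p p' \<Longrightarrow> same_proj k v v' \<Longrightarrow> \<alpha> p v = \<alpha> p' v'" and
    l: "\<And>p p' v v'. same_proj l p p' \<Longrightarrow> same_proj l v v' \<Longrightarrow> \<beta> p v = \<beta> p' v'"
    using assms unfolding Omega1_iff by metis
  have m: "same_proj k p p'" "same_proj l p p'" if "same_proj (max k l) p p'" for p p'
    using that by (auto simp: same_proj_def)
  show ?thesis
  proof (rule Omega1I[where k = "max k l"])
    show "linear ((\<alpha> + \<beta>) p)" for p
      using linear_compose_add[OF Omega1_linear[OF assms(1)] Omega1_linear[OF assms(2)]]
      by (simp add: plus_fun_def)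
    show "(\<alpha> + \<beta>) p v = (\<alpha> + \<beta>) p' v'" if "same_proj (max k l) p p'" "same_proj (max k l) v v'" for p p' v v'
      using k[OF m(1) m(1)] l[OF m(2) m(2)] that by (simp add: plus_fun_def)
    show "smooth (\<lambda>p. (\<alpha> + \<beta>) p v)" for v
      using smooth_add[OF Omega1_smooth[OF assms(1)] Omega1_smooth[OF assms(2)]] by simp
  qed
qed

lemma Omega1_smult1:
  assumes "g \<in> Omega0" "\<alpha> \<in> Omega1" shows "smult1 g \<alpha> \<in> Omega1"
proof -
  obtain k l where
    k: "\<And>p p' v v'. same_proj k p p' \<Longrightarrow> same_proj k v v' \<Longrightarrow> \<alpha> p v = \<alpha> p' v'" and
    l: "\<And>p p'. same_proj l p p' \<Longrightarrow> g p = g p'"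
    using assms unfolding Omega1_iff Omega0_iff of_order_def by metis
  have m: "same_proj k p p'" "same_proj l p p'" if "same_proj (max k l) p p'" for p p'
    using that by (auto simp: same_proj_def)
  show ?thesis
  proof (rule Omega1I[where k = "max k l"])
    show "linear (smult1 g \<alpha> p)" for p
      unfolding smult1_def
      by (rule linearI) (simp_all only: linear_add[OF Omega1_linear[OF assms(2)]]
          linear_scale[OF Omega1_linear[OF assms(2)]] distrib_left mult_scaleR_right)
    show "smult1 g \<alpha> p v = smult1 g \<alpha> p' v'" if "same_proj (max k l) p p'" "same_proj (max k l) v v'" for p p' v v'
      using k[OF m(1) m(1)] l[OF m(2)] that unfolding smult1_def by metis
    show "smooth (\<lambda>p. smult1 g \<alpha> p v)" for v
      using smooth_mult[OF Omega0_smooth[OF assms(1)] Omega1_smooth[OF assms(2)]] by (simp add: smult1_def)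
  qed
qed

lemma Omega1_cnj1:
  assumes "\<alpha> \<in> Omega1" shows "cnj1 \<alpha> \<in> Omega1"
proof -
  obtain k where k: "\<And>p p' v v'. same_proj k p p' \<Longrightarrow> same_proj k v v' \<Longrightarrow> \<alpha> p v = \<alpha> p' v'"
    using assms unfolding Omega1_iff by metis
  show ?thesis
  proof (rule Omega1I[where k = k])
    show "linear (cnj1 \<alpha> p)" for p
      unfolding cnj1_def
      by (rule linearI) (simp_all only: linear_add[OF Omega1_linear[OF assms]]
          linear_scale[OF Omega1_linear[OF assms]] complex_cnj_add complex_cnj_scaleR)
    show "cnj1 \<alpha> p v = cnj1 \<alpha> p' v'" if "same_proj k p p'" "same_proj k v v'" for p p' v v'
      using k[OF that] unfolding cnj1_def by metis
    show "smooth (\<lambda>p. cnj1 \<alpha> p v)" for v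
      using smooth_cnj[OF Omega1_smooth[OF assms]] by (simp add: cnj1_def)
  qed
qed

lemma Omega1_zeta: "zeta \<in> Omega1"
proof (rule Omega1I[where k = 0])
  show "linear (zeta p)" for p by (rule linearI) (simp_all add: zeta_def)
qed (simp_all add: zeta_def same_proj_def)

lemma v_rot_eq: "v_rot p = (- \<i> * zc p, 0, \<lambda>j. \<i> * of_nat (Suc j) * uj j p)"
proof -
  have E: "((\<lambda>t. exp (\<i> * of_real t * c)) has_vector_derivative \<i> * c) (at (0::real))" for c
  proof -
    have "((\<lambda>t. exp (t *\<^sub>R (\<i> * c))) has_vector_derivative \<i> * c * exp (0 *\<^sub>R (\<i> * c))) (at (0::real))"
      by (rule exp_scaleR_has_vector_derivative_left)
    then show ?thesis by (simp add: scaleR_conv_of_real algebra_simps)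
  qed
  have z: "((\<lambda>t. inverse (exp (\<i> * of_real t)) * a) has_vector_derivative - \<i> * a) (at (0::real))" for a
    using has_vector_derivative_mult_left[OF E[of "-1"], of a] by (simp add: exp_minus)
  have u: "((\<lambda>t. exp (\<i> * of_real t) ^ (j + 1) * a) has_vector_derivative \<i> * of_nat (Suc j) * a) (at (0::real))" for j a
  proof -
    have "exp (\<i> * of_real t) ^ (j + 1) = exp (\<i> * of_real t * of_nat (Suc j))" for t
      using exp_of_nat_mult[of "Suc j" "\<i> * of_real t"] by (simp add: mult.commute)
    then show ?thesis
      using has_vector_derivative_mult_left[OF E[of "of_nat (Suc j)"], of a] by simp
  qed
  show ?thesis
    unfolding v_rot_def rot_def
    using vector_derivative_at[OF z] vector_derivative_at[OF u] by (simp add: fun_eq_iff)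
qed

context poisson
begin

lemma eta_hvec: "eta f i p (hvec f p a) = 0"
proof (cases i)
  case 0
  then show ?thesis by (simp add: hvec_def zeta_def complex_eq_iff)
next
  case (Suc n)
  then show ?thesis by (simp add: hvec_def zeta_def omega_Suc_def)
qed

lemma ideal1_hvec: "\<alpha> \<in> ideal1 f \<Longrightarrow> \<alpha> p (hvec f p a) = 0"
  by (induction rule: ideal1.induct) (simp_all add: eta_hvec cnj1_def smult1_def)

lemma Omega1_eta: "eta f i \<in> Omega1"
proof (cases i)
  case 0
  show ?thesis unfolding 0
  proof (rule Omega1I[where k = 0])
    show "linear (eta f 0 p)" for p
      by (rule linearI) (simp_all add: zeta_def algebra_simps scaleR_conv_of_real)
    have "(\<lambda>p. eta f 0 p v) \<in> Omega0" for v by (simp add: zeta_def Omega0_intros)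
    then show "smooth (\<lambda>p. eta f 0 p v)" for v by (rule Omega0_smooth)
  qed (simp_all add: zeta_def same_proj_def)
next
  case (Suc n)
  obtain k where k: "of_order k (T n)" using T_Omega0 by (auto simp: Omega0_iff)
  show ?thesis unfolding Suc
  proof (rule Omega1I[where k = "max k (Suc n)"])
    show "linear (eta f (Suc n) p)" for p
      by (rule linearI) (simp_all add: zeta_def omega_Suc_def algebra_simps scaleR_conv_of_real scaleR_fun_def)
    have "(\<lambda>p. eta f (Suc n) p v) \<in> Omega0" for v
      by (simp add: zeta_def omega_Suc_def Omega0_intros T_Omega0 del: jetT.simps)
    then show "smooth (\<lambda>p. eta f (Suc n) p v)" for v by (rule Omega0_smooth)
    show "eta f (Suc n) p v = eta f (Suc n) p' v'"
      if "same_proj (max k (Suc n)) p p'" "same_proj (max k (Suc n)) v v'" for p p' v v'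
    proof -
      have "same_proj k p p'" using that by (simp add: same_proj_def)
      then have "T n p = T n p'" using k by (simp add: of_order_def)
      then show ?thesis using that by (simp add: zeta_def omega_Suc_def same_proj_def del: jetT.simps)
    qed
  qed
qed

lemma ideal1_Omega1: "\<alpha> \<in> ideal1 f \<Longrightarrow> \<alpha> \<in> Omega1"
  by (induction rule: ideal1.induct) (auto intro: Omega1_eta Omega1_cnj1 Omega1_add Omega1_smult1 simp del: plus_fun_apply)

lemma ideal1_add': "\<alpha> \<in> ideal1 f \<Longrightarrow> \<beta> \<in> ideal1 f \<Longrightarrow> (\<lambda>p v. \<alpha> p v + \<beta> p v) \<in> ideal1 f"
  using ideal1.add[of \<alpha> f \<beta>] by (simp add: plus_fun_def)

lemma ideal1_smult': "g \<in> Omega0 \<Longrightarrow> \<alpha> \<in> ideal1 f \<Longrightarrow> (\<lambda>p v. g p * \<alpha> p v) \<in> ideal1 f"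
  using ideal1.smult[of g \<alpha> f] by (simp add: smult1_def)

lemma ideal1_eta: "eta f i \<in> ideal1 f" "(\<lambda>p v. cnj (eta f i p v)) \<in> ideal1 f"
  using ideal1.eta ideal1.eta_cnj[of f i] by (simp_all add: cnj1_def)

lemma ideal1_0: "(\<lambda>p v. 0) \<in> ideal1 f"
  using ideal1_smult'[OF Omega0_const[of 0] ideal1_eta(1)] by simp

lemma ideal1_uminus': "\<alpha> \<in> ideal1 f \<Longrightarrow> (\<lambda>p v. - \<alpha> p v) \<in> ideal1 f"
  using ideal1_smult'[OF Omega0_const[of "-1"]] by simp

lemma ideal1_diff': "\<alpha> \<in> ideal1 f \<Longrightarrow> \<beta> \<in> ideal1 f \<Longrightarrow> (\<lambda>p v. \<alpha> p v - \<beta> p v) \<in> ideal1 f"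
  using ideal1_add'[OF _ ideal1_uminus'] by simp

lemma ideal1_sum': "(\<And>i. i \<in> A \<Longrightarrow> \<alpha> i \<in> ideal1 f) \<Longrightarrow> (\<lambda>p v. \<Sum>i\<in>A. \<alpha> i p v) \<in> ideal1 f"
  by (induction A rule: infinite_finite_induct) (simp_all add: ideal1_0 ideal1_add')

text \<open>The horizontal part of a form modulo the ideal. Membership of the remainder in the
  inductively generated \<open>ideal1\<close> is demanded outright, so that cohomology classes can
  be compared through symbols.\<close>

definition has_symbol :: "form1 \<Rightarrow> (jet \<Rightarrow> complex) \<Rightarrow> (jet \<Rightarrow> complex) \<Rightarrow> bool" where
  "has_symbol \<alpha> A B \<longleftrightarrow> A \<in> Omega0 \<and> B \<in> Omega0 \<and>
     (\<exists>\<theta>\<in>ideal1 f. \<alpha> = (\<lambda>p v. A p * zc v + B p * cnj (zc v) + \<theta> p v))"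

lemma has_symbolI:
  "A \<in> Omega0 \<Longrightarrow> B \<in> Omega0 \<Longrightarrow> \<theta> \<in> ideal1 f \<Longrightarrow>
     (\<And>p v. \<alpha> p v = A p * zc v + B p * cnj (zc v) + \<theta> p v) \<Longrightarrow> has_symbol \<alpha> A B"
  unfolding has_symbol_def by blast

lemma has_symbol_Omega1:
  assumes "has_symbol \<alpha> A B" shows "\<alpha> \<in> Omega1"
proof -
  obtain \<theta> where \<theta>: "\<theta> \<in> ideal1 f" "\<alpha> = (\<lambda>p v. A p * zc v + B p * cnj (zc v) + \<theta> p v)"
    "A \<in> Omega0" "B \<in> Omega0" using assms by (auto simp: has_symbol_def)
  then have "\<alpha> = smult1 A zeta + smult1 B (cnj1 zeta) + \<theta>"
    by (simp add: fun_eq_iff smult1_def zeta_def cnj1_def)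
  then show ?thesis
    using \<theta> by (simp add: Omega1_add Omega1_smult1 Omega1_zeta Omega1_cnj1 ideal1_Omega1)
qed

lemma has_symbol_hvec: "has_symbol \<alpha> A B \<Longrightarrow> \<alpha> p (hvec f p a) = A p * a + B p * cnj a"
  by (auto simp: has_symbol_def ideal1_hvec) (simp_all add: hvec_def)

lemma has_symbol_add:
  assumes "has_symbol \<alpha> A B" "has_symbol \<alpha>' A' B'"
  shows "has_symbol (\<lambda>p v. \<alpha> p v + \<alpha>' p v) (\<lambda>p. A p + A' p) (\<lambda>p. B p + B' p)"
proof -
  obtain \<theta> \<theta>' where "\<theta> \<in> ideal1 f" "\<alpha> = (\<lambda>p v. A p * zc v + B p * cnj (zc v) + \<theta> p v)"
    "\<theta>' \<in> ideal1 f" "\<alpha>' = (\<lambda>p v. A' p * zc v + B' p * cnj (zc v) + \<theta>' p v)"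
    "A \<in> Omega0" "B \<in> Omega0" "A' \<in> Omega0" "B' \<in> Omega0"
    using assms by (auto simp: has_symbol_def)
  then show ?thesis
    by (intro has_symbolI[where \<theta> = "\<lambda>p v. \<theta> p v + \<theta>' p v"]) (simp_all add: Omega0_add ideal1_add' algebra_simps)
qed

lemma has_symbol_smult:
  assumes "g \<in> Omega0" "has_symbol \<alpha> A B"
  shows "has_symbol (\<lambda>p v. g p * \<alpha> p v) (\<lambda>p. g p * A p) (\<lambda>p. g p * B p)"
proof -
  obtain \<theta> where "\<theta> \<in> ideal1 f" "\<alpha> = (\<lambda>p v. A p * zc v + B p * cnj (zc v) + \<theta> p v)"
    "A \<in> Omega0" "B \<in> Omega0"
    using assms by (auto simp: has_symbol_def)
  then show ?thesis using assms(1)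
    by (intro has_symbolI[where \<theta> = "\<lambda>p v. g p * \<theta> p v"]) (simp_all add: Omega0_mult ideal1_smult' algebra_simps)
qed

lemma has_symbol_diff_ideal1:
  assumes "has_symbol \<alpha> A B" "has_symbol \<beta> A B" shows "\<beta> - \<alpha> \<in> ideal1 f"
proof -
  obtain \<theta> \<theta>' where "\<theta> \<in> ideal1 f" "\<alpha> = (\<lambda>p v. A p * zc v + B p * cnj (zc v) + \<theta> p v)"
    "\<theta>' \<in> ideal1 f" "\<beta> = (\<lambda>p v. A p * zc v + B p * cnj (zc v) + \<theta>' p v)"
    using assms by (auto simp: has_symbol_def)
  moreover have "(\<lambda>p v. \<theta>' p v - \<theta> p v) \<in> ideal1 f"
    using ideal1_diff' \<open>\<theta> \<in> ideal1 f\<close> \<open>\<theta>' \<in> ideal1 f\<close> by blast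
  moreover have "\<beta> - \<alpha> = (\<lambda>p v. \<theta>' p v - \<theta> p v)"
    using calculation by (simp add: fun_eq_iff)
  ultimately show ?thesis by simp
qed

lemma eta_coords:
  "of_real (uc v) = eta f 0 p v + uj 0 p * zc v + cnj (uj 0 p) * cnj (zc v)"
  "uj i v = eta f (Suc i) p v + uj (Suc i) p * zc v - T i p * cnj (zc v)"
  by (simp_all add: zeta_def omega_Suc_def)

lemma dird_eta:
  assumes "F \<in> Omega0" "of_order k F"
  shows "dird v F p = e F p * zc v + eb F p * cnj (zc v) + (d_u F p * eta f 0 p v
     + (\<Sum>i\<le>k. d_uj i F p * eta f (Suc i) p v + d_ujbar i F p * cnj (eta f (Suc i) p v)))"
  unfolding dird_decomp[OF Omega0_smooth[OF assms(1)] assms(2) order_refl] e_m1_sum[OF assms(2) order_refl]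
    e_m1bar_sum[OF assms(2) order_refl assms(1)]
  by (simp add: eta_coords(1)[where v = v and p = p] eta_coords(2)[where v = v and p = p] algebra_simps sum.distrib sum_subtractf sum_distrib_left
      del: eta.simps jetT.simps)

lemma has_symbol_ext_d0:
  assumes "F \<in> Omega0" shows "has_symbol (ext_d0 F) (e F) (eb F)"
proof -
  obtain k where k: "of_order k F" using assms by (auto simp: Omega0_iff)
  show ?thesis
  proof (rule has_symbolI)
    show "ext_d0 F p v = e F p * zc v + eb F p * cnj (zc v) + (d_u F p * eta f 0 p v
     + (\<Sum>i\<le>k. d_uj i F p * eta f (Suc i) p v + d_ujbar i F p * cnj (eta f (Suc i) p v)))" for p v
      unfolding ext_d0_def by (rule dird_eta[OF assms k])
    show "(\<lambda>p v. d_u F p * eta f 0 p v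
     + (\<Sum>i\<le>k. d_uj i F p * eta f (Suc i) p v + d_ujbar i F p * cnj (eta f (Suc i) p v))) \<in> ideal1 f"
      using assms by (intro ideal1_add' ideal1_smult' ideal1_sum' ideal1_eta Omega0_intros)
  qed (use assms in \<open>simp_all add: Omega0_e Omega0_eb\<close>)
qed

lemma ideal1_B1: "\<theta> \<in> ideal1 f \<Longrightarrow> \<theta> \<in> B1 f"
proof -
  assume "\<theta> \<in> ideal1 f"
  moreover have "\<theta> = ext_d0 (\<lambda>p. 0) + \<theta>" by (simp add: fun_eq_iff ext_d0_def)
  ultimately show ?thesis unfolding B1_def using Omega0_const by blast
qed

text \<open>Exactness in the quotient makes both coefficients total derivatives of one function; the
  horizontal vectors over 1 and \<open>\<i>\<close> separate the two coefficients.\<close>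

lemma B1_symbol:
  assumes "\<alpha> \<in> B1 f" "has_symbol \<alpha> A B"
  obtains F where "F \<in> Omega0" "e F = A" "eb F = B"
proof -
  obtain F \<theta> where F: "F \<in> Omega0" "\<theta> \<in> ideal1 f" "\<alpha> = ext_d0 F + \<theta>"
    using assms by (auto simp: B1_def)
  have *: "e F p * a + eb F p * cnj a = A p * a + B p * cnj a" for p a
    using has_symbol_hvec[OF assms(2), of p a] has_symbol_hvec[OF has_symbol_ext_d0[OF F(1)], of p a]
      ideal1_hvec[OF F(2), of p a] F(3) by simp
  have "e F p = A p \<and> eb F p = B p" for p
  proof -
    have "e F p + eb F p = A p + B p" using *[of p 1] by simp
    moreover have "e F p - eb F p = A p - B p"
    proof -
      have "\<i> * (e F p - eb F p) = \<i> * (A p - B p)" using *[of p \<i>] by (simp add: algebra_simps)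
      then show ?thesis by simp
    qed
    ultimately show ?thesis by (auto simp: complex_eq_iff)
  qed
  then show ?thesis using that F(1) by blast
qed

lemma B1_add: "\<alpha> \<in> B1 f \<Longrightarrow> \<beta> \<in> B1 f \<Longrightarrow> \<alpha> + \<beta> \<in> B1 f"
proof -
  assume "\<alpha> \<in> B1 f" "\<beta> \<in> B1 f"
  then obtain F \<theta> G \<theta>' where F: "F \<in> Omega0" "\<theta> \<in> ideal1 f" "\<alpha> = ext_d0 F + \<theta>"
    and G: "G \<in> Omega0" "\<theta>' \<in> ideal1 f" "\<beta> = ext_d0 G + \<theta>'"
    unfolding B1_def by blast
  have "\<alpha> + \<beta> = ext_d0 (\<lambda>p. F p + G p) + (\<theta> + \<theta>')"
    by (simp add: F(3) G(3) fun_eq_iff ext_d0_def dird_add Omega0_smooth F G)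
  then show ?thesis unfolding B1_def using Omega0_add[OF F(1) G(1)] ideal1.add[OF F(2) G(2)] by blast
qed

lemma B1_scale: "\<alpha> \<in> B1 f \<Longrightarrow> smult1 (\<lambda>_. c) \<alpha> \<in> B1 f"
proof -
  assume "\<alpha> \<in> B1 f"
  then obtain F \<theta> where F: "F \<in> Omega0" "\<theta> \<in> ideal1 f" "\<alpha> = ext_d0 F + \<theta>"
    unfolding B1_def by blast
  have "smult1 (\<lambda>_. c) \<alpha> = ext_d0 (\<lambda>p. c * F p) + smult1 (\<lambda>_. c) \<theta>"
    by (simp add: F(3) fun_eq_iff ext_d0_def dird_mult Omega0_smooth F smult1_def algebra_simps)
  then show ?thesis
    unfolding B1_def using Omega0_mult[OF Omega0_const F(1)] ideal1.smult[OF Omega0_const F(2)] by blast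
qed

lemma B1_diff: "\<alpha> \<in> B1 f \<Longrightarrow> \<beta> \<in> B1 f \<Longrightarrow> \<alpha> - \<beta> \<in> B1 f"
proof -
  assume "\<alpha> \<in> B1 f" "\<beta> \<in> B1 f"
  then have "\<alpha> + smult1 (\<lambda>_. -1) \<beta> \<in> B1 f" by (intro B1_add B1_scale)
  moreover have "\<alpha> + smult1 (\<lambda>_. -1) \<beta> = \<alpha> - \<beta>" by (simp add: fun_eq_iff smult1_def)
  ultimately show ?thesis by simp
qed

lemma B1_0: "0 \<in> B1 f"
  using ideal1_B1[OF ideal1_0] by (simp add: zero_fun_def)

lemma ideal2_wedge_swap: "\<theta> \<in> ideal1 f \<Longrightarrow> \<beta> \<in> Omega1 \<Longrightarrow> wedge \<theta> \<beta> \<in> ideal2 f"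
proof -
  assume "\<theta> \<in> ideal1 f" "\<beta> \<in> Omega1"
  then have "smult2 (\<lambda>p. -1) (wedge \<beta> \<theta>) \<in> ideal2 f"
    by (intro ideal2.smult ideal2.wedge Omega0_const)
  moreover have "smult2 (\<lambda>p. -1) (wedge \<beta> \<theta>) = wedge \<theta> \<beta>"
    by (simp add: fun_eq_iff smult2_def wedge_def)
  ultimately show ?thesis by simp
qed

text \<open>Modulo the ideal the differential is (e B - e' A) times \<open>zeta\<close> wedge its
  conjugate.\<close>

lemma has_symbol_Z1:
  assumes s: "has_symbol \<alpha> A B" and eq: "e B = eb A"
  shows "\<alpha> \<in> Z1 f"
proof -
  obtain \<theta> where \<theta>: "\<theta> \<in> ideal1 f" "\<alpha> = (\<lambda>p v. A p * zc v + B p * cnj (zc v) + \<theta> p v)"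
    "A \<in> Omega0" "B \<in> Omega0" using s by (auto simp: has_symbol_def)
  obtain \<theta>A where A: "\<theta>A \<in> ideal1 f" "ext_d0 A = (\<lambda>p v. e A p * zc v + eb A p * cnj (zc v) + \<theta>A p v)"
    using has_symbol_ext_d0[OF \<theta>(3)] unfolding has_symbol_def by blast
  obtain \<theta>B where B: "\<theta>B \<in> ideal1 f" "ext_d0 B = (\<lambda>p v. e B p * zc v + eb B p * cnj (zc v) + \<theta>B p v)"
    using has_symbol_ext_d0[OF \<theta>(4)] unfolding has_symbol_def by blast
  have dA: "dird v A p = e A p * zc v + eb A p * cnj (zc v) + \<theta>A p v"
    "dird v B p = e B p * zc v + eb B p * cnj (zc v) + \<theta>B p v" for v p
    using A(2) B(2) by (auto simp: ext_d0_def fun_eq_iff)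
  have D: "dird v (\<lambda>p. \<alpha> p w) p = dird v A p * zc w + dird v B p * cnj (zc w) + dird v (\<lambda>p. \<theta> p w) p" for v w p
    using Omega0_smooth[OF \<theta>(3)] Omega0_smooth[OF \<theta>(4)] Omega1_smooth[OF ideal1_Omega1[OF \<theta>(1)]]
    by (simp add: \<theta>(2) dird_add dird_mult smooth_add smooth_mult)
  have "ext_d1 \<alpha> = (wedge \<theta>A zeta + wedge \<theta>B (cnj1 zeta)) + ext_d1 \<theta>"
    by (simp add: fun_eq_iff ext_d1_def D dA eq wedge_def zeta_def cnj1_def algebra_simps)
  also have "\<dots> \<in> ideal2 f"
    by (intro ideal2.add ideal2.ext_d ideal2_wedge_swap Omega1_zeta Omega1_cnj1 A(1) B(1) \<theta>(1))
  finally show ?thesis using has_symbol_Omega1[OF s] by (simp add: Z1_def)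
qed

lemma H1_class_eq:
  assumes "\<alpha> \<in> Z1 f"
  shows "H1_class f \<alpha> = {\<beta> \<in> Z1 f. \<beta> - \<alpha> \<in> B1 f}"
  using assms by (auto simp: H1_class_def cohomologous_def)

lemma H1_class_eq_iff:
  assumes "\<alpha> \<in> Z1 f" "\<beta> \<in> Z1 f"
  shows "H1_class f \<alpha> = H1_class f \<beta> \<longleftrightarrow> \<beta> - \<alpha> \<in> B1 f"
proof
  assume "H1_class f \<alpha> = H1_class f \<beta>"
  moreover have "\<beta> \<in> H1_class f \<beta>" using assms B1_0 by (simp add: H1_class_eq)
  ultimately have "\<beta> \<in> H1_class f \<alpha>" by simp
  then show "\<beta> - \<alpha> \<in> B1 f" unfolding H1_class_eq[OF assms(1)] by simp
next
  assume *: "\<beta> - \<alpha> \<in> B1 f"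
  have "\<gamma> - \<alpha> \<in> B1 f \<longleftrightarrow> \<gamma> - \<beta> \<in> B1 f" for \<gamma>
  proof
    show "\<gamma> - \<beta> \<in> B1 f" if "\<gamma> - \<alpha> \<in> B1 f"
      using B1_diff[OF that *] unfolding diff_diff_eq2[symmetric] by (simp add: algebra_simps)
    show "\<gamma> - \<alpha> \<in> B1 f" if "\<gamma> - \<beta> \<in> B1 f"
      using B1_add[OF that *] by (simp only: diff_add_cancel add_diff_eq)
  qed
  then show "H1_class f \<alpha> = H1_class f \<beta>" using assms by (simp add: H1_class_eq)
qed

lemma H1_class_in: "\<alpha> \<in> Z1 f \<Longrightarrow> H1_class f \<alpha> \<in> H1bar f"
  unfolding H1_class_def H1bar_def by (rule quotientI)

lemma Z1_add:
  assumes "\<alpha> \<in> Z1 f" "\<beta> \<in> Z1 f" shows "\<alpha> + \<beta> \<in> Z1 f"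
proof -
  have o: "\<alpha> \<in> Omega1" "\<beta> \<in> Omega1" using assms by (auto simp: Z1_def)
  have "ext_d1 (\<alpha> + \<beta>) = ext_d1 \<alpha> + ext_d1 \<beta>"
    using o by (simp add: fun_eq_iff ext_d1_def dird_add Omega1_smooth)
  then show ?thesis using assms o by (simp add: Z1_def Omega1_add ideal2.add)
qed

lemma Z1_scale:
  assumes "\<alpha> \<in> Z1 f" shows "smult1 (\<lambda>_. c) \<alpha> \<in> Z1 f"
proof -
  have o: "\<alpha> \<in> Omega1" using assms by (auto simp: Z1_def)
  have "ext_d1 (smult1 (\<lambda>_. c) \<alpha>) = smult2 (\<lambda>_. c) (ext_d1 \<alpha>)"
    using o by (simp add: fun_eq_iff ext_d1_def dird_mult Omega1_smooth smult1_def smult2_def algebra_simps)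
  then show ?thesis
    using assms o by (simp add: Z1_def Omega1_smult1 ideal2.smult Omega0_const)
qed

text \<open>All classes in the union over representatives coincide, and the union is nonempty
  because a cocycle lies in its own class.\<close>

lemma H1_add_class:
  assumes "\<alpha> \<in> Z1 f" "\<beta> \<in> Z1 f"
  shows "H1_add f (H1_class f \<alpha>) (H1_class f \<beta>) = H1_class f (\<alpha> + \<beta>)"
proof -
  have "H1_class f (\<alpha>' + \<beta>') = H1_class f (\<alpha> + \<beta>)"
    if "\<alpha>' \<in> H1_class f \<alpha>" "\<beta>' \<in> H1_class f \<beta>" for \<alpha>' \<beta>'
  proof -
    have *: "\<alpha>' \<in> Z1 f" "\<beta>' \<in> Z1 f" "\<alpha>' - \<alpha> \<in> B1 f" "\<beta>' - \<beta> \<in> B1 f"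
      using that assms by (auto simp: H1_class_eq)
    have "(\<alpha>' + \<beta>') - (\<alpha> + \<beta>) = (\<alpha>' - \<alpha>) + (\<beta>' - \<beta>)" by simp
    then have "(\<alpha>' + \<beta>') - (\<alpha> + \<beta>) \<in> B1 f" using B1_add[OF *(3,4)] by metis
    then show ?thesis
      using H1_class_eq_iff[OF Z1_add[OF assms] Z1_add[OF *(1,2)]] by simp
  qed
  then have "H1_add f (H1_class f \<alpha>) (H1_class f \<beta>) =
      (\<Union>\<alpha>'\<in>H1_class f \<alpha>. \<Union>\<beta>'\<in>H1_class f \<beta>. H1_class f (\<alpha> + \<beta>))"
    unfolding H1_add_def by (intro SUP_cong refl)
  moreover have "\<alpha> \<in> H1_class f \<alpha>" "\<beta> \<in> H1_class f \<beta>" using assms B1_0 by (simp_all add: H1_class_eq)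
  then have "H1_class f \<alpha> \<noteq> {}" "H1_class f \<beta> \<noteq> {}" by auto
  ultimately show ?thesis by simp
qed

lemma H1_scale_class:
  assumes "\<alpha> \<in> Z1 f"
  shows "H1_scale f c (H1_class f \<alpha>) = H1_class f (smult1 (\<lambda>_. c) \<alpha>)"
proof -
  have "H1_class f (smult1 (\<lambda>_. c) \<alpha>') = H1_class f (smult1 (\<lambda>_. c) \<alpha>)"
    if "\<alpha>' \<in> H1_class f \<alpha>" for \<alpha>'
  proof -
    have *: "\<alpha>' \<in> Z1 f" "\<alpha>' - \<alpha> \<in> B1 f" using that assms by (auto simp: H1_class_eq)
    have "smult1 (\<lambda>_. c) \<alpha>' - smult1 (\<lambda>_. c) \<alpha> = smult1 (\<lambda>_. c) (\<alpha>' - \<alpha>)"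
      by (simp add: fun_eq_iff smult1_def algebra_simps)
    then show ?thesis
      using H1_class_eq_iff[OF Z1_scale[OF assms] Z1_scale[OF *(1)]] B1_scale[OF *(2)] by metis
  qed
  then have "H1_scale f c (H1_class f \<alpha>) = (\<Union>\<alpha>'\<in>H1_class f \<alpha>. H1_class f (smult1 (\<lambda>_. c) \<alpha>))"
    unfolding H1_scale_def by (intro SUP_cong refl)
  moreover have "\<alpha> \<in> H1_class f \<alpha>" using assms B1_0 by (simp add: H1_class_eq)
  then have "H1_class f \<alpha> \<noteq> {}" by auto
  ultimately show ?thesis by simp
qed

section \<open>Contraction of \<open>Phi\<close> with the rotation field\<close>

lemma partial_q:
  "q_fun \<in> Omega0" "e q_fun = (\<lambda>p. zc p * uj 1 p + uj 0 p + cnj (zc p) * T 0 p)"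
  "eb q_fun = (\<lambda>p. - cnj (e q_fun p))"
proof -
  have q: "q_fun = (\<lambda>p. zc p * uj 0 p - cnj (zc p) * cnj (uj 0 p))"
    by (simp add: fun_eq_iff q_fun_def)
  show "q_fun \<in> Omega0" unfolding q by (simp add: Omega0_intros)
  show eq: "e q_fun = (\<lambda>p. zc p * uj 1 p + uj 0 p + cnj (zc p) * T 0 p)" unfolding q
    by (simp add: e_m1_rules Omega0_intros e_uj e_fst algebra_simps)
  show "eb q_fun = (\<lambda>p. - cnj (e q_fun p))" unfolding eq unfolding q
    by (simp add: e_m1_rules Omega0_intros e_uj e_fst algebra_simps fun_eq_iff)
qed

text \<open>The \<open>eta f 0\<close>-component identifies \<open>q_fun\<close> as the generating
  function of rotations.\<close>

lemma eta_v_rot: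
  "zeta p (v_rot p) = - \<i> * zc p" "eta f 0 p (v_rot p) = \<i> * q_fun p"
  "omega_Suc f 0 p (v_rot p) = \<i> * uj 0 p + \<i> * cnj (zc p) * T 0 p"
  "(\<lambda>p. eta f i p (v_rot p)) \<in> Omega0"
proof -
  show "zeta p (v_rot p) = - \<i> * zc p" "eta f 0 p (v_rot p) = \<i> * q_fun p"
    "omega_Suc f 0 p (v_rot p) = \<i> * uj 0 p + \<i> * cnj (zc p) * T 0 p"
    by (simp_all add: v_rot_eq zeta_def omega_Suc_def q_fun_def algebra_simps)
  show "(\<lambda>p. eta f i p (v_rot p)) \<in> Omega0"
    by (cases i) (simp_all add: v_rot_eq zeta_def omega_Suc_def Omega0_intros T_Omega0 del: jetT.simps)
qed

lemma J_op_ext_d0: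
  assumes "P \<in> Omega0" "of_order k P"
  shows "J_op f (ext_d0 P) p v = (\<i> * e P p) * zc v + (- \<i> * eb P p) * cnj (zc v) + (d_u P p * eta f 0 p v
     + (\<Sum>i\<le>k. (\<i> * d_uj i P p) * eta f (Suc i) p v + (- \<i> * d_ujbar i P p) * cnj (eta f (Suc i) p v)))"
proof -
  have "eta f 0 p (J_vec f p v) = eta f 0 p v" "eta f (Suc i) p (J_vec f p v) = \<i> * eta f (Suc i) p v"
    "zc (J_vec f p v) = \<i> * zc v" for i
    using fun_cong[OF fun_cong[OF J_op_eta_0[of f]], of p v] fun_cong[OF fun_cong[OF J_op_eta_Suc[of f i]], of p v]
    by (simp_all add: J_op_def smult1_def J_vec_def)
  then show ?thesis
    by (simp add: J_op_def ext_d0_def dird_eta[OF assms] mult_ac del: eta.simps)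
qed

lemma e_pow_0: "(e ^^ m) (\<lambda>p. 0) = (\<lambda>p. 0)"
  by (induction m) simp_all

lemma Omega0_e_pow: "F \<in> Omega0 \<Longrightarrow> (e ^^ m) F \<in> Omega0"
  by (induction m) (simp_all add: Omega0_e)

lemma B_coeff_sum:
  assumes "of_order k P" "i \<ge> 1"
  shows "B_coeff f i j P p = \<i> * (\<Sum>m\<le>k. (- 1) powi (int m - int i + 1)
     * of_nat ((m + i - 1) choose (i - 1)) * (e ^^ m) (d_uj (m + i + j - 1) P) p)"
proof -
  have "(- 1) powi (int m - int i + 1) * of_nat ((m + i - 1) choose (i - 1)) * (e ^^ m) (d_uj (m + i + j - 1) P) p = 0"
    if "m \<notin> {..k}" for m
  proof -
    have "d_uj (m + i + j - 1) P = (\<lambda>p. 0)"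
      using that assms(2) by (intro d_uj_order[OF assms(1)]) auto
    then show ?thesis by (simp add: e_pow_0)
  qed
  from suminf_finite[OF finite_atMost this] show ?thesis
    unfolding B_coeff_def by simp
qed

lemma B_coeff_Omega0:
  assumes "P \<in> Omega0" "i \<ge> 1" shows "B_coeff f i j P \<in> Omega0"
proof -
  obtain k where k: "of_order k P" using assms by (auto simp: Omega0_iff)
  show ?thesis
    unfolding B_coeff_sum[OF k assms(2), abs_def]
    using assms(1) by (intro Omega0_intros Omega0_e_pow)
qed

lemma B_coeff_eq_0:
  assumes "of_order k P" "i \<ge> 1" "j > k" shows "B_coeff f i j P p = 0"
proof -
  have "d_uj (m + i + j - 1) P = (\<lambda>p. 0)" for m
    using assms by (intro d_uj_order[OF assms(1)]) auto
  then show ?thesis unfolding B_coeff_sum[OF assms(1,2)] by (simp add: e_pow_0)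
qed

text \<open>The summand with \<open>J_op\<close> contributes q dP, since J multiplies the two
  horizontal parts of dP by \<open>\<i>\<close> and \<open>- \<i>\<close>; the contraction of
  \<open>psi\<close> contributes the terms P e q and P e' q. Everything else contains a factor from
  the ideal.\<close>

lemma has_symbol_Phi:
  assumes P: "P \<in> Omega0"
  shows "has_symbol (interior v_rot (Phi f P)) (\<lambda>p. (q_fun p * e P p - P p * e q_fun p) / 2)
     (\<lambda>p. - (q_fun p * eb P p - P p * eb q_fun p) / 2)"
proof -
  obtain k where k: "of_order k P" using P by (auto simp: Omega0_iff)
  have k': "of_order k (cnj \<circ> P)" using k by (simp add: of_order_def)
  have P': "cnj \<circ> P \<in> Omega0" using Omega0_cnj[OF P] by (simp add: o_def)
  let ?J = "\<lambda>p v. d_u P p * eta f 0 p v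
     + (\<Sum>i\<le>k. (\<i> * d_uj i P p) * eta f (Suc i) p v + (- \<i> * d_ujbar i P p) * cnj (eta f (Suc i) p v))"
  let ?Jv = "\<lambda>p. J_op f (ext_d0 P) p (v_rot p)"
  let ?X = "\<lambda>i j p w. B_coeff f i j P p * wedge (eta f i) (eta f j) p (v_rot p) w
          + cnj (B_coeff f i j (cnj \<circ> P) p) * wedge (cnj1 (eta f i)) (cnj1 (eta f j)) p (v_rot p) w"
  have Jv: "?Jv \<in> Omega0"
  proof -
    have "zc (v_rot p) = - \<i> * zc p" for p using eta_v_rot(1) by (simp add: zeta_def)
    then show ?thesis unfolding J_op_ext_d0[OF P k] using P
      by (simp add: Omega0_intros eta_v_rot(4) Omega0_e Omega0_eb del: eta.simps)
  qed
  \<comment> \<open>Contracting a product of two generators of the ideal leaves one generator in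
    each term.\<close>
  have X: "?X i j \<in> ideal1 f" if "i \<ge> 1" for i j
  proof -
    have "?X i j = (\<lambda>p w.
       (B_coeff f i j P p * eta f i p (v_rot p)) * eta f j p w - (B_coeff f i j P p * eta f j p (v_rot p)) * eta f i p w
       + ((cnj (B_coeff f i j (cnj \<circ> P) p) * cnj (eta f i p (v_rot p))) * cnj (eta f j p w)
         - (cnj (B_coeff f i j (cnj \<circ> P) p) * cnj (eta f j p (v_rot p))) * cnj (eta f i p w)))"
      by (simp add: fun_eq_iff wedge_def cnj1_def algebra_simps del: eta.simps)
    also have "\<dots> \<in> ideal1 f"
      by (intro ideal1_add' ideal1_diff' ideal1_smult' ideal1_eta Omega0_mult Omega0_cnj eta_v_rot(4) B_coeff_Omega0 P P' that)
    finally show ?thesis .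
  qed
  have S: "(\<Sum>j. \<Sum>i\<in>{1..<j}. ?X i j p w) = (\<Sum>j\<le>k. \<Sum>i\<in>{1..<j}. ?X i j p w)" for p w
    by (rule suminf_finite) (auto simp: B_coeff_eq_0[OF k] B_coeff_eq_0[OF k'] simp del: eta.simps)
  let ?\<theta> = "\<lambda>p w. (((- \<i> / 2) * q_fun p) * ?J p w + (1/2 * ?Jv p) * eta f 0 p w
      + (((- 1 / 2) * (zc p * P p)) * eta f 1 p w + ((- 1 / 2) * (cnj (zc p) * P p)) * cnj (eta f 1 p w)))
      + (\<Sum>j\<le>k. \<Sum>i\<in>{1..<j}. ?X i j p w)"
  have psi: "psi f p (v_rot p) w = - (1/2) * (e q_fun p * zc w + cnj (e q_fun p) * cnj (zc w))
      + (- 1 / 2) * (zc p * eta f 1 p w + cnj (zc p) * cnj (eta f 1 p w))" for p w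
  proof -
    have im: "complex_of_real (Im x) = (x - cnj x) / (2 * \<i>)" for x
      by (simp add: complex_eq_iff)
    have om: "omega_Suc f 0 p w = eta f 1 p w + uj 1 p * zc w" by (simp add: zeta_def)
    have "wedge zeta (omega_Suc f 0) p (v_rot p) w = - \<i> * (zc p * eta f 1 p w + e q_fun p * zc w)"
      unfolding wedge_def eta_v_rot om partial_q(2) by (simp add: zeta_def algebra_simps)
    then have h: "psi f p (v_rot p) w = (- \<i> * (zc p * eta f 1 p w + e q_fun p * zc w)
        - \<i> * (cnj (zc p) * cnj (eta f 1 p w) + cnj (e q_fun p) * cnj (zc w))) / (2 * \<i>)"
      unfolding psi_def im by (simp del: eta.simps)
    have "(- \<i> * X - \<i> * Y) / (2 * \<i>) = - (1/2) * (X + Y)" for X Y :: complex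
      by (simp add: field_simps)
    then show ?thesis unfolding h by (simp only:) (simp add: algebra_simps del: eta.simps)
  qed
  have alg: "- (1/2) * (\<i> * q * ((\<i> * E) * z + (- \<i> * Eb) * zb + J) - h * Jv)
      + P0 * (- (1/2) * (Q * z + Qb * zb) + (- 1 / 2) * (c * g + cb * gb)) + S
    = (q * E - P0 * Q) / 2 * z + - (q * Eb - P0 * - Qb) / 2 * zb
      + (((- \<i> / 2) * q) * J + (1/2 * Jv) * h + (((- 1 / 2) * (c * P0)) * g + ((- 1 / 2) * (cb * P0)) * gb) + S)"
    for q E z Eb zb J h Jv P0 Q Qb c g cb gb S :: complex
    by (simp add: field_simps)
  show ?thesis
  proof (rule has_symbolI[where \<theta> = ?\<theta>])
    have XS: "(\<lambda>p w. \<Sum>j\<le>k. \<Sum>i\<in>{1..<j}. ?X i j p w) \<in> ideal1 f"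
      by (rule ideal1_sum', rule ideal1_sum', rule X) simp
    show "?\<theta> \<in> ideal1 f"
      by (rule ideal1_add'[OF _ XS], intro ideal1_add' ideal1_smult' ideal1_sum' ideal1_eta Omega0_intros)
        (use P Jv partial_q(1) in auto)
    show "interior v_rot (Phi f P) p w = (q_fun p * e P p - P p * e q_fun p) / 2 * zc w
       + - (q_fun p * eb P p - P p * eb q_fun p) / 2 * cnj (zc w) + ?\<theta> p w" for p w
    proof -
      have "interior v_rot (Phi f P) p w = - (1/2) * (\<i> * q_fun p * J_op f (ext_d0 P) p w - eta f 0 p w * ?Jv p)
        + P p * psi f p (v_rot p) w + (\<Sum>j\<le>k. \<Sum>i\<in>{1..<j}. ?X i j p w)"
        unfolding interior_def Phi_def S
        by (simp only: wedge_def[of "eta f 0"] eta_v_rot(2))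
      also have "J_op f (ext_d0 P) p w = (\<i> * e P p) * zc w + (- \<i> * eb P p) * cnj (zc w) + ?J p w"
        by (rule J_op_ext_d0[OF P k])
      finally show ?thesis unfolding psi partial_q(3) by (simp only: alg)
    qed
  qed (use P partial_q(1) in \<open>simp_all add: Omega0_intros Omega0_e Omega0_eb\<close>)
qed

end

section \<open>The kernel of \<open>e_m1bar\<close>\<close>

lemma smooth_affine:
  assumes F: "smooth F" and A: "continuous_on UNIV A" "\<And>p v t. A (p + t *\<^sub>R v) = A p + t *\<^sub>R L v"
  shows "smooth (\<lambda>p. F (A p))" "dird v (\<lambda>p. F (A p)) = (\<lambda>p. dird (L v) F (A p))"
proof -
  have D: "dird v (\<lambda>p. F (A p)) = (\<lambda>p. dird (L v) F (A p))" for F v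
    by (rule ext) (simp add: dird_def A(2))
  show "dird v (\<lambda>p. F (A p)) = (\<lambda>p. dird (L v) F (A p))" by (rule D)
  have "Ck n (\<lambda>p. F (A p))" if "smooth F" for n F
    using that
  proof (induction n arbitrary: F)
    case 0
    then show ?case using continuous_on_compose[OF A(1), of F]
      by (simp add: o_def continuous_on_subset[OF smooth_continuous])
  next
    case (Suc n)
    have "continuous_on UNIV (\<lambda>p. F (A p))" using continuous_on_compose[OF A(1), of F] Suc.prems
      by (simp add: o_def continuous_on_subset[OF smooth_continuous])
    then show ?case
      using Suc by (simp add: D A(2) differentiable_smooth smooth_dird)
  qed
  then show "smooth (\<lambda>p. F (A p))" using F by (simp add: smooth_def)
qed

section \<open>Freezing \<open>u\<close> and scaling the jets\<close>

definition freeze_u :: "real \<Rightarrow> jet \<Rightarrow> jet" where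
  "freeze_u a p = (zc p, a, snd (snd p))"

text \<open>The exponents are chosen so that T^i becomes homogeneous of degree i. At t = 0 this is
  the projection to the zero section, where all jets vanish while z and \<open>u\<close> are
  kept.\<close>

definition dilate :: "real \<Rightarrow> jet \<Rightarrow> jet" where
  "dilate t p = (zc p, uc p, \<lambda>j. of_real (t ^ Suc j) * uj j p)"

lemma continuous_jetI:
  assumes "continuous_on S (\<lambda>x. zc (A x))" "continuous_on S (\<lambda>x. uc (A x))" "\<And>j. continuous_on S (\<lambda>x. uj j (A x))"
  shows "continuous_on S A"
proof -
  have "continuous_on S (\<lambda>x. (zc (A x), uc (A x), \<lambda>j. uj j (A x)))"
    by (intro continuous_on_Pair continuous_on_coordinatewise_then_product assms)
  then show ?thesis by simp
qed

lemma continuous_uj: "continuous_on UNIV (\<lambda>p::jet. uj j p)"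
  using smooth_continuous[OF Omega0_smooth[OF Omega0_uj]] .

lemma continuous_uc: "continuous_on UNIV (\<lambda>p::jet. uc p)" "continuous_on UNIV (\<lambda>p::jet. zc p)"
  by (intro continuous_intros)+

lemma smooth_freeze_u:
  assumes "smooth F"
  shows "smooth (\<lambda>p. F (freeze_u a p))"
    "dird v (\<lambda>p. F (freeze_u a p)) = (\<lambda>p. dird (zc v, 0, snd (snd v)) F (freeze_u a p))"
proof -
  have A: "continuous_on UNIV (freeze_u a)"
    by (rule continuous_jetI) (simp_all add: freeze_u_def continuous_uj continuous_uc)
  show "smooth (\<lambda>p. F (freeze_u a p))"
    "dird v (\<lambda>p. F (freeze_u a p)) = (\<lambda>p. dird (zc v, 0, snd (snd v)) F (freeze_u a p))"
    by (rule smooth_affine[OF assms A, where L = "\<lambda>v. (zc v, 0, snd (snd v))"]; simp add: freeze_u_def)+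
qed

lemma smooth_dilate:
  assumes "smooth F"
  shows "smooth (\<lambda>p. F (dilate t p))"
    "dird v (\<lambda>p. F (dilate t p)) = (\<lambda>p. dird (dilate t v) F (dilate t p))"
proof -
  have A: "continuous_on UNIV (dilate t)"
    by (rule continuous_jetI) (simp_all add: dilate_def continuous_uj continuous_uc continuous_on_mult_left)
  show "smooth (\<lambda>p. F (dilate t p))"
    "dird v (\<lambda>p. F (dilate t p)) = (\<lambda>p. dird (dilate t v) F (dilate t p))"
    by (rule smooth_affine[OF assms A, where L = "dilate t"]; simp add: dilate_def fun_eq_iff scaleR_fun_def algebra_simps)+
qed

lemma Omega0_freeze_u:
  assumes "F \<in> Omega0"
  shows "(\<lambda>p. F (freeze_u a p)) \<in> Omega0" "d_u (\<lambda>p. F (freeze_u a p)) = (\<lambda>p. 0)"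
    "d_z (\<lambda>p. F (freeze_u a p)) = (\<lambda>p. d_z F (freeze_u a p))"
    "d_zbar (\<lambda>p. F (freeze_u a p)) = (\<lambda>p. d_zbar F (freeze_u a p))"
    "d_uj i (\<lambda>p. F (freeze_u a p)) = (\<lambda>p. d_uj i F (freeze_u a p))"
    "d_ujbar i (\<lambda>p. F (freeze_u a p)) = (\<lambda>p. d_ujbar i F (freeze_u a p))"
proof -
  have s: "smooth F" using assms by (rule Omega0_smooth)
  obtain k where "of_order k F" using assms by (auto simp: Omega0_iff)
  then have "of_order k (\<lambda>p. F (freeze_u a p))" by (auto simp: of_order_def same_proj_def freeze_u_def)
  then show "(\<lambda>p. F (freeze_u a p)) \<in> Omega0" using smooth_freeze_u(1)[OF s] by (auto simp: Omega0_iff)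
  have "(0, 0, 0) = (0 :: jet)" by (simp add: zero_prod_def)
  then show "d_u (\<lambda>p. F (freeze_u a p)) = (\<lambda>p. 0)"
    using dird_0 by (simp add: fun_eq_iff d_u_def smooth_freeze_u(2)[OF s])
  show "d_z (\<lambda>p. F (freeze_u a p)) = (\<lambda>p. d_z F (freeze_u a p))"
    "d_zbar (\<lambda>p. F (freeze_u a p)) = (\<lambda>p. d_zbar F (freeze_u a p))"
    "d_uj i (\<lambda>p. F (freeze_u a p)) = (\<lambda>p. d_uj i F (freeze_u a p))"
    "d_ujbar i (\<lambda>p. F (freeze_u a p)) = (\<lambda>p. d_ujbar i F (freeze_u a p))"
    by (simp_all add: fun_eq_iff d_z_def d_zbar_def d_uj_def d_ujbar_def smooth_freeze_u(2)[OF s])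
qed

lemma line_const:
  assumes "smooth F" "\<And>t. dird v F (p + t *\<^sub>R v) = 0"
  shows "F (p + t *\<^sub>R v) = F p"
proof -
  have "((\<lambda>t. F (p + t *\<^sub>R v)) has_vector_derivative 0) (at t within UNIV)" for t
    using smooth_line[OF assms(1), of p v t] assms(2) by simp
  then show ?thesis
  proof (rule has_vector_derivative_zero_constant[OF convex_UNIV])
    fix c assume "\<And>x. x \<in> UNIV \<Longrightarrow> F (p + x *\<^sub>R v) = c"
    from this[of t] this[of 0] show ?thesis by simp
  qed
qed

lemma freeze_u_const:
  assumes "F \<in> Omega0" "d_u F = (\<lambda>p. 0)" shows "F (freeze_u a p) = F p"
proof -
  have "F (p + (a - uc p) *\<^sub>R (0, 1, 0)) = F p"
    by (rule line_const) (use assms in \<open>simp_all add: Omega0_smooth d_u_def fun_eq_iff\<close>)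
  moreover have "p + (a - uc p) *\<^sub>R (0, 1, 0) = freeze_u a p"
    by (cases p) (simp add: freeze_u_def scaleR_fun_def fun_eq_iff)
  ultimately show ?thesis by simp
qed

lemma partial_dilate:
  assumes "F \<in> Omega0"
  shows "d_z (\<lambda>p. F (dilate t p)) = (\<lambda>p. d_z F (dilate t p))"
    "d_zbar (\<lambda>p. F (dilate t p)) = (\<lambda>p. d_zbar F (dilate t p))"
    "d_uj l (\<lambda>p. F (dilate t p)) = (\<lambda>p. of_real (t ^ Suc l) * d_uj l F (dilate t p))"
    "d_u (\<lambda>p. F (dilate t p)) = (\<lambda>p. d_u F (dilate t p))" "(\<lambda>p. F (dilate t p)) \<in> Omega0"
proof -
  note s = Omega0_smooth[OF assms]
  have "dilate t (c, 0, 0) = (c, 0, 0)" for c by (simp add: dilate_def fun_eq_iff)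
  then show "d_z (\<lambda>p. F (dilate t p)) = (\<lambda>p. d_z F (dilate t p))"
    "d_zbar (\<lambda>p. F (dilate t p)) = (\<lambda>p. d_zbar F (dilate t p))"
    by (simp_all add: d_z_def[abs_def] d_zbar_def[abs_def] smooth_dilate(2)[OF s])
  have v: "dilate t (0, 0, 0(l := c)) = t ^ Suc l *\<^sub>R (0, 0, 0(l := c))" for c
    by (auto simp: dilate_def scaleR_fun_def fun_eq_iff scaleR_conv_of_real)
  show "d_uj l (\<lambda>p. F (dilate t p)) = (\<lambda>p. of_real (t ^ Suc l) * d_uj l F (dilate t p))"
    unfolding d_uj_def[abs_def] smooth_dilate(2)[OF s] v dird_scale[OF s]
    by (simp add: fun_eq_iff scaleR_conv_of_real algebra_simps)
  have "dilate t (0, 1, 0) = (0, 1, 0)" by (simp add: dilate_def fun_eq_iff)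
  then show "d_u (\<lambda>p. F (dilate t p)) = (\<lambda>p. d_u F (dilate t p))"
    by (simp add: d_u_def[abs_def] smooth_dilate(2)[OF s])
  obtain k where "of_order k F" using assms by (auto simp: Omega0_iff)
  then have "of_order k (\<lambda>p. F (dilate t p))" by (auto simp: of_order_def same_proj_def dilate_def)
  then show "(\<lambda>p. F (dilate t p)) \<in> Omega0" using smooth_dilate(1)[OF s] by (auto simp: Omega0_iff)
qed

text \<open>Homogeneity of weight \<open>i - k\<close>, where \<open>u\<^sub>j\<close> has weight \<open>j + 1\<close>.\<close>
definition weight :: "nat \<Rightarrow> nat \<Rightarrow> (jet \<Rightarrow> complex) \<Rightarrow> bool" where
  "weight i k F \<longleftrightarrow> (\<forall>t>0. \<forall>p. of_real (t ^ k) * F (dilate t p) = of_real (t ^ i) * F p)"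

lemma weight_d_uj:
  assumes "F \<in> Omega0" "weight i k F" shows "weight i (k + Suc l) (d_uj l F)"
  unfolding weight_def
proof (intro allI impI)
  fix t :: real and p assume "t > 0"
  then have "(\<lambda>p. of_real (t ^ k) * F (dilate t p)) = (\<lambda>p. of_real (t ^ i) * F p)"
    using assms(2) by (simp add: weight_def)
  then have "d_uj l (\<lambda>p. of_real (t ^ k) * F (dilate t p)) p = d_uj l (\<lambda>p. of_real (t ^ i) * F p) p"
    by simp
  then show "of_real (t ^ (k + Suc l)) * d_uj l F (dilate t p) = of_real (t ^ i) * d_uj l F p"
    by (simp add: partial_rules Omega0_intros partial_dilate assms(1) power_add mult_ac)
qed

lemma weight_mult: "weight i k F \<Longrightarrow> weight j l G \<Longrightarrow> weight (i + j) (k + l) (\<lambda>p. F p * G p)"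
  unfolding weight_def
proof (intro allI impI)
  fix t :: real and p
  assume "\<forall>t>0. \<forall>p. of_real (t ^ k) * F (dilate t p) = of_real (t ^ i) * F p"
    "\<forall>t>0. \<forall>p. of_real (t ^ l) * G (dilate t p) = of_real (t ^ j) * G p" "t > 0"
  then have "(of_real (t ^ k) * F (dilate t p)) * (of_real (t ^ l) * G (dilate t p))
    = (of_real (t ^ i) * F p) * (of_real (t ^ j) * G p)" by metis
  then show "of_real (t ^ (k + l)) * (F (dilate t p) * G (dilate t p)) = of_real (t ^ (i + j)) * (F p * G p)"
    by (simp add: power_add mult_ac)
qed

lemma weight_diff: "weight i k F \<Longrightarrow> weight i k G \<Longrightarrow> weight i k (\<lambda>p. F p - G p)"
  by (simp add: weight_def algebra_simps)

lemma weight_sum: "(\<And>l. l \<in> A \<Longrightarrow> weight i k (F l)) \<Longrightarrow> weight i k (\<lambda>p. \<Sum>l\<in>A. F l p)"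
  by (simp add: weight_def sum_distrib_left)

lemma weight_cancel: "weight (l + i) (l + k) F \<Longrightarrow> weight i k F"
  by (simp add: weight_def power_add mult.assoc)

lemma dilate_tendsto:
  assumes "smooth F" shows "((\<lambda>t. F (dilate t p)) \<longlongrightarrow> F (dilate 0 p)) (at_right 0)"
proof -
  have "continuous_on UNIV (\<lambda>t. dilate t p)"
    by (rule continuous_jetI) (auto simp: dilate_def intro!: continuous_intros)
  then have "continuous_on UNIV (F \<circ> (\<lambda>t. dilate t p))"
    by (rule continuous_on_compose) (rule continuous_on_subset[OF smooth_continuous[OF assms]], simp)
  then have "isCont (\<lambda>t. F (dilate t p)) 0" by (simp add: o_def continuous_on_eq_continuous_at)
  then show ?thesis by (simp add: continuous_within filterlim_at_split isCont_def)
qed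

text \<open>Let t tend to 0 from above: continuity at the zero section forces negative weight to
  vanish identically, weight zero to be constant along the jets, and positive weight to vanish on
  the zero section.\<close>

lemma weight_limit:
  assumes "smooth F" "weight i k F"
  shows "i < k \<Longrightarrow> F p = 0" "i = k \<Longrightarrow> F p = F (dilate 0 p)" "k < i \<Longrightarrow> F (dilate 0 p) = 0"
proof -
  note L = dilate_tendsto[OF assms(1), of p]
  have pos: "eventually (\<lambda>t::real. t > 0) (at_right 0)" by (simp add: eventually_at_right_less)
  have P: "((\<lambda>t::real. complex_of_real (t ^ Suc n)) \<longlongrightarrow> 0) (at_right 0)" for n
  proof -
    have "((\<lambda>t::real. complex_of_real (t ^ Suc n)) \<longlongrightarrow> complex_of_real (0 ^ Suc n)) (at_right 0)"
      by (intro tendsto_intros)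
    then show ?thesis by simp
  qed
  have W: "of_real (t ^ k) * F (dilate t p) = of_real (t ^ i) * F p" if "t > 0" for t
    using assms(2) that by (simp add: weight_def)
  show "F p = 0" if ik: "i < k"
  proof -
    obtain n where n: "k = i + Suc n" using less_imp_Suc_add[OF ik] by auto
    have "of_real (t ^ Suc n) * F (dilate t p) = F p" if "t > 0" for t
      using W[OF that] that by (simp add: n power_add mult_ac)
    then have "((\<lambda>t. of_real (t ^ Suc n) * F (dilate t p)) \<longlongrightarrow> F p) (at_right 0)"
      by (intro tendsto_eventually eventually_mono[OF pos]) auto
    moreover have "((\<lambda>t. of_real (t ^ Suc n) * F (dilate t p)) \<longlongrightarrow> 0 * F (dilate 0 p)) (at_right 0)"
      by (intro tendsto_mult P L)
    ultimately show ?thesis using tendsto_unique[OF trivial_limit_at_right_real] by fastforce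
  qed
  show "F p = F (dilate 0 p)" if "i = k"
  proof -
    have "F (dilate t p) = F p" if "t > 0" for t
      using W[OF that] that \<open>i = k\<close> by simp
    then have "((\<lambda>t. F (dilate t p)) \<longlongrightarrow> F p) (at_right 0)"
      by (intro tendsto_eventually eventually_mono[OF pos]) auto
    then show ?thesis using tendsto_unique[OF trivial_limit_at_right_real _ L] by fastforce
  qed
  show "F (dilate 0 p) = 0" if ik: "k < i"
  proof -
    obtain n where n: "i = k + Suc n" using less_imp_Suc_add[OF ik] by auto
    have "F (dilate t p) = of_real (t ^ Suc n) * F p" if "t > 0" for t
      using W[OF that] that by (simp add: n power_add mult_ac)
    then have "((\<lambda>t. of_real (t ^ Suc n) * F p - F (dilate t p)) \<longlongrightarrow> 0) (at_right 0)"
      by (intro tendsto_eventually eventually_mono[OF pos]) auto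
    moreover have "((\<lambda>t. of_real (t ^ Suc n) * F p - F (dilate t p)) \<longlongrightarrow> 0 * F p - F (dilate 0 p)) (at_right 0)"
      by (intro tendsto_diff tendsto_mult P L tendsto_const)
    ultimately show ?thesis using tendsto_unique[OF trivial_limit_at_right_real] by fastforce
  qed
qed

text \<open>Finite order provides a largest index with nonzero derivative, which the step rules
  out.\<close>

lemma order_descent:
  assumes h: "h \<in> Omega0"
    and step: "\<And>m. (\<And>j. m < j \<Longrightarrow> d_uj j h = (\<lambda>p. 0)) \<Longrightarrow> d_uj m h = (\<lambda>p. 0)"
  shows "d_uj j h = (\<lambda>p. 0)"
proof (rule ccontr)
  assume "d_uj j h \<noteq> (\<lambda>p. 0)"
  then have ne: "{j. d_uj j h \<noteq> (\<lambda>p. 0)} \<noteq> {}" by blast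
  obtain k where k: "of_order k h" using h by (auto simp: Omega0_iff)
  have "i \<le> k" if "d_uj i h \<noteq> (\<lambda>p. 0)" for i
    using d_uj_order(1)[OF k, of i] that by (cases "i \<le> k") auto
  then have "{j. d_uj j h \<noteq> (\<lambda>p. 0)} \<subseteq> {..k}" by blast
  then have fin: "finite {j. d_uj j h \<noteq> (\<lambda>p. 0)}" by (rule finite_subset) simp
  define m where "m = Max {j. d_uj j h \<noteq> (\<lambda>p. 0)}"
  have "d_uj i h = (\<lambda>p. 0)" if "m < i" for i
  proof (rule ccontr)
    assume "d_uj i h \<noteq> (\<lambda>p. 0)"
    then have "i \<le> m" unfolding m_def by (intro Max_ge fin) blast
    with that show False by simp
  qed
  from step[OF this] have "d_uj m h = (\<lambda>p. 0)" .
  moreover have "m \<in> {j. d_uj j h \<noteq> (\<lambda>p. 0)}" unfolding m_def by (rule Max_in[OF fin ne])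
  ultimately show False by blast
qed

section \<open>Vector fields along the jet coordinates\<close>

definition act :: "nat \<Rightarrow> (nat \<Rightarrow> jet \<Rightarrow> complex) \<Rightarrow> (jet \<Rightarrow> complex) \<Rightarrow> jet \<Rightarrow> complex" where
  "act m Y w p = (\<Sum>i\<le>m. Y i p * d_uj i w p)"

text \<open>These are the components of the commutator Y X - X Y, with the order of the arguments
  reversed; both fields are truncated at index m.\<close>

definition bracket ::
  "nat \<Rightarrow> (nat \<Rightarrow> jet \<Rightarrow> complex) \<Rightarrow> (nat \<Rightarrow> jet \<Rightarrow> complex) \<Rightarrow> nat \<Rightarrow> jet \<Rightarrow> complex" where
  "bracket m X Y i p = (\<Sum>l\<le>m. Y l p * d_uj l (X i) p - X l p * d_uj l (Y i) p)"

lemma Omega0_bracket: "(\<And>i. X i \<in> Omega0) \<Longrightarrow> (\<And>i. Y i \<in> Omega0) \<Longrightarrow> bracket m X Y i \<in> Omega0"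
  unfolding bracket_def[abs_def] by (intro Omega0_intros)

lemma act_bracket:
  assumes "\<And>i. X i \<in> Omega0" "\<And>i. Y i \<in> Omega0" "w \<in> Omega0"
  shows "act m (bracket m X Y) w p = act m Y (act m X w) p - act m X (act m Y w) p"
proof -
  have A: "act m Y (act m X w) p = (\<Sum>l\<le>m. \<Sum>i\<le>m. Y l p * (X i p * d_uj l (d_uj i w) p + d_uj l (X i) p * d_uj i w p))"
    if "\<And>i. X i \<in> Omega0" "\<And>i. Y i \<in> Omega0" for X Y
    unfolding act_def[of m Y] unfolding act_def[abs_def]
    using that assms(3) by (simp add: partial_rules Omega0_intros sum_distrib_left)
  have "(\<Sum>l\<le>m. \<Sum>i\<le>m. Y l p * (X i p * d_uj l (d_uj i w) p)) = (\<Sum>l\<le>m. \<Sum>i\<le>m. X l p * (Y i p * d_uj l (d_uj i w) p))"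
    by (subst sum.swap)
      (simp add: derivation_commute[OF derivation_partial(4) derivation_partial(4) assms(3)] mult.left_commute)
  then have "act m Y (act m X w) p - act m X (act m Y w) p
    = (\<Sum>l\<le>m. \<Sum>i\<le>m. (Y l p * d_uj l (X i) p - X l p * d_uj l (Y i) p) * d_uj i w p)"
    unfolding A[OF assms(1,2)] A[OF assms(2,1)]
    by (simp add: distrib_left sum.distrib sum_subtractf left_diff_distrib mult.assoc)
  also have "\<dots> = act m (bracket m X Y) w p"
    unfolding act_def bracket_def by (subst sum.swap) (simp add: sum_distrib_right)
  finally show ?thesis by simp
qed

lemma act_d_zbar:
  assumes "\<And>i. Y i \<in> Omega0" "\<And>i. d_zbar (Y i) = (\<lambda>p. 0)" "w \<in> Omega0"
  shows "act m Y (d_zbar w) = d_zbar (act m Y w)"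
  unfolding act_def[abs_def] using assms
  by (simp add: partial_rules Omega0_intros derivation_commute[OF derivation_partial(2) derivation_partial(4)])

lemma d_zbar_bracket:
  assumes "\<And>i. X i \<in> Omega0" "\<And>i. Y i \<in> Omega0" "\<And>i. d_zbar (X i) = (\<lambda>p. 0)" "\<And>i. d_zbar (Y i) = (\<lambda>p. 0)"
  shows "d_zbar (bracket m X Y i) = (\<lambda>p. 0)"
  unfolding bracket_def[abs_def] using assms
  by (simp add: partial_rules Omega0_intros derivation_commute[OF derivation_partial(2) derivation_partial(4)])

text \<open>The weight of Y_l and the loss l + 1 from \<open>d_uj l\<close> combine so that l
  cancels: each bracket with X lowers the weight of every component by one.\<close>

lemma weight_bracket:
  assumes "\<And>i. X i \<in> Omega0" "\<And>i. Y i \<in> Omega0" "\<And>i. weight i 0 (X i)" "\<And>i. weight i k (Y i)"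
  shows "weight i (Suc k) (bracket m X Y i)"
  unfolding bracket_def[abs_def]
proof (intro weight_sum weight_diff)
  fix l
  show "weight i (Suc k) (\<lambda>p. Y l p * d_uj l (X i) p)"
    by (rule weight_cancel[where l = l])
      (use weight_mult[OF assms(4)[of l] weight_d_uj[OF assms(1) assms(3), of i l]] in \<open>simp add: add_ac\<close>)
  show "weight i (Suc k) (\<lambda>p. X l p * d_uj l (Y i) p)"
    by (rule weight_cancel[where l = l])
      (use weight_mult[OF assms(3)[of l] weight_d_uj[OF assms(2) assms(4), of i l]] in \<open>simp add: add_ac\<close>)
qed

context poisson
begin

text \<open>In the recursion the factor u_(n-j) has weight n - j + 1 and T^j has weight j, which add
  up to n + 1 in every summand.\<close>

lemma T_dilate: "T i (dilate t p) = of_real (t ^ i) * T i p"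
proof (induction i arbitrary: p rule: less_induct)
  case (less i)
  show ?case
  proof (cases i)
    case 0
    then show ?thesis by (simp add: dilate_def)
  next
    case (Suc n)
    have "d_u (T j) (dilate t p) = of_real (t ^ j) * d_u (T j) p" if "j \<le> n" for j
    proof -
      have "(\<lambda>p. T j (dilate t p)) = (\<lambda>p. of_real (t ^ j) * T j p)" using less[of j] that Suc by auto
      then have "d_u (\<lambda>p. T j (dilate t p)) p = d_u (\<lambda>p. of_real (t ^ j) * T j p) p" by simp
      then show ?thesis
        by (simp add: partial_dilate T_Omega0 partial_rules Omega0_intros del: jetT.simps)
    qed
    moreover have "uj (n - j) (dilate t p) = of_real (t ^ (n - j + 1)) * uj (n - j) p" for j
      by (simp add: dilate_def)
    ultimately have "T (Suc n) (dilate t p)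
        = (\<Sum>j\<le>n. of_nat (n choose j) * (of_real (t ^ (n - j + 1)) * uj (n - j) p) * (of_real (t ^ j) * d_u (T j) p))"
      by simp
    also have "\<dots> = (\<Sum>j\<le>n. of_real (t ^ Suc n) * (of_nat (n choose j) * uj (n - j) p * d_u (T j) p))"
    proof (intro sum.cong refl)
      fix j assume "j \<in> {..n}"
      then have t: "t ^ Suc n = t ^ (n - j + 1) * t ^ j" by (simp flip: power_add)
      show "of_nat (n choose j) * (of_real (t ^ (n - j + 1)) * uj (n - j) p) * (of_real (t ^ j) * d_u (T j) p)
         = of_real (t ^ Suc n) * (of_nat (n choose j) * uj (n - j) p * d_u (T j) p)"
        unfolding t of_real_mult by (simp only: mult_ac)
    qed
    finally show ?thesis unfolding Suc by (simp add: sum_distrib_left)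
  qed
qed

end

locale poisson_indep = poisson +
  assumes indep: "\<forall>a b :: real. (\<forall>x. a * f x + b * deriv f x = 0) \<longrightarrow> a = 0 \<and> b = 0"
begin

text \<open>If the second expression vanished for all b, then f'(a) f - f(a) f' would be a linear
  relation with the nonzero coefficient f(a).\<close>

lemma wronskian_pair:
  obtains a b where "f a \<noteq> 0" "f b * deriv f a - f a * deriv f b \<noteq> 0"
proof -
  have "\<not> (\<forall>x. f x = 0)" using indep[rule_format, of 1 0] by auto
  then obtain a where a: "f a \<noteq> 0" by blast
  have "\<not> (\<forall>x. deriv f a * f x + (- f a) * deriv f x = 0)"
    using indep[rule_format, of "deriv f a" "- f a"] a by auto
  then obtain b where "deriv f a * f b + (- f a) * deriv f b \<noteq> 0" by blast
  then have "f b * deriv f a - f a * deriv f b \<noteq> 0" by (simp add: mult.commute)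
  then show ?thesis using that a by blast
qed

lemma f_nonconst: obtains a b where "f a \<noteq> f b"
proof -
  have "\<exists>a b. f a \<noteq> f b"
  proof (rule ccontr)
    assume "\<not> (\<exists>a b. f a \<noteq> f b)"
    then have c: "f = (\<lambda>x. f 0)" by auto
    have "deriv f x = 0" for x by (subst c) simp
    then show False using indep[rule_format, of 0 1] by auto
  qed
  then show ?thesis using that by blast
qed

text \<open>
  As \<open>h\<close> does not depend on \<open>u\<close>, it is annihilated by \<open>d_zbar - \<Sum>T\<^sup>i \<partial>\<^sub>i\<close> for each frozen value of \<open>u\<close>.
  Iterated brackets of two of these fields lower the weight; the \<open>m\<close>-th one is a nonzero multiple of \<open>\<partial>\<^sub>m\<close>
  on functions of order \<open>m\<close>.
\<close>
lemma eb_kernel_step: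
  assumes h: "h \<in> hol" and eb: "eb h = (\<lambda>p. 0)" and top: "\<And>j. m < j \<Longrightarrow> d_uj j h = (\<lambda>p. 0)"
  shows "d_uj m h = (\<lambda>p. 0)"
proof -
  note hO = holD(2)[OF h]
  obtain k where "of_order k h" using hO by (auto simp: Omega0_iff)
  then have k: "of_order (max k m) h" by (rule of_order_mono) simp
  have E: "d_zbar h p = (\<Sum>i\<le>m. T i p * d_uj i h p)" for p
  proof -
    have "d_zbar h p = (\<Sum>i\<le>max k m. T i p * d_uj i h p)"
      using fun_cong[OF eb, of p] e_m1bar_sum[OF k order_refl hO, of f p] holD(3,4)[OF h] by simp
    also have "\<dots> = (\<Sum>i\<le>m. T i p * d_uj i h p)"
      by (rule sum.mono_neutral_right) (auto simp: top)
    finally show ?thesis .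
  qed
  have Ea: "d_zbar h p = (\<Sum>i\<le>m. T i (freeze_u a p) * d_uj i h p)" for a p
  proof -
    have "d_zbar h (freeze_u a p) = d_zbar h p" "d_uj i h (freeze_u a p) = d_uj i h p" for i
      using freeze_u_const[OF holD(2,3)[OF hol_partial(2)[OF h]]] freeze_u_const[OF holD(2,3)[OF hol_partial(3)[OF h]]]
      by auto
    then show ?thesis using E[of "freeze_u a p"] by simp
  qed
  show ?thesis
  proof (cases "m = 0")
    case True
    \<comment> \<open>Only T^0 = f acts at order 0, so two values of f suffice.\<close>
    obtain a b where ab: "f a \<noteq> f b" by (rule f_nonconst)
    have "d_zbar h p = of_real (f c) * d_uj 0 h p" for p c
      using Ea[of p c] True by (simp add: freeze_u_def)
    then have "of_real (f a) * d_uj 0 h p = of_real (f b) * d_uj 0 h p" for p by metis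
    then have "d_uj 0 h p = 0" for p using ab by (metis mult_right_cancel of_real_eq_iff)
    then show ?thesis using True by auto
  next
    case False
    obtain a b where fa: "f a \<noteq> 0" and ab: "f b * deriv f a - f a * deriv f b \<noteq> 0" by (rule wronskian_pair)
    define D where "D = complex_of_real (f b * deriv f a - f a * deriv f b)"
    have D: "D \<noteq> 0" unfolding D_def of_real_eq_0_iff by (rule ab)
    define Y0 where "Y0 = (\<lambda>i p. T i (freeze_u a p))"
    \<comment> \<open>This combination cancels the component along T^0, so X vanishes on the zero
      section, yet it still acts on h as a multiple of \<open>d_zbar\<close>.\<close>
    define X where "X = (\<lambda>i p. of_real (f b) * T i (freeze_u a p) - of_real (f a) * T i (freeze_u b p))"
    define Y where "Y n = (bracket m X ^^ n) Y0" for n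
    have Y_Suc: "Y (Suc n) = bracket m X (Y n)" for n by (simp add: Y_def)
    have X0: "X i \<in> Omega0" "d_zbar (X i) = (\<lambda>p. 0)" "weight i 0 (X i)" for i
    proof -
      show "X i \<in> Omega0" unfolding X_def by (intro Omega0_intros Omega0_freeze_u T_Omega0)
      show "d_zbar (X i) = (\<lambda>p. 0)" unfolding X_def
        by (simp add: partial_rules Omega0_intros Omega0_freeze_u T_Omega0 del: jetT.simps)
      have fr: "freeze_u c (dilate t p) = dilate t (freeze_u c p)" for t c p by (simp add: dilate_def freeze_u_def)
      show "weight i 0 (X i)" by (simp add: weight_def X_def fr T_dilate algebra_simps del: jetT.simps)
    qed
    have Y1: "(\<forall>i. Y n i \<in> Omega0 \<and> d_zbar (Y n i) = (\<lambda>p. 0) \<and> weight i n (Y n i))" for n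
    proof (induction n)
      case 0
      have fr: "freeze_u c (dilate t p) = dilate t (freeze_u c p)" for t c p by (simp add: dilate_def freeze_u_def)
      show ?case by (simp add: Y_def Y0_def Omega0_freeze_u T_Omega0 weight_def fr T_dilate del: jetT.simps)
    next
      case (Suc n)
      then show ?case unfolding Y_Suc
        by (simp add: Omega0_bracket d_zbar_bracket weight_bracket X0)
    qed
    have actX: "act m X h = (\<lambda>p. of_real (f b - f a) * d_zbar h p)"
    proof
      fix p
      have "act m X h p = of_real (f b) * (\<Sum>i\<le>m. T i (freeze_u a p) * d_uj i h p)
          - of_real (f a) * (\<Sum>i\<le>m. T i (freeze_u b p) * d_uj i h p)"
        by (simp add: act_def X_def algebra_simps sum_subtractf sum_distrib_left del: jetT.simps)
      then show "act m X h p = of_real (f b - f a) * d_zbar h p"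
        unfolding Ea[symmetric] by (simp add: algebra_simps)
    qed
    have act0: "act m (Y 0) h = d_zbar h"
      using Ea[of _ a] by (auto simp: act_def Y_def Y0_def fun_eq_iff)
    have act_c: "act m V (\<lambda>p. c * w p) = (\<lambda>p. c * act m V w p)" if "w \<in> Omega0" for V c w
      using that by (simp add: act_def[abs_def] partial_rules Omega0_intros sum_distrib_left mult_ac)
    \<comment> \<open>Coefficients free of the conjugate of z commute with \<open>d_zbar\<close>.
      Hence both orders of X and Y 0 give (f b - f a) times the second
      \<open>d_zbar\<close>-derivative of h, and their commutator annihilates h; the later brackets
      follow in the same way.\<close>
    have actS: "act m (Y (Suc n)) h = (\<lambda>p. 0)" for n
    proof (induction n)
      case 0
      have "act m (Y (Suc 0)) h p = of_real (f b - f a) * act m (Y 0) (d_zbar h) p - act m X (d_zbar h) p" for p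
        unfolding Y_Suc act_bracket[OF X0(1) conjunct1[OF spec[OF Y1]] hO] actX act0
        by (simp add: act_c hO Omega0_intros)
      moreover have "act m (Y 0) (d_zbar h) = d_zbar (d_zbar h)"
        by (subst act_d_zbar) (use Y1 hO act0 in auto)
      moreover have "act m X (d_zbar h) = (\<lambda>p. of_real (f b - f a) * d_zbar (d_zbar h) p)"
        by (subst act_d_zbar) (use X0 hO actX in \<open>auto simp: partial_rules Omega0_intros\<close>)
      ultimately show ?case by auto
    next
      case (Suc n)
      have "act m (Y (Suc (Suc n))) h p = of_real (f b - f a) * act m (Y (Suc n)) (d_zbar h) p - act m X (\<lambda>p. 0) p" for p
        unfolding Y_Suc[of "Suc n"] act_bracket[OF X0(1) conjunct1[OF spec[OF Y1]] hO] actX Suc.IH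
        by (simp add: act_c hO Omega0_intros)
      moreover have "act m (Y (Suc n)) (d_zbar h) = (\<lambda>p. 0)"
        by (subst act_d_zbar) (use Y1 hO Suc.IH in auto)
      ultimately show ?case by (auto simp: act_def fun_eq_iff)
    qed
    \<comment> \<open>The component has weight i - n, which is negative.\<close>
    have low: "Y n i p = 0" if "i < n" for n i p
      using weight_limit(1)[OF Omega0_smooth] Y1 that by blast
    \<comment> \<open>The diagonal component has weight zero and may be computed on the zero
      section. There X vanishes, and only the derivative D of its component n + 1 in direction n
      survives.\<close>
    have diag: "Y n n p = of_real (f a) * D ^ n" if "n \<le> m" for n p
      using that
    proof (induction n arbitrary: p)
      case 0
      then show ?case by (simp add: Y_def Y0_def freeze_u_def)
    next
      case (Suc n)
      let ?p = "dilate 0 p"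
      have X_0: "X l ?p = 0" for l
      proof (cases l)
        case 0 then show ?thesis by (simp add: X_def freeze_u_def)
      next
        case (Suc _) then show ?thesis using weight_limit(3)[OF Omega0_smooth[OF X0(1)] X0(3)] by simp
      qed
      have dX: "Y n l ?p * d_uj l (X (Suc n)) ?p = (if l = n then of_real (f a) * D ^ Suc n else 0)" for l
      proof -
        have "d_uj l (X (Suc n)) ?p = (if l = n then D else 0)" if "l \<ge> n"
        proof -
          have "d_uj l (X (Suc n)) ?p = of_real (f b) * d_uj l (T (Suc n)) (freeze_u a ?p)
              - of_real (f a) * d_uj l (T (Suc n)) (freeze_u b ?p)"
            unfolding X_def by (simp add: partial_rules Omega0_intros Omega0_freeze_u T_Omega0 del: jetT.simps)
          then show ?thesis using that T_uj_high[of "Suc n" l]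
            by (cases "l = n") (simp_all add: T_uj_top D_def freeze_u_def del: jetT.simps)
        qed
        then show ?thesis using low[of l n ?p] Suc by (cases "l < n") auto
      qed
      have "Y (Suc n) (Suc n) p = Y (Suc n) (Suc n) ?p"
        using weight_limit(2)[OF Omega0_smooth] Y1 by blast
      also have "\<dots> = of_real (f a) * D ^ Suc n"
        unfolding Y_Suc bracket_def dX X_0 using Suc.prems by simp
      finally show ?case .
    qed
    obtain n where n: "m = Suc n" using False not0_implies_Suc by blast
    have "d_uj m h p = 0" for p
    proof -
      have "0 = (\<Sum>i\<le>m. Y m i p * d_uj i h p)" using fun_cong[OF actS[of n], of p] by (simp add: n act_def)
      also have "\<dots> = (\<Sum>i\<le>m. if i = m then of_real (f a) * D ^ m * d_uj m h p else 0)"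
        using low diag by (intro sum.cong refl) (auto simp: order.strict_iff_order)
      also have "\<dots> = of_real (f a) * D ^ m * d_uj m h p" by simp
      finally show ?thesis using fa D by simp
    qed
    then show ?thesis by auto
  qed
qed

lemma eb_kernel:
  assumes h: "h \<in> hol" and eb: "eb h = (\<lambda>p. 0)"
  shows "d_uj j h = (\<lambda>p. 0)" "d_zbar h = (\<lambda>p. 0)"
proof -
  show j: "d_uj j h = (\<lambda>p. 0)" for j
    by (rule order_descent[OF holD(2)[OF h]]) (rule eb_kernel_step[OF h eb])
  obtain k where k: "of_order k h" using holD(2)[OF h] by (auto simp: Omega0_iff)
  show "d_zbar h = (\<lambda>p. 0)"
    using eb e_m1bar_sum[OF k order_refl holD(2)[OF h], of f] holD(3,4)[OF h] j by (auto simp: fun_eq_iff)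
qed

end

section \<open>Symmetries without leading term\<close>

text \<open>Both derivatives are tangent to the zero section.\<close>

lemma zero_section_cong:
  assumes "F \<in> Omega0" "G \<in> Omega0" "\<And>p. F (dilate 0 p) = G (dilate 0 p)"
  shows "d_z F (dilate 0 p) = d_z G (dilate 0 p)" "d_zbar F (dilate 0 p) = d_zbar G (dilate 0 p)"
  using fun_cong[OF partial_dilate(1)[OF assms(1)], of 0 p] fun_cong[OF partial_dilate(1)[OF assms(2)], of 0 p]
    fun_cong[OF partial_dilate(2)[OF assms(1)], of 0 p] fun_cong[OF partial_dilate(2)[OF assms(2)], of 0 p] assms(3)
  by auto

lemma zero_section_vanish:
  assumes "F \<in> Omega0" "\<And>p. F (dilate 0 p) = 0"
  shows "d_z F (dilate 0 p) = 0" "d_zbar F (dilate 0 p) = 0"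
  using zero_section_cong[OF assms(1) Omega0_const[of 0]] assms(2) by auto

lemma dilate_freeze_u: "dilate t (freeze_u a p) = freeze_u a (dilate t p)"
  by (simp add: dilate_def freeze_u_def)

lemma coords_zero_section [simp]: "uj j (dilate 0 p) = 0" "zc (dilate t p) = zc p" "uc (dilate t p) = uc p"
  "zc (freeze_u a p) = zc p" "uc (freeze_u a p) = a" "uj j (freeze_u a p) = uj j p"
  by (simp_all add: dilate_def freeze_u_def)

lemma hol_freeze: "F \<in> hol \<Longrightarrow> F (freeze_u a p) = F p"
  using freeze_u_const holD by blast

lemma dird_uj:
  assumes "F \<in> Omega0"
  shows "dird (0, 0, 0(i := c)) F p = c * d_uj i F p + cnj c * d_ujbar i F p"
proof -
  obtain k where k: "of_order k F" using assms by (auto simp: Omega0_iff)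
  have "(\<Sum>j\<le>max k i. (if j = i then c else 0) * d_uj j F p + cnj (if j = i then c else 0) * d_ujbar j F p)
     = (\<Sum>j\<le>max k i. if j = i then c * d_uj i F p + cnj c * d_ujbar i F p else 0)"
    by (intro sum.cong) auto
  then show ?thesis
    using dird_decomp[OF Omega0_smooth[OF assms] k, of "max k i" "(0, 0, 0(i := c))" p]
    by (simp add: fun_upd_def zero_fun_def)
qed

lemma hol_const_uj:
  assumes "F \<in> hol" "\<And>j. d_uj j F = (\<lambda>p. 0)"
  shows "F (dilate 0 p) = F p"
proof -
  obtain k where k: "of_order k F" using holD(2)[OF assms(1)] by (auto simp: Omega0_iff)
  have "F (dilate 0 p + 1 *\<^sub>R (0, 0, snd (snd p))) = F (dilate 0 p)"
  proof (rule line_const)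
    show "smooth F" using assms holD Omega0_smooth by blast
    show "dird (0, 0, snd (snd p)) F (dilate 0 p + t *\<^sub>R (0, 0, snd (snd p))) = 0" for t
      using dird_decomp[OF \<open>smooth F\<close> k order_refl] assms holD(4)[OF assms(1)] by simp
  qed
  moreover have "dilate 0 p + 1 *\<^sub>R (0, 0, snd (snd p)) = p"
    by (cases p) (simp add: dilate_def scaleR_fun_def fun_eq_iff)
  ultimately show ?thesis by simp
qed

text \<open>A slice to which \<open>d_zbar\<close> and \<open>d_uj 0\<close> are tangent, so
  relations valid only on it may still be differentiated by these operators.\<close>

definition u0_slice :: "jet set" where
  "u0_slice = {p. \<forall>j\<ge>1. uj j p = 0}"

lemma u0_slice_vanish:
  assumes "\<And>p. p \<in> u0_slice \<Longrightarrow> F p = 0" "p \<in> u0_slice"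
  shows "d_uj 0 F p = 0" "d_zbar F p = 0"
proof -
  have "dird (a, 0, 0(0 := b)) F p = 0" for a b
  proof -
    have "F (p + t *\<^sub>R (a, 0, 0(0 := b))) = 0" for t
      using assms by (intro assms(1)) (simp add: u0_slice_def scaleR_fun_def)
    then show ?thesis by (simp add: dird_def)
  qed
  from this[of 0] this[where b = 0] show "d_uj 0 F p = 0" "d_zbar F p = 0"
    by (simp_all add: d_uj_def d_zbar_def fun_upd_idem zero_fun_def)
qed

lemma u0_slice_cong:
  assumes "F \<in> Omega0" "G \<in> Omega0" "\<And>p. p \<in> u0_slice \<Longrightarrow> F p = G p" "p \<in> u0_slice"
  shows "d_uj 0 F p = d_uj 0 G p" "d_zbar F p = d_zbar G p"
  using u0_slice_vanish[where F = "\<lambda>p. F p - G p"] assms by (simp_all add: partial_rules)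

context poisson_indep
begin

lemma eb_hol:
  assumes "w \<in> hol" "\<And>i. M < i \<Longrightarrow> d_uj i w = (\<lambda>p. 0)"
  shows "eb w p = d_zbar w p - (\<Sum>i\<le>M. T i p * d_uj i w p)"
proof -
  note O = holD(2)[OF assms(1)]
  obtain k where "of_order k w" using O by (auto simp: Omega0_iff)
  then have k: "of_order (max k M) w" by (rule of_order_mono) simp
  have "(\<Sum>i\<le>max k M. T i p * d_uj i w p) = (\<Sum>i\<le>M. T i p * d_uj i w p)"
    by (rule sum.mono_neutral_right) (auto simp: assms(2))
  then show ?thesis
    using e_m1bar_sum[OF k order_refl O, of f p] holD(3,4)[OF assms(1)] by simp
qed

lemma e_zero_section:
  assumes "w \<in> nobar" shows "e w (dilate 0 p) = d_z w (dilate 0 p)"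
proof -
  obtain k where k: "of_order k w" using nobarD(1)[OF assms] by (auto simp: Omega0_iff)
  show ?thesis by (simp add: e_m1_nobar_sum[OF assms k order_refl])
qed

lemma T_zero_section: "T i (dilate 0 p) = (if i = 0 then of_real (f (uc p)) else 0)"
  using T_dilate[of i 0 p] by (cases i) (simp_all del: jetT.simps(2))

lemma weight_T: "weight i 0 (T i)"
  by (simp add: weight_def T_dilate del: jetT.simps)

text \<open>The derivative has weight i - j - 1, so on the zero section only weight zero can
  survive, where it equals \<open>f\<^sub>u\<close>. The second derivatives below obey the same
  principle.\<close>

lemma d_T_zero_section: "d_uj j (T i) (dilate 0 p) = (if i = Suc j then fu p else 0)"
proof -
  have w: "weight i (Suc j) (d_uj j (T i))" using weight_d_uj[OF T_Omega0 weight_T] by simp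
  have "smooth (d_uj j (T i))" by (intro Omega0_smooth Omega0_intros T_Omega0)
  note W = weight_limit[OF this w]
  consider "i < Suc j" | "i = Suc j" | "Suc j < i" by linarith
  then show ?thesis
  proof cases
    case 2
    then show ?thesis by (simp add: T_uj_top del: jetT.simps)
  qed (use W(1,3) in \<open>simp_all del: jetT.simps\<close>)
qed

lemma d_d_T_zero_section: "i \<noteq> j + m + 2 \<Longrightarrow> d_uj m (d_uj j (T i)) (dilate 0 p) = 0"
proof -
  assume ne: "i \<noteq> j + m + 2"
  have w: "weight i (Suc j + Suc m) (d_uj m (d_uj j (T i)))"
    using weight_d_uj[OF _ weight_d_uj[OF T_Omega0 weight_T], of j i m] by (simp add: Omega0_intros T_Omega0)
  have "smooth (d_uj m (d_uj j (T i)))" by (intro Omega0_smooth Omega0_intros T_Omega0)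
  note W = weight_limit[OF this w]
  show ?thesis using W(1,3) ne by (cases "i < Suc j + Suc m") auto
qed

lemma f_complex_nonconst:
  assumes "\<And>x. A + B * of_real (f x) = (0::complex)" shows "B = 0"
proof -
  obtain a b where "f a \<noteq> f b" by (rule f_nonconst)
  moreover have "B * of_real (f a) = B * of_real (f b)" using assms[of a] assms[of b] by algebra
  ultimately show ?thesis by simp
qed

end

context poisson
begin

lemma nobar_e_pow: "w \<in> nobar \<Longrightarrow> (e ^^ i) w \<in> nobar"
  by (induction i) (simp_all add: nobar_e_m1)

lemma e_q_nobar: "e q_fun \<in> Omega0" "d_ujbar i (e q_fun) = (\<lambda>p. 0)"
    "d_uj l (e q_fun) = (\<lambda>p. if l = 0 then 1 else if l = 1 then zc p else 0)"
  unfolding partial_q(2)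
  by (auto simp: partial_rules Omega0_intros Omega0_f partial_f fun_eq_iff)

end

section \<open>The linearized symmetry equation\<close>

locale symmetry = poisson_indep +
  fixes P :: "jet \<Rightarrow> complex"
  assumes P_Omega0: "P \<in> Omega0"
    and P_eq: "eb (e P) = (\<lambda>p. - (fu p * P p))"
    and P_u: "d_u P = (\<lambda>p. 0)"
    and P_mixed: "d_ujbar j (d_uj i P) = (\<lambda>p. 0)"
begin

abbreviation pj where "pj j \<equiv> d_uj j P"
abbreviation Gj where "Gj j \<equiv> d_uj j (e P)"

text \<open>This is where the two side conditions on P enter: each first derivative loses both
  \<open>u\<close> and the conjugate jets.\<close>

lemma hol_p: "pj j \<in> hol"
  using P_mixed derivation_commute[OF derivation_partial(3) derivation_partial(4) P_Omega0, of j]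
  by (simp add: hol_def nobar_def Omega0_intros P_Omega0 P_u)

lemma G_Suc: "Gj (Suc j) = (\<lambda>p. e (pj (Suc j)) p + pj j p)"
  by (rule d_uj_e(1)[OF P_Omega0])

lemma G_0: "Gj 0 = e (pj 0)"
  using d_uj_e(2)[OF P_Omega0] P_u by simp

lemma hol_G: "Gj j \<in> hol"
proof (cases j)
  case (Suc n)
  then show ?thesis using hol_add[OF hol_e_m1[OF hol_p] hol_p] by (simp add: G_Suc)
qed (simp add: G_0 hol_e_m1 hol_p)

lemma d_uj_p_commute: "d_uj i (pj j) = d_uj j (pj i)"
  by (rule derivation_commute[OF derivation_partial(4) derivation_partial(4) P_Omega0])

lemma d_uj_G_commute: "d_uj i (Gj j) = d_uj j (Gj i)"
  by (rule derivation_commute[OF derivation_partial(4) derivation_partial(4) Omega0_e[OF P_Omega0]])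

lemmas p_Omega0 = holD(2)[OF hol_p]
lemmas G_Omega0 = holD(2)[OF hol_G]

lemma d_uj_e_p: "d_uj (Suc i) (e (pj j)) = (\<lambda>p. e (d_uj (Suc i) (pj j)) p + d_uj i (pj j) p)"
  "d_uj 0 (e (pj j)) = e (d_uj 0 (pj j))"
  using d_uj_e[OF p_Omega0] holD(3)[OF hol_p] by auto

lemma w_nobar: "(\<lambda>p. pj j p * e q_fun p) \<in> nobar"
  using e_q_nobar holD(1)[OF hol_p] by (intro nobar_mult) (auto simp: nobar_def)

lemma d_uj_w: "d_uj l (\<lambda>p. pj j p * e q_fun p) p
    = pj j p * (if l = 0 then 1 else if l = 1 then zc p else 0) + d_uj l (pj j) p * e q_fun p"
  by (simp add: partial_rules p_Omega0 e_q_nobar)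

end

locale symmetry_order = symmetry +
  fixes n :: nat
  assumes top: "n < j \<Longrightarrow> d_uj j P = (\<lambda>p. 0)"
begin

text \<open>By the index shift of \<open>d_uj_e\<close>, \<open>e P\<close> has order n + 1 with the
  leading coefficient of P.\<close>

lemma G_top: "Gj (Suc n) = pj n" "Suc n < j \<Longrightarrow> Gj j = (\<lambda>p. 0)"
proof -
  show "Gj (Suc n) = pj n" by (simp add: G_Suc top)
  show "Gj j = (\<lambda>p. 0)" if j: "Suc n < j"
  proof (cases j)
    case (Suc i)
    then show ?thesis using j by (simp add: G_Suc top)
  next
    case 0
    then show ?thesis using j by simp
  qed
qed

lemma d_uj_G_top: "Suc n < i \<Longrightarrow> d_uj i (Gj j) = (\<lambda>p. 0)"
  by (simp add: d_uj_G_commute[of i j] G_top)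

text \<open>Apply \<open>d_uj j\<close> to the symmetry equation; \<open>f\<^sub>u\<close> is free
  of jets, so only the coefficients T^i of e' produce commutator terms.\<close>

lemma linearized:
  assumes "Suc n \<le> N"
  shows "eb (Gj j) p - (\<Sum>i\<le>N. d_uj j (T i) p * Gj i p) + fu p * pj j p = 0"
proof -
  have O: "e P \<in> Omega0" by (rule Omega0_e[OF P_Omega0])
  obtain k where "of_order k (e P)" using O by (auto simp: Omega0_iff)
  then have k: "of_order (max k N) (e P)" by (rule of_order_mono) simp
  have "(\<Sum>i\<le>max k N. d_uj j (T i) p * Gj i p) = (\<Sum>i\<le>N. d_uj j (T i) p * Gj i p)"
    by (rule sum.mono_neutral_right) (use assms in \<open>auto simp: G_top\<close>)
  then have "eb (Gj j) p - (\<Sum>i\<le>N. d_uj j (T i) p * Gj i p) = d_uj j (eb (e P)) p"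
    using d_uj_eb[OF O k order_refl, of j] by simp
  also have "\<dots> = - (fu p * pj j p)"
    unfolding P_eq by (simp add: partial_rules Omega0_intros Omega0_f P_Omega0 partial_f')
  finally have "eb (Gj j) p - (\<Sum>i\<le>N. d_uj j (T i) p * Gj i p) = - (fu p * pj j p)" .
  then show ?thesis by (simp only:) simp
qed

text \<open>Take j = n + 1 in the linearized equation: T^i with i \<le> n + 1 does not involve
  u_(n+1), and the derivative of P in that direction is zero. By \<open>eb_kernel\<close> the
  leading coefficient then depends on z alone.\<close>

lemma eb_p_top: "eb (pj n) = (\<lambda>p. 0)"
proof
  fix p
  show "eb (pj n) p = 0"
    using linearized[of "Suc n" "Suc n" p] by (simp add: G_top T_uj_high top del: jetT.simps)
qed

lemmas p_top_kernel = eb_kernel[OF hol_p eb_p_top]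

lemma p_top_zero_section: "pj n (dilate 0 p) = pj n p"
  by (rule hol_const_uj[OF hol_p p_top_kernel(1)])

lemma e_p_top: "e (pj n) = d_z (pj n)"
proof -
  obtain k where k: "of_order k (pj n)" using p_Omega0 by (auto simp: Omega0_iff)
  show ?thesis
    using e_m1_nobar_sum[OF holD(1)[OF hol_p] k order_refl, of f] holD(3)[OF hol_p]
    by (auto simp: fun_eq_iff p_top_kernel(1))
qed

lemma d_uj_d_z_p_top: "d_uj i (d_z (pj n)) = (\<lambda>p. 0)"
  by (simp add: derivation_commute[OF derivation_partial(4) derivation_partial(1) p_Omega0] p_top_kernel)

text \<open>For j = n the only commutator term is f_u times the leading coefficient, and it cancels
  the term f_u p_n.\<close>

lemma G_n_kernel: "d_uj i (Gj n) = (\<lambda>p. 0)"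
proof (rule eb_kernel(1)[OF hol_G])
  show "eb (Gj n) = (\<lambda>p. 0)"
  proof
    fix p
    have "(\<Sum>i\<le>Suc n. d_uj n (T i) p * Gj i p) = fu p * pj n p"
      by (simp add: T_uj_high T_uj_top G_top del: jetT.simps)
    then show "eb (Gj n) p = 0" using linearized[of "Suc n" n p] by simp
  qed
qed

text \<open>On the zero section only T^0 and the derivative of T^(j+1) in u_j are left. All
  remaining functions are free of \<open>u\<close>, so x is arbitrary and this is a linear relation
  between 1, f and \<open>f\<^sub>u\<close>.\<close>

lemma linearized_zero_section:
  "d_zbar (Gj j) (dilate 0 p) - of_real (f x) * d_uj 0 (Gj j) (dilate 0 p)
     + of_real (deriv f x) * (pj j (dilate 0 p) - Gj (Suc j) (dilate 0 p)) = 0"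
proof -
  let ?q = "dilate 0 (freeze_u x p)"
  define N where "N = Suc n + Suc j"
  then have N: "Suc n \<le> N" "Suc j \<le> N" by auto
  have fr: "w ?q = w (dilate 0 p)" if "w \<in> hol" for w
    unfolding dilate_freeze_u by (rule hol_freeze[OF that])
  have "(\<Sum>i\<le>N. d_uj j (T i) ?q * Gj i ?q) = (\<Sum>i\<le>N. if i = Suc j then of_real (deriv f x) * Gj (Suc j) ?q else 0)"
    by (intro sum.cong refl) (simp add: d_T_zero_section del: jetT.simps)
  moreover have "eb (Gj j) ?q = d_zbar (Gj j) ?q - (\<Sum>i\<le>N. if i = 0 then of_real (f x) * d_uj 0 (Gj j) ?q else 0)"
  proof -
    have "(\<Sum>i\<le>N. T i ?q * d_uj i (Gj j) ?q) = (\<Sum>i\<le>N. if i = 0 then of_real (f x) * d_uj 0 (Gj j) ?q else 0)"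
      by (intro sum.cong refl) (simp add: T_zero_section del: jetT.simps)
    moreover have "d_uj i (Gj j) = (\<lambda>p. 0)" if "N < i" for i using that N by (simp add: d_uj_G_top)
    ultimately show ?thesis using eb_hol[OF hol_G, where M = N and p = ?q] by simp
  qed
  ultimately have "d_zbar (Gj j) ?q - of_real (f x) * d_uj 0 (Gj j) ?q - of_real (deriv f x) * Gj (Suc j) ?q
      + of_real (deriv f x) * pj j ?q = 0"
    using linearized[OF N(1), of j ?q] N by simp
  then show ?thesis
    by (simp add: fr hol_p hol_G hol_partial algebra_simps)
qed

text \<open>The second derivative of T^i survives only for i = j + m + 2; the bound on n makes its
  factor \<open>Gj i\<close> zero, since \<open>e P\<close> has order at most n + 1.\<close>

lemma d_u_linearized_zero_section:
  assumes "n \<le> j + m"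
  shows "d_zbar (d_uj m (Gj j)) (dilate 0 p) - of_real (f x) * d_uj 0 (d_uj m (Gj j)) (dilate 0 p)
     + of_real (deriv f x) * (d_uj m (pj j) (dilate 0 p)
         - d_uj (Suc m) (Gj j) (dilate 0 p) - d_uj m (Gj (Suc j)) (dilate 0 p)) = 0"
proof -
  let ?q = "dilate 0 (freeze_u x p)"
  define N where "N = Suc n + Suc j + Suc m"
  then have N: "Suc n \<le> N" "Suc j \<le> N" "Suc m \<le> N" by auto
  have fr: "w ?q = w (dilate 0 p)" if "w \<in> hol" for w
    unfolding dilate_freeze_u by (rule hol_freeze[OF that])
  have DG: "d_uj i (d_uj m (Gj j)) = (\<lambda>p. 0)" if "N < i" for i
  proof -
    have "d_uj i (d_uj m (Gj j)) = d_uj m (d_uj i (Gj j))"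
      by (rule derivation_commute) (simp_all add: G_Omega0)
    then show ?thesis using that N by (simp add: d_uj_G_top)
  qed
  have eq: "(\<lambda>p. eb (Gj j) p - (\<Sum>i\<le>N. d_uj j (T i) p * Gj i p) + fu p * pj j p) = (\<lambda>p. 0)"
    using linearized[OF N(1)] by auto
  obtain k where "of_order k (Gj j)" using G_Omega0 by (auto simp: Omega0_iff)
  then have k: "of_order (max k N) (Gj j)" by (rule of_order_mono) simp
  have S: "(\<Sum>i\<le>max k N. d_uj m (T i) p * d_uj i (Gj j) p) = (\<Sum>i\<le>N. d_uj m (T i) p * d_uj i (Gj j) p)" for p
    by (rule sum.mono_neutral_right) (use N in \<open>auto simp: d_uj_G_top\<close>)
  have "d_uj m (\<lambda>p. eb (Gj j) p - (\<Sum>i\<le>N. d_uj j (T i) p * Gj i p) + fu p * pj j p) ?q = 0"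
    unfolding eq by simp
  then have main: "eb (d_uj m (Gj j)) ?q - (\<Sum>i\<le>N. d_uj m (T i) ?q * d_uj i (Gj j) ?q)
     - (\<Sum>i\<le>N. d_uj j (T i) ?q * d_uj m (Gj i) ?q + d_uj m (d_uj j (T i)) ?q * Gj i ?q) + of_real (deriv f x) * d_uj m (pj j) ?q = 0"
    by (simp add: partial_rules Omega0_intros Omega0_eb G_Omega0 T_Omega0 p_Omega0 Omega0_f partial_f'
        d_uj_eb[OF G_Omega0 k order_refl] S del: jetT.simps sum.atMost_Suc)
  have "(\<Sum>i\<le>N. d_uj m (T i) ?q * d_uj i (Gj j) ?q) = (\<Sum>i\<le>N. if i = Suc m then of_real (deriv f x) * d_uj (Suc m) (Gj j) ?q else 0)"
    by (intro sum.cong refl) (simp add: d_T_zero_section del: jetT.simps)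
  moreover have "(\<Sum>i\<le>N. d_uj j (T i) ?q * d_uj m (Gj i) ?q + d_uj m (d_uj j (T i)) ?q * Gj i ?q)
      = (\<Sum>i\<le>N. if i = Suc j then of_real (deriv f x) * d_uj m (Gj (Suc j)) ?q else 0)"
  proof (intro sum.cong refl)
    fix i
    have 0: "d_uj m (d_uj j (T i)) ?q * Gj i ?q = 0"
      using d_d_T_zero_section[of i j m] G_top(2)[of i] assms by (cases "i = j + m + 2") auto
    show "d_uj j (T i) ?q * d_uj m (Gj i) ?q + d_uj m (d_uj j (T i)) ?q * Gj i ?q =
        (if i = Suc j then of_real (deriv f x) * d_uj m (Gj (Suc j)) ?q else 0)"
      unfolding 0 d_T_zero_section by simp
  qed
  moreover have "eb (d_uj m (Gj j)) ?q = d_zbar (d_uj m (Gj j)) ?q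
      - (\<Sum>i\<le>N. if i = 0 then of_real (f x) * d_uj 0 (d_uj m (Gj j)) ?q else 0)"
  proof -
    have "(\<Sum>i\<le>N. T i ?q * d_uj i (d_uj m (Gj j)) ?q) = (\<Sum>i\<le>N. if i = 0 then of_real (f x) * d_uj 0 (d_uj m (Gj j)) ?q else 0)"
      by (intro sum.cong refl) (simp add: T_zero_section del: jetT.simps)
    then show ?thesis using eb_hol[OF hol_partial(3)[OF hol_G] DG, where p = ?q] by simp
  qed
  ultimately have "d_zbar (d_uj m (Gj j)) ?q - of_real (f x) * d_uj 0 (d_uj m (Gj j)) ?q
      - of_real (deriv f x) * d_uj (Suc m) (Gj j) ?q - of_real (deriv f x) * d_uj m (Gj (Suc j)) ?q
      + of_real (deriv f x) * d_uj m (pj j) ?q = 0"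
    using main N by simp
  then show ?thesis
    by (simp add: fr hol_p hol_G hol_partial algebra_simps)
qed

text \<open>A conservation law with characteristic \<open>P\<close> and zero class forces this identity.\<close>
definition euler_identity :: bool where
  "euler_identity \<longleftrightarrow> (\<exists>N\<ge>n. \<exists>W\<in>nobar. \<forall>p. (\<Sum>j\<le>N. (- 1) ^ j * (e ^^ j) (\<lambda>p. pj j p * e q_fun p) p) - zc p * e P p
      = cnj (W p) - cnj (zc p) * eb P p)"

lemma d_uj_e_zero_section:
  assumes "w \<in> nobar"
  shows "d_uj (Suc l) (e w) (dilate 0 p) = d_z (d_uj (Suc l) w) (dilate 0 p) + d_uj l w (dilate 0 p)"
  using d_uj_e(1)[OF nobarD(1)[OF assms], of l] nobar_partial[OF assms, of "DJ (Suc l)"]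
  by (simp add: e_zero_section)

text \<open>On the zero section e acts as the tangential \<open>d_z\<close> plus the index shift, so
  it raises the order by at most one.\<close>

lemma d_uj_e_pow_high:
  assumes "w \<in> nobar" "\<And>l p. r \<le> l \<Longrightarrow> d_uj l w (dilate 0 p) = 0" "r + i \<le> l"
  shows "d_uj l ((e ^^ i) w) (dilate 0 p) = 0"
  using assms(3)
proof (induction i arbitrary: l p)
  case (Suc i)
  then obtain l' where l': "l = Suc l'" by (cases l) auto
  have "(e ^^ i) w \<in> nobar" by (rule nobar_e_pow[OF assms(1)])
  moreover have "d_z (d_uj (Suc l') ((e ^^ i) w)) (dilate 0 p) = 0"
    using Suc l' by (intro zero_section_vanish) (simp_all add: Omega0_intros nobarD(1)[OF nobar_e_pow[OF assms(1)]])
  ultimately show ?case using Suc l' by (simp add: d_uj_e_zero_section)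
qed (use assms in auto)

lemma d_uj_e_pow_1:
  assumes "w \<in> nobar" "\<And>l p. 2 \<le> l \<Longrightarrow> d_uj l w (dilate 0 p) = 0"
  shows "d_uj (Suc i) ((e ^^ i) w) (dilate 0 p) = d_uj 1 w (dilate 0 p)"
proof (induction i)
  case (Suc i)
  have "(e ^^ i) w \<in> nobar" by (rule nobar_e_pow[OF assms(1)])
  moreover have "d_z (d_uj (Suc (Suc i)) ((e ^^ i) w)) (dilate 0 p) = 0"
    using d_uj_e_pow_high[OF assms, where i = i and l = "Suc (Suc i)"]
    by (intro zero_section_vanish) (simp_all add: Omega0_intros nobarD(1)[OF nobar_e_pow[OF assms(1)]])
  ultimately show ?case using Suc by (simp add: d_uj_e_zero_section)
qed simp

text \<open>The coefficient just below the top: each application of e shifts it and adds one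
  \<open>d_z\<close> of the top coefficient, which itself is carried along unchanged by
  \<open>d_uj_e_pow_1\<close>.\<close>

lemma d_uj_e_pow_0:
  assumes "w \<in> nobar" "\<And>l p. 2 \<le> l \<Longrightarrow> d_uj l w (dilate 0 p) = 0"
  shows "d_uj i ((e ^^ i) w) (dilate 0 p) = of_nat i * d_z (d_uj 1 w) (dilate 0 p) + d_uj 0 w (dilate 0 p)"
proof (induction i)
  case (Suc i)
  have "(e ^^ i) w \<in> nobar" by (rule nobar_e_pow[OF assms(1)])
  moreover have "d_z (d_uj (Suc i) ((e ^^ i) w)) (dilate 0 p) = d_z (d_uj 1 w) (dilate 0 p)"
    using d_uj_e_pow_1[OF assms]
    by (intro zero_section_cong) (simp_all add: Omega0_intros nobarD(1)[OF nobar_e_pow[OF assms(1)]] nobarD(1)[OF assms(1)])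
  ultimately show ?case using Suc by (simp add: d_uj_e_zero_section algebra_simps)
qed simp

lemma euler_identity_order:
  assumes euler_identity
  obtains W where "W \<in> nobar" "\<And>p. (\<Sum>j\<le>n. (- 1) ^ j * (e ^^ j) (\<lambda>p. pj j p * e q_fun p) p) - zc p * e P p
      = cnj (W p) - cnj (zc p) * eb P p"
proof -
  obtain N W where W: "n \<le> N" "W \<in> nobar" "\<And>p. (\<Sum>j\<le>N. (- 1) ^ j * (e ^^ j) (\<lambda>p. pj j p * e q_fun p) p) - zc p * e P p
      = cnj (W p) - cnj (zc p) * eb P p"
    using assms unfolding euler_identity_def by blast
  have "(\<Sum>j\<le>N. (- 1) ^ j * (e ^^ j) (\<lambda>p. pj j p * e q_fun p) p) = (\<Sum>j\<le>n. (- 1) ^ j * (e ^^ j) (\<lambda>p. pj j p * e q_fun p) p)" for p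
    by (rule sum.mono_neutral_right) (use W(1) in \<open>auto simp: top e_pow_0\<close>)
  then show ?thesis using that W by simp
qed

text \<open>
  Generic case. The components of the linearized equation along \<open>f\<close> and \<open>f\<^sub>u\<close> at the zero section make
  the leading coefficient constant and kill \<open>P\<^sub>u\<^sub>i\<^sub>u\<^sub>j\<close> for \<open>i + j \<ge> n\<close>, so that the \<open>u\<^sub>n\<close>-coefficient of the
  Euler identity at \<open>z = 0\<close> is \<open>\<plusminus>(n + 1)\<close> times the leading coefficient.
\<close>
lemma p_top_generic:
  assumes ind: "\<And>A B C. (\<And>x. A + B * of_real (f x) + C * of_real (deriv f x) = (0::complex)) \<Longrightarrow> B = 0 \<and> C = 0"
    and n: "n = Suc k" and EI: euler_identity
  shows "pj n = (\<lambda>p. 0)"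
proof -
  let ?o = "dilate 0"
  \<comment> \<open>The coefficients of f and of \<open>f\<^sub>u\<close> vanish separately. With
    \<open>G_Suc\<close> the second relation says that \<open>d_z\<close> of every p_j with j \<ge>
    1 is zero on the zero section.\<close>
  have lin: "d_uj 0 (Gj j) (?o p) = 0" "Gj (Suc j) (?o p) = pj j (?o p)" for j p
    using ind[of "d_zbar (Gj j) (?o p)" "- d_uj 0 (Gj j) (?o p)" "pj j (?o p) - Gj (Suc j) (?o p)"]
      linearized_zero_section[of j p] by (simp_all add: mult.commute)
  have dz: "d_z (pj (Suc j)) (?o p) = 0" for j p
    using lin(2)[of j p] by (simp add: G_Suc e_zero_section holD(1)[OF hol_p])
  \<comment> \<open>Descent from index n + 1: the u_0-derivative of \<open>Gj (Suc j)\<close> is e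
    of that of p_(j+1) plus that of p_j, and e preserves vanishing on the zero section.\<close>
  have x0: "\<forall>p. d_uj 0 (pj (Suc n - i)) (?o p) = 0" for i
  proof (induction i)
    case 0
    then show ?case by (simp add: top)
  next
    case (Suc i)
    show ?case
    proof (cases "i \<le> n")
      case True
      define j where "j = n - i"
      have j: "Suc n - i = Suc j" "Suc n - Suc i = j" using True by (simp_all add: j_def)
      have "d_uj 0 (Gj (Suc j)) p = e (d_uj 0 (pj (Suc j))) p + d_uj 0 (pj j) p" for p
        unfolding G_Suc by (simp add: partial_rules Omega0_e p_Omega0 d_uj_e_p)
      moreover have "e (d_uj 0 (pj (Suc j))) (?o p) = 0" for p
        using Suc.IH j
        by (simp add: e_zero_section holD(1) hol_partial hol_p zero_section_vanish Omega0_intros p_Omega0)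
      ultimately show ?thesis using lin(1)[of "Suc j"] j by simp
    qed (use Suc in simp)
  qed
  have x0: "d_uj 0 (pj j) (?o p) = 0" for j p
  proof (cases "j \<le> n")
    case True
    then show ?thesis using x0[of "Suc n - j"] by simp
  qed (simp add: top)
  \<comment> \<open>Downward induction on i + j. At 2 n + 1 one of the indices exceeds n; r counts
    the steps down.\<close>
  have S: "\<forall>i j p. n \<le> i + j \<longrightarrow> 2 * n + 1 - r \<le> i + j \<longrightarrow> d_uj i (pj j) (?o p) = 0" for r
  proof (induction r)
    case 0
    show ?case
    proof (intro allI impI)
      fix i j p assume "2 * n + 1 - 0 \<le> i + j"
      then consider "n < i" | "n < j" by linarith
      then show "d_uj i (pj j) (?o p) = 0" by cases (simp_all add: top d_uj_p_commute[of i j])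
    qed
  next
    case (Suc r)
    define s where "s = 2 * n + 1 - Suc r"
    have high: "d_uj i (pj j) (?o p) = 0" if "n \<le> i + j" "s < i + j" for i j p
    proof -
      have "2 * n + 1 - r \<le> i + j" using that unfolding s_def by linarith
      then show ?thesis using Suc.IH that by blast
    qed
    have dG: "d_uj m (Gj (Suc j)) (?o p) = (if m = 0 then 0 else d_uj (m - 1) (pj (Suc j)) (?o p)) + d_uj m (pj j) (?o p)"
      if "s = m + j" "n \<le> s" for m j p
    proof -
      have z: "d_uj m (pj (Suc j)) (?o p) = 0" for p using high[of m "Suc j"] that by simp
      have "e (d_uj m (pj (Suc j))) (?o p) = 0"
        using z by (simp add: e_zero_section holD(1) hol_partial hol_p zero_section_vanish Omega0_intros p_Omega0)
      moreover have "d_uj m (Gj (Suc j)) = (\<lambda>p. d_uj m (e (pj (Suc j))) p + d_uj m (pj j) p)"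
        unfolding G_Suc by (simp add: partial_rules Omega0_e p_Omega0)
      ultimately show ?thesis by (cases m) (simp_all add: d_uj_e_p)
    qed
    \<comment> \<open>The \<open>f\<^sub>u\<close>-part of the differentiated equation becomes a
      three-term recursion along the antidiagonal i + j = s. Its initial value at m = 0 is
      \<open>x0\<close>, so it forces the whole antidiagonal to vanish.\<close>
    have rel: "(if m = 0 then 0 else d_uj (m - 1) (pj (Suc j)) (?o p)) + d_uj m (pj j) (?o p)
        + (if j = 0 then 0 else d_uj (Suc m) (pj (j - 1)) (?o p)) = 0" if "s = m + j" "n \<le> s" for m j p
    proof -
      have "d_uj m (pj j) (?o p) - d_uj (Suc m) (Gj j) (?o p) - d_uj m (Gj (Suc j)) (?o p) = 0"
        using ind[of "d_zbar (d_uj m (Gj j)) (?o p)" "- d_uj 0 (d_uj m (Gj j)) (?o p)"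
            "d_uj m (pj j) (?o p) - d_uj (Suc m) (Gj j) (?o p) - d_uj m (Gj (Suc j)) (?o p)"]
          d_u_linearized_zero_section[of j m p] that by (simp add: mult.commute)
      moreover have "d_uj (Suc m) (Gj j) (?o p)
          = (if j = 0 then 0 else d_uj (Suc m) (pj (j - 1)) (?o p)) + d_uj m (pj j) (?o p)"
        using dG[of j m p] that by (simp add: d_uj_G_commute[of "Suc m"] d_uj_p_commute[of "Suc m"] d_uj_p_commute[of m])
      moreover have "b + x + c = 0" if "x - A - B = 0" "A = c + x" "B = b + x" for A B b c x :: complex
        using that by algebra
      ultimately show ?thesis using dG[OF that] by blast
    qed
    have zero: "\<forall>m'\<le>m. d_uj m' (pj (s - m')) (?o p) = 0" if "n \<le> s" "m \<le> s" for m p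
      using that(2)
    proof (induction m)
      case 0
      then show ?case using x0 by simp
    next
      case (Suc m)
      then have IH: "d_uj m' (pj (s - m')) (?o p) = 0" if "m' \<le> m" for m' using that by simp
      have "d_uj (Suc m) (pj (s - m - 1)) (?o p) = 0"
        using rel[of m "s - m" p] IH[of m] IH[of "m - 1"] Suc.prems \<open>n \<le> s\<close>
        by (cases m) (auto split: if_splits simp: Suc_diff_Suc)
      then show ?case using IH by (auto simp: le_Suc_eq)
    qed
    show ?case
    proof (intro allI impI)
      fix i j p assume ij: "n \<le> i + j" "2 * n + 1 - Suc r \<le> i + j"
      show "d_uj i (pj j) (?o p) = 0"
      proof (cases "i + j = s")
        case True
        then show ?thesis using zero[of i p] ij(1) by auto
      qed (use high ij s_def in auto)
    qed
  qed
  have S: "d_uj i (pj j) (?o p) = 0" if "n \<le> i + j" for i j p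
    using S[of "2 * n + 1"] that by simp
  obtain W where W: "W \<in> nobar" "\<And>p. (\<Sum>j\<le>n. (- 1) ^ j * (e ^^ j) (\<lambda>p. pj j p * e q_fun p) p) - zc p * e P p
      = cnj (W p) - cnj (zc p) * eb P p"
    by (rule euler_identity_order[OF EI]) (rule that)
  have gz: "d_z (pj n) = (\<lambda>p. 0)"
  proof
    fix p
    have "d_z (pj n) (?o p) = d_z (pj n) p" by (rule hol_const_uj[OF hol_partial(1)[OF hol_p] d_uj_d_z_p_top])
    then show "d_z (pj n) p = 0" using dz[of k p] n by simp
  qed
  let ?w = "\<lambda>j p. pj j p * e q_fun p"
  \<comment> \<open>The product with \<open>e q_fun\<close> has order below n - j on the zero
    section: \<open>e q_fun\<close> involves only u_0 and u_1, and n - j \<ge> 2.\<close>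
  have low: "d_uj n ((e ^^ j) (?w j)) (?o p) = 0" if "j + 2 \<le> n" for j p
    by (rule d_uj_e_pow_high[OF w_nobar, where r = "n - j"]) (use that S in \<open>auto simp: d_uj_w\<close>)
  have mid: "d_uj n ((e ^^ k) (?w k)) (?o p) = zc p * pj k (?o p)" for p
  proof -
    have "d_uj (Suc k) ((e ^^ k) (?w k)) (?o p) = d_uj 1 (?w k) (?o p)"
      by (rule d_uj_e_pow_1[OF w_nobar]) (use n S in \<open>auto simp: d_uj_w\<close>)
    then show ?thesis using S[of 1 k] n by (simp add: d_uj_w)
  qed
  \<comment> \<open>The n comes from n times \<open>d_z\<close> of z p_n, with p_n constant in z,
    and the extra 1 from the summand u_0 of \<open>e q_fun\<close>.\<close>
  have hi: "d_uj n ((e ^^ n) (?w n)) (?o p) = of_nat (Suc n) * pj n (?o p)" for p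
  proof -
    have "d_uj n ((e ^^ n) (?w n)) (?o p) = of_nat n * d_z (d_uj 1 (?w n)) (?o p) + d_uj 0 (?w n) (?o p)"
      by (rule d_uj_e_pow_0[OF w_nobar]) (simp add: d_uj_w p_top_kernel)
    moreover have "d_uj 1 (?w n) = (\<lambda>p. pj n p * zc p)" "d_uj 0 (?w n) = pj n"
      by (simp_all add: fun_eq_iff d_uj_w p_top_kernel)
    ultimately show ?thesis by (simp add: partial_rules p_Omega0 Omega0_intros gz algebra_simps)
  qed
  have "pj n p = 0" for p
  proof -
    \<comment> \<open>At z = 0 every term carrying z or its conjugate drops, including the summand j
      = k, and \<open>d_uj n\<close> annihilates the conjugate of W. Only j = n is left.\<close>
    let ?p = "?o (0, uc p, snd (snd p))"
    have E: "(\<lambda>p. (\<Sum>j\<le>n. (- 1) ^ j * (e ^^ j) (?w j) p) - zc p * e P p)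
      = (\<lambda>p. cnj (W p) - cnj (zc p) * eb P p)" using W(2) by auto
    have O: "(e ^^ j) (?w j) \<in> Omega0" for j using nobarD(1)[OF nobar_e_pow[OF w_nobar]] .
    have "d_uj n (\<lambda>p. (\<Sum>j\<le>n. (- 1) ^ j * (e ^^ j) (?w j) p) - zc p * e P p) ?p
      = d_uj n (\<lambda>p. cnj (W p) - cnj (zc p) * eb P p) ?p" unfolding E ..
    moreover have "d_uj n (\<lambda>p. cnj (W p) - cnj (zc p) * eb P p) ?p = 0"
      by (simp add: partial_rules Omega0_intros nobarD[OF W(1)] Omega0_eb P_Omega0)
    moreover have "d_uj n (\<lambda>p. (\<Sum>j\<le>n. (- 1) ^ j * (e ^^ j) (?w j) p) - zc p * e P p) ?p
      = (\<Sum>j\<le>n. (- 1) ^ j * d_uj n ((e ^^ j) (?w j)) ?p)"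
      by (simp add: partial_rules Omega0_intros O Omega0_e P_Omega0 del: sum.atMost_Suc)
    moreover have "(\<Sum>j\<le>n. (- 1) ^ j * d_uj n ((e ^^ j) (?w j)) ?p)
       = (\<Sum>j\<le>n. if j = n then (- 1) ^ n * (of_nat (Suc n) * pj n ?p) else 0)"
    proof (intro sum.cong refl)
      fix j assume "j \<in> {..n}"
      then consider "j + 2 \<le> n" | "j = k" | "j = n" using n by fastforce
      then show "(- 1) ^ j * d_uj n ((e ^^ j) (?w j)) ?p = (if j = n then (- 1) ^ n * (of_nat (Suc n) * pj n ?p) else 0)"
        by cases (use low mid hi n in simp_all)
    qed
    ultimately have "(- 1) ^ n * (of_nat (Suc n) * pj n ?p) = 0" by simp
    then have 0: "pj n (0, uc p, snd (snd p)) = 0"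
      using p_top_zero_section[of "(0, uc p, snd (snd p))"] by (simp del: of_nat_Suc)
    have "pj n ((0, uc p, snd (snd p)) + 1 *\<^sub>R (zc p, 0, 0)) = pj n (0, uc p, snd (snd p))"
    proof (rule line_const)
      show sm: "smooth (pj n)" by (rule Omega0_smooth[OF p_Omega0])
      obtain K where K: "of_order K (pj n)" using p_Omega0 by (auto simp: Omega0_iff)
      show "dird (zc p, 0, 0) (pj n) ((0, uc p, snd (snd p)) + t *\<^sub>R (zc p, 0, 0)) = 0" for t
        using dird_decomp[OF sm K order_refl, of "(zc p, 0, 0)"] by (simp add: gz p_top_kernel zero_fun_def)
    qed
    then show "pj n p = 0" using 0 by (cases p) (simp add: zero_fun_def plus_fun_def)
  qed
  then show ?thesis by auto
qed

end

section \<open>The exponential case and order zero\<close>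

lemma derivation_power:
  assumes "derivation D" "F \<in> Omega0"
  shows "D (\<lambda>p. F p ^ i) = (\<lambda>p. of_nat i * F p ^ (i - 1) * D F p)"
proof (induction i)
  case (Suc i)
  have "D (\<lambda>p. F p ^ Suc i) = (\<lambda>p. F p * D (\<lambda>p. F p ^ i) p + D F p * F p ^ i)"
    using derivation_mult[OF assms(1,2) Omega0_power[OF assms(2)], of i] by simp
  also have "\<dots> = (\<lambda>p. of_nat (Suc i) * F p ^ (Suc i - 1) * D F p)"
    unfolding Suc by (cases i) (simp_all add: fun_eq_iff algebra_simps)
  finally show ?case .
qed (simp add: derivation_const[OF assms(1)])

lemmas partial_power = derivation_partial[THEN derivation_power]

text \<open>Away from z = 0 one divides; at z = 0 continuity along a line through nearby points
  concludes.\<close>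

lemma zc_mult_eq_0:
  assumes F: "F \<in> Omega0" and z: "\<And>p. zc p * F p = 0"
  shows "F = (\<lambda>p. 0)"
proof
  fix p
  show "F p = 0"
  proof (cases "zc p = 0")
    case True
    have "F (p + t *\<^sub>R (1, 0, 0)) = 0" if "t > 0" for t
    proof -
      have "zc (p + t *\<^sub>R (1, 0, 0)) \<noteq> 0" using True that by (simp add: scaleR_conv_of_real)
      then show ?thesis using z[of "p + t *\<^sub>R (1, 0, 0)"] by simp
    qed
    then have "((\<lambda>t. F (p + t *\<^sub>R (1, 0, 0))) \<longlongrightarrow> 0) (at_right 0)"
      by (intro tendsto_eventually) (auto simp: eventually_at_right_less intro: eventually_mono[OF eventually_at_right_less])
    moreover have "((\<lambda>t. F (p + t *\<^sub>R (1, 0, 0))) \<longlongrightarrow> F (p + 0 *\<^sub>R (1, 0, 0))) (at_right 0)"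
    proof -
      have "isCont (\<lambda>t. F (p + t *\<^sub>R (1, 0, 0))) 0"
        using smooth_line[OF Omega0_smooth[OF F], of p "(1, 0, 0)" 0] by (rule has_vector_derivative_continuous)
      then show ?thesis by (simp add: isCont_def filterlim_at_split)
    qed
    ultimately have "0 = F (p + 0 *\<^sub>R (1, 0, 0))" by (rule tendsto_unique[OF trivial_limit_at_right_real])
    then show ?thesis by (simp only: scaleR_zero_left add_0_right)
  qed (use z[of p] in simp)
qed

lemma all_partials_zero:
  assumes F: "F \<in> Omega0" and 0: "\<And>a. partial a F = (\<lambda>p. 0)"
  shows "F p = F q"
proof -
  obtain k where k: "of_order k F" using F by (auto simp: Omega0_iff)
  have "dird v F p = 0" for v p
    using dird_decomp[OF Omega0_smooth[OF F] k order_refl, of v p] 0[of DZ] 0[of DZb] 0[of DU] 0[of "DJ _"] 0[of "DJb _"]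
    by simp
  from line_const[OF Omega0_smooth[OF F] this, where p = q and v = "p - q" and t = 1] show ?thesis by simp
qed

context symmetry_order
begin

text \<open>
  If \<open>f\<^sub>u = \<alpha> + \<beta> f\<close> then \<open>H = \<beta> d_zbar + \<alpha> d_uj 0\<close> annihilates all \<open>Gj j\<close>. On the slice \<open>u\<^sub>1 = u\<^sub>2 = \<dots> = 0\<close>, where
  \<open>T\<^sup>i\<close> is \<open>\<beta>\<^sup>i\<^sup>-\<^sup>1 f\<^sub>u u\<^sub>0\<^sup>i\<close>, iterating \<open>H\<close> on the linearized equation isolates the top coefficient.
\<close>
lemma p_top_exponential:
  assumes fu: "\<And>x. deriv f x = \<alpha> + \<beta> * f x" and \<alpha>: "\<alpha> \<noteq> 0" and \<beta>: "\<beta> \<noteq> 0" and n: "n = Suc k"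
  shows "pj n = (\<lambda>p. 0)"
proof -
  let ?a = "complex_of_real \<alpha>" and ?b = "complex_of_real \<beta>"
  have fuu: "deriv (deriv f) x = \<beta> * deriv f x" for x
  proof -
    have "((\<lambda>x. \<alpha> + \<beta> * f x) has_real_derivative \<beta> * deriv f x) (at x)"
      by (auto intro!: derivative_eq_intros DERIV_f)
    moreover have "deriv f = (\<lambda>x. \<alpha> + \<beta> * f x)" using fu by auto
    ultimately show ?thesis by (simp add: DERIV_imp_deriv)
  qed
  have Tu: "d_u (d_u (T i)) = (\<lambda>p. ?b * d_u (T i) p)" for i
  proof (induction i rule: less_induct)
    case (less i)
    show ?case
    proof (cases i)
      case 0
      then show ?thesis by (simp add: partial_f partial_f' fuu)
    next
      case (Suc m)
      have "d_u (T (Suc m)) = (\<lambda>p. ?b * T (Suc m) p)"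
        unfolding T_partial_Suc[OF derivation_partial(3)]
        by (simp add: fun_eq_iff sum_distrib_left less Suc mult_ac)
      then have "d_u (d_u (T (Suc m))) = d_u (\<lambda>p. ?b * T (Suc m) p)" by simp
      also have "\<dots> = (\<lambda>p. ?b * d_u (T (Suc m)) p)"
        by (simp add: partial_rules T_Omega0 Omega0_intros del: jetT.simps)
      finally show ?thesis using Suc by simp
    qed
  qed
  \<comment> \<open>All T^i except T^0 are eigenfunctions of \<open>d_u\<close> with eigenvalue
    \<beta>; the defect \<alpha> at i = 0 is what produces the operator H.\<close>
  have TuS: "d_u (T i) p = ?b * T i p + (if i = 0 then ?a else 0)" for i p
  proof (cases i)
    case 0
    then show ?thesis by (simp add: partial_f fu)
  next
    case (Suc m)
    then show ?thesis
      unfolding Suc T_partial_Suc[OF derivation_partial(3)]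
      by (simp add: sum_distrib_left Tu mult_ac)
  qed
  have jTu: "d_u (d_uj j (T i)) p = ?b * d_uj j (T i) p" for i j p
  proof -
    have "d_u (T i) = (\<lambda>p. ?b * T i p + (if i = 0 then ?a else 0))" by (rule ext) (rule TuS)
    then have "d_uj j (d_u (T i)) p = d_uj j (\<lambda>p. ?b * T i p + (if i = 0 then ?a else 0)) p" by simp
    then show ?thesis
      by (simp add: derivation_commute[OF derivation_partial(3) derivation_partial(4) T_Omega0]
          partial_rules Omega0_intros T_Omega0 del: jetT.simps)
  qed
  \<comment> \<open>Apply \<open>d_u\<close> - \<beta> to the linearized equation. Every term
    containing some T^i with i \<ge> 1 or \<open>f\<^sub>u\<close> cancels, and what remains is
    minus H applied to \<open>Gj j\<close>.\<close>
  have HG: "?b * d_zbar (Gj j) p + ?a * d_uj 0 (Gj j) p = 0" for j p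
  proof -
    define N where "N = Suc n"
    have DG: "d_uj i (Gj j) = (\<lambda>p. 0)" if "N < i" for i using that by (simp add: d_uj_G_top N_def)
    let ?L = "\<lambda>p. d_zbar (Gj j) p - (\<Sum>i\<le>N. T i p * d_uj i (Gj j) p) - (\<Sum>i\<le>N. d_uj j (T i) p * Gj i p) + fu p * pj j p"
    have L: "?L p = 0" for p
      using linearized[of N j p] eb_hol[OF hol_G DG, where p = p] by (simp add: N_def)
    then have "d_u ?L p = d_u (\<lambda>p. 0) p" by (metis (no_types, lifting) ext)
    then have "- (\<Sum>i\<le>N. d_u (T i) p * d_uj i (Gj j) p) - (\<Sum>i\<le>N. d_u (d_uj j (T i)) p * Gj i p)
        + of_real (deriv (deriv f) (uc p)) * pj j p = 0"
      by (simp add: partial_rules Omega0_intros G_Omega0 T_Omega0 p_Omega0 Omega0_f partial_f' holD(3)[OF hol_G]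
          holD(3)[OF hol_p] holD(3)[OF hol_partial(2)[OF hol_G]] holD(3)[OF hol_partial(3)[OF hol_G]] del: jetT.simps)
    moreover have "(\<Sum>i\<le>N. d_u (T i) p * d_uj i (Gj j) p)
       = ?b * (\<Sum>i\<le>N. T i p * d_uj i (Gj j) p) + ?a * d_uj 0 (Gj j) p"
    proof -
      have "(\<Sum>i\<le>N. d_u (T i) p * d_uj i (Gj j) p)
        = (\<Sum>i\<le>N. ?b * (T i p * d_uj i (Gj j) p) + (if i = 0 then ?a * d_uj 0 (Gj j) p else 0))"
        unfolding TuS by (intro sum.cong refl) (simp add: algebra_simps del: jetT.simps)
      then show ?thesis by (simp add: sum.distrib sum_distrib_left)
    qed
    moreover have "(\<Sum>i\<le>N. d_u (d_uj j (T i)) p * Gj i p) = ?b * (\<Sum>i\<le>N. d_uj j (T i) p * Gj i p)"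
      unfolding jTu by (simp add: sum_distrib_left mult.assoc)
    ultimately have *: "- (?b * X + ?a * d_uj 0 (Gj j) p) - ?b * Y + ?b * fu p * pj j p = 0"
      if "X = (\<Sum>i\<le>N. T i p * d_uj i (Gj j) p)" "Y = (\<Sum>i\<le>N. d_uj j (T i) p * Gj i p)" for X Y
      using that by (simp add: fuu)
    have "?b * (d_zbar (Gj j) p - X - Y + fu p * pj j p) = 0"
      if "X = (\<Sum>i\<le>N. T i p * d_uj i (Gj j) p)" "Y = (\<Sum>i\<le>N. d_uj j (T i) p * Gj i p)" for X Y
      using L[of p] that by simp
    from this[OF refl refl] *[OF refl refl] show ?thesis by algebra
  qed
  let ?H = "\<lambda>w p. ?b * d_zbar w p + ?a * d_uj 0 w p"
  \<comment> \<open>H commutes with e on the coefficients p_j, because they are free of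
    \<open>u\<close>; \<open>G_Suc\<close> then carries the vanishing down from index n + 1.\<close>
  have Hp: "?H (pj (Suc n - i)) = (\<lambda>p. 0)" for i
  proof (induction i)
    case 0
    then show ?case by (simp add: top)
  next
    case (Suc i)
    show ?case
    proof (cases "i \<le> n")
      case True
      define j where "j = n - i"
      have j: "Suc n - i = Suc j" "Suc n - Suc i = j" using True by (simp_all add: j_def)
      have "e (?H (pj (Suc j))) = (\<lambda>p. 0)" using Suc.IH j by simp
      moreover have "e (?H (pj (Suc j))) = (\<lambda>p. ?H (e (pj (Suc j))) p)"
        by (simp add: e_m1_rules Omega0_intros p_Omega0 d_z_e d_uj_e_p)
      moreover have "?H (Gj (Suc j)) p = ?H (e (pj (Suc j))) p + ?H (pj j) p" for p
        unfolding G_Suc by (simp add: partial_rules Omega0_intros Omega0_e p_Omega0 algebra_simps)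
      ultimately have "?H (pj j) p = 0" for p using HG[of "Suc j" p] by (metis add_0)
      then show ?thesis using j by simp
    qed (use Suc in simp)
  qed
  have Hp0: "?H (pj 0) p = 0" for p using fun_cong[OF Hp[of "Suc n"], of p] by simp
  have Tsl: "T (Suc i) p = ?b ^ i * fu p * uj 0 p ^ Suc i" if "p \<in> u0_slice" for i p
  proof (induction i)
    case 0
    show ?case by (simp add: partial_f)
  next
    case (Suc i)
    have "T (Suc (Suc i)) p = (\<Sum>j\<le>Suc i. if j = Suc i then uj 0 p * d_u (T (Suc i)) p else 0)"
      unfolding jetT.simps(2)[of f "Suc i"]
      by (intro sum.cong refl) (use that in \<open>auto simp: u0_slice_def simp del: jetT.simps\<close>)
    also have "\<dots> = uj 0 p * d_u (T (Suc i)) p" by simp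
    finally show ?case unfolding TuS Suc by simp
  qed
  have dTsl: "d_uj 0 (T (Suc i)) p = ?b ^ i * fu p * (of_nat (Suc i) * uj 0 p ^ i)" if "p \<in> u0_slice" for i p
  proof -
    have "d_uj 0 (T (Suc i)) p = d_uj 0 (\<lambda>p. ?b ^ i * fu p * uj 0 p ^ Suc i) p"
      by (rule u0_slice_cong(1)[OF _ _ Tsl that]) (simp_all add: T_Omega0 Omega0_intros Omega0_f del: jetT.simps power_Suc)
    then show ?thesis
      by (simp add: partial_rules partial_power Omega0_intros Omega0_f partial_f' del: jetT.simps power_Suc)
  qed
  \<comment> \<open>The falling factorial of i with m factors. It vanishes for m > i, which makes
    truncated exponents such as i - m harmless.\<close>
  define c where "c m i = (\<Prod>l<m. of_nat i - of_nat l :: complex)" for m i :: nat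
  have c_Suc: "c (Suc m) i = c m i * of_nat (i - m)" for m i
  proof (cases "m \<le> i")
    case False
    then have "c m i = 0" unfolding c_def by (intro prod_zero) auto
    then show ?thesis by (simp add: c_def)
  qed (simp add: c_def of_nat_diff)
  \<comment> \<open>The sum of \<beta>^i u_0^(i+1) G_(i+1), differentiated m times in the explicit
    u_0 while the G are held fixed. As H annihilates the G and sends u_0 to \<alpha>, it maps
    \<open>s m\<close> to \<alpha> times \<open>s (Suc m)\<close>.\<close>
  define s where "s m p = (\<Sum>i\<le>n. c m (Suc i) * ?b ^ i * uj 0 p ^ (Suc i - m) * Gj (Suc i) p)" for m p
  have sO: "s m \<in> Omega0" for m
    unfolding s_def[abs_def] by (intro Omega0_intros G_Omega0 Omega0_e P_Omega0)
  have Hs: "?H (s m) = (\<lambda>p. ?a * s (Suc m) p)" for m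
  proof
    fix p
    have "?H (s m) p = (\<Sum>i\<le>n. c m (Suc i) * ?b ^ i * (uj 0 p ^ (Suc i - m) * ?H (Gj (Suc i)) p
         + ?a * of_nat (Suc i - m) * uj 0 p ^ (Suc i - m - 1) * Gj (Suc i) p))"
      unfolding s_def[abs_def]
      by (simp add: partial_rules partial_power Omega0_intros G_Omega0 sum_distrib_left sum.distrib algebra_simps
          del: sum.atMost_Suc of_nat_Suc)
    also have "\<dots> = ?a * s (Suc m) p"
      unfolding HG s_def c_Suc by (simp add: sum_distrib_left mult_ac)
    finally show "?H (s m) p = ?a * s (Suc m) p" .
  qed
  have d0s: "d_uj 0 (s 0) p = (\<Sum>i\<le>n. ?b ^ i * (of_nat (Suc i) * uj 0 p ^ i * Gj (Suc i) p + uj 0 p ^ Suc i * d_uj 0 (Gj (Suc i)) p))" for p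
    unfolding s_def[abs_def]
    by (simp add: c_def partial_rules partial_power Omega0_intros G_Omega0 algebra_simps
        del: sum.atMost_Suc of_nat_Suc power_Suc)
  let ?K = "\<lambda>p. d_zbar (Gj 0) p - ?a * (d_uj 0 (s 0) p - pj 0 p)"
  have s0_hol: "s 0 \<in> hol"
    unfolding s_def[abs_def] by (intro hol_sum hol_mult hol_const hol_power hol_uj hol_G)
  have K_hol: "?K \<in> hol"
    by (intro hol_diff hol_mult hol_const hol_partial hol_G hol_p s0_hol)
  \<comment> \<open>This is the linearized equation for j = 0, multiplied by \<alpha>;
    \<open>HG\<close> trades \<alpha> d_0 G_0 for - \<beta> d_zbar G_0, so that \<alpha> + \<beta> f
    = f_u factors out.\<close>
  have fuK: "fu p * ?K p = 0" if p: "p \<in> u0_slice" for p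
  proof -
    have DG: "d_uj i (Gj 0) = (\<lambda>p. 0)" if "Suc n < i" for i using that by (simp add: d_uj_G_top)
    have L: "d_zbar (Gj 0) p - (\<Sum>i\<le>Suc n. T i p * d_uj 0 (Gj i) p) - (\<Sum>i\<le>Suc n. d_uj 0 (T i) p * Gj i p) + fu p * pj 0 p = 0"
      using linearized[of "Suc n" 0 p] eb_hol[OF hol_G DG, where p = p]
      by (simp add: d_uj_G_commute[of _ 0] del: jetT.simps sum.atMost_Suc)
    have "(\<Sum>i\<le>Suc n. T i p * d_uj 0 (Gj i) p) = of_real (f (uc p)) * d_uj 0 (Gj 0) p
        + (\<Sum>i\<le>n. ?b ^ i * fu p * uj 0 p ^ Suc i * d_uj 0 (Gj (Suc i)) p)"
      by (simp only: sum.atMost_Suc_shift Tsl[OF p]) simp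
    moreover have "(\<Sum>i\<le>Suc n. d_uj 0 (T i) p * Gj i p)
        = (\<Sum>i\<le>n. ?b ^ i * fu p * (of_nat (Suc i) * uj 0 p ^ i) * Gj (Suc i) p)"
      by (simp only: sum.atMost_Suc_shift dTsl[OF p]) (simp add: partial_f)
    moreover have "fu p * d_uj 0 (s 0) p = (\<Sum>i\<le>n. ?b ^ i * fu p * uj 0 p ^ Suc i * d_uj 0 (Gj (Suc i)) p)
        + (\<Sum>i\<le>n. ?b ^ i * fu p * (of_nat (Suc i) * uj 0 p ^ i) * Gj (Suc i) p)"
      unfolding d0s by (simp add: sum_distrib_left distrib_left sum.distrib mult_ac del: power_Suc of_nat_Suc)
    ultimately have "d_zbar (Gj 0) p - of_real (f (uc p)) * d_uj 0 (Gj 0) p - fu p * (d_uj 0 (s 0) p - pj 0 p) = 0"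
      using L by (simp add: algebra_simps)
    moreover have "fu p = ?a + ?b * of_real (f (uc p))" by (simp add: fu)
    ultimately show ?thesis using HG[of 0 p] by algebra
  qed
  \<comment> \<open>Moving \<open>u\<close> to a point with f_u \<noteq> 0 removes the factor, since
    K does not depend on \<open>u\<close>.\<close>
  obtain x where x: "deriv f x \<noteq> 0" using indep[rule_format, of 0 1] by auto
  have K: "?K p = 0" if p: "p \<in> u0_slice" for p
  proof -
    have "freeze_u x p \<in> u0_slice" using p by (simp add: u0_slice_def)
    from fuK[OF this] have "?K (freeze_u x p) = 0" using x by simp
    then show ?thesis using hol_freeze[OF K_hol, of x p] by simp
  qed
  have slice_step: "?H F p = 0" if "\<And>p. p \<in> u0_slice \<Longrightarrow> F p = 0" "p \<in> u0_slice" for F p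
    using u0_slice_vanish[OF that] by simp
  have comm: "?H (d_uj 0 F) = d_uj 0 (?H F)" if "F \<in> Omega0" for F
    using that by (simp add: partial_rules Omega0_intros
        derivation_commute[OF derivation_partial(2) derivation_partial(4)])
  have commp: "d_uj 0 (?H F) p = ?H (d_uj 0 F) p" if "F \<in> Omega0" for F p
    using fun_cong[OF comm[OF that], of p] by (rule sym)
  \<comment> \<open>H is tangent to the slice, so it may be applied to K = 0. It annihilates G_0 and
    p_0, leaving \<alpha> times H of the u_0-derivative of \<open>s 0\<close>.\<close>
  have s1: "d_uj 0 (s 1) p = 0" if p: "p \<in> u0_slice" for p
  proof -
    have HK: "?H ?K p = 0" by (rule slice_step[OF K p])
    have HK': "?H ?K p = ?H (d_zbar (Gj 0)) p - ?a * (?H (d_uj 0 (s 0)) p - ?H (pj 0) p)"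
      by (simp add: partial_rules Omega0_intros G_Omega0 sO p_Omega0 algebra_simps)
    have "?H (d_zbar (Gj 0)) = d_zbar (?H (Gj 0))"
      by (simp add: partial_rules Omega0_intros G_Omega0 derivation_commute[OF derivation_partial(2) derivation_partial(4)])
    moreover have "?H (Gj 0) = (\<lambda>p. 0)" by (rule ext) (rule HG)
    ultimately have "?H (d_zbar (Gj 0)) = (\<lambda>p. 0)" by simp
    then have "?H (d_zbar (Gj 0)) p = 0" by (rule fun_cong)
    moreover note HK HK'
    ultimately have "?a * ?H (d_uj 0 (s 0)) p = 0" using Hp0[of p] by simp
    then have "?H (d_uj 0 (s 0)) p = 0" using \<alpha> by (simp only: mult_eq_0_iff of_real_eq_0_iff) simp
    then have "d_uj 0 (?H (s 0)) p = 0" unfolding commp[OF sO] .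
    then show ?thesis using \<alpha> unfolding Hs by (simp add: partial_rules Omega0_intros sO)
  qed
  have sm: "\<forall>p\<in>u0_slice. d_uj 0 (s (Suc m)) p = 0" for m
  proof (induction m)
    case 0
    then show ?case using s1 by simp
  next
    case (Suc m)
    show ?case
    proof
      fix p assume p: "p \<in> u0_slice"
      have "?H (d_uj 0 (s (Suc m))) p = 0" by (rule slice_step[OF _ p]) (use Suc in blast)
      then have "d_uj 0 (?H (s (Suc m))) p = 0" unfolding commp[OF sO] .
      then show "d_uj 0 (s (Suc (Suc m))) p = 0" using \<alpha> unfolding Hs by (simp add: partial_rules Omega0_intros sO)
    qed
  qed
  \<comment> \<open>After n differentiations only the powers u_0^n and u_0^(n+1) survive,
    accompanied by G_n and by G_(n+1) = p_n. Since G_n has no jet derivatives, the u_0-derivative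
    isolates p_n.\<close>
  have sn: "s n p = c n n * ?b ^ k * Gj n p + c n (Suc n) * ?b ^ n * uj 0 p * pj n p" for p
  proof -
    have "c n (Suc i) = 0" if "i < k" for i
      unfolding c_def using that n by (intro prod_zero) (auto intro!: bexI[of _ "Suc i"])
    then have "(\<Sum>i<k. c n (Suc i) * ?b ^ i * uj 0 p ^ (Suc i - n) * Gj (Suc i) p) = 0" by simp
    moreover have "{..n} = insert n (insert k {..<k})" using n by auto
    ultimately show ?thesis unfolding s_def using n by (simp add: G_top(1)[unfolded n] del: power_Suc)
  qed
  have dsn: "d_uj 0 (s n) p = c n (Suc n) * ?b ^ n * pj n p" for p
    unfolding sn[abs_def]
    by (simp add: partial_rules Omega0_intros G_Omega0 p_Omega0 p_top_kernel G_n_kernel)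
  have c: "c n (Suc n) \<noteq> 0"
    unfolding c_def by (simp add: prod_zero_iff del: of_nat_Suc)
  have "pj n (dilate 0 p) = 0" for p
  proof -
    have "dilate 0 p \<in> u0_slice" by (simp add: u0_slice_def)
    then have "d_uj 0 (s (Suc k)) (dilate 0 p) = 0" using sm[of k] by blast
    then have "c n (Suc n) * ?b ^ n * pj n (dilate 0 p) = 0" unfolding n[symmetric] dsn .
    then show ?thesis using c \<beta> by simp
  qed
  then show ?thesis using p_top_zero_section by auto
qed

text \<open>The u_0-derivative of the Euler identity is p_0 = z d_z p_0, so p_0 = C z, the leading
  coefficient of C \<open>q_fun\<close>. Rotation invariance of z u_0 then contradicts a nonzero
  weight unless C = 0.\<close>

lemma p_order_0:
  assumes n: "n = 0" and EI: euler_identity and wt: "weighted_degree P d" and d: "d \<noteq> 0"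
  shows "pj 0 = (\<lambda>p. 0)"
proof -
  have z: "pj (Suc j) = (\<lambda>p. 0)" for j using top n by simp
  have x: "d_uj i (pj 0) = (\<lambda>p. 0)" for i using p_top_kernel(1) n by simp
  have zb: "d_zbar (pj 0) = (\<lambda>p. 0)" using p_top_kernel(2) n by simp
  obtain W where W: "W \<in> nobar" "\<And>p. (\<Sum>j\<le>n. (- 1) ^ j * (e ^^ j) (\<lambda>p. pj j p * e q_fun p) p) - zc p * e P p
      = cnj (W p) - cnj (zc p) * eb P p"
    by (rule euler_identity_order[OF EI]) (rule that)
  have E: "(\<lambda>p. pj 0 p * e q_fun p - zc p * e P p) = (\<lambda>p. cnj (W p) - cnj (zc p) * eb P p)"
    using W(2) n by (simp add: fun_eq_iff)
  obtain k where k: "of_order k P" using P_Omega0 by (auto simp: Omega0_iff)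
  have ebP: "d_uj 0 (eb P) = (\<lambda>p. 0)"
  proof -
    have "d_uj 0 (T i) p * pj i p = 0" for i p
      by (cases i) (simp_all add: z partial_f del: jetT.simps(2))
    then have "(\<Sum>i\<le>k. d_uj 0 (T i) p * pj i p) = 0" for p by (intro sum.neutral) blast
    then show ?thesis
      using eb_p_top n by (simp add: d_uj_eb[OF P_Omega0 k order_refl] del: mult_eq_0_iff)
  qed
  have "d_uj 0 (\<lambda>p. cnj (W p) - cnj (zc p) * eb P p) = (\<lambda>p. 0)"
    by (simp add: partial_rules Omega0_intros nobarD[OF W(1)] Omega0_eb P_Omega0 ebP)
  moreover have "d_uj 0 (\<lambda>p. pj 0 p * e q_fun p - zc p * e P p) = (\<lambda>p. pj 0 p - zc p * d_z (pj 0) p)"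
    using e_p_top n by (simp add: partial_rules Omega0_intros p_Omega0 e_q_nobar Omega0_e P_Omega0 x G_0)
  ultimately have g: "pj 0 = (\<lambda>p. zc p * d_z (pj 0) p)" unfolding E by (simp add: fun_eq_iff)
  \<comment> \<open>A further z-derivative gives z d_z d_z p_0 = 0, so d_z p_0 is constant.\<close>
  have "d_z (pj 0) = (\<lambda>p. zc p * d_z (d_z (pj 0)) p + d_z (pj 0) p)"
    by (subst g) (simp add: partial_rules Omega0_intros p_Omega0)
  then have "zc p * d_z (d_z (pj 0)) p = 0" for p by (simp add: fun_eq_iff)
  then have zz: "d_z (d_z (pj 0)) = (\<lambda>p. 0)" by (intro zc_mult_eq_0 Omega0_intros p_Omega0)
  have hol: "d_z (pj 0) \<in> hol" by (intro hol_partial hol_p)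
  have const: "d_z (pj 0) p = d_z (pj 0) 0" for p
  proof (rule all_partials_zero)
    show "d_z (pj 0) \<in> Omega0" using hol by (rule holD)
    show "partial a (d_z (pj 0)) = (\<lambda>p. 0)" for a
    proof (cases a)
      case DZb
      then show ?thesis by (simp add: derivation_commute[OF derivation_partial(2) derivation_partial(1) p_Omega0] zb)
    next
      case (DJ i)
      then show ?thesis by (simp add: derivation_commute[OF derivation_partial(4) derivation_partial(1) p_Omega0] x)
    qed (use zz holD(3,4)[OF hol] in simp_all)
  qed
  define C where "C = d_z (pj 0) 0"
  have gC: "pj 0 p = zc p * C" for p using fun_cong[OF g, of p] const[of p] by (simp add: C_def)
  \<comment> \<open>A rotation with l^d = -1: it reverses the sign of P but leaves z u_0
    fixed.\<close>
  define l where "l = cis (pi / of_int d)"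
  have l: "cmod l = 1" "l \<noteq> 0" by (simp_all add: l_def)
  have "l powi d = cis (of_int d * (pi / of_int d))"
    unfolding l_def by (simp add: cis_power_int)
  then have ld: "l powi d = -1" using d by simp
  have rot: "P (rot l p) = - P p" for p
    using wt l(1) ld unfolding weighted_degree_def by simp
  have lin: "rot l (p + t *\<^sub>R v) = rot l p + t *\<^sub>R rot l v" for p v t
    by (simp add: rot_def scaleR_fun_def fun_eq_iff algebra_simps)
  have "dird (0, 0, 0(0 := c)) (\<lambda>p. P (rot l p)) p = dird (0, 0, 0(0 := l * c)) P (rot l p)" for c p
  proof -
    have "rot l (0, 0, 0(0 := c)) = (0, 0, 0(0 := l * c))" by (simp add: rot_def fun_eq_iff)
    then show ?thesis by (simp only: dird_def lin)
  qed
  then have "d_uj 0 (\<lambda>p. P (rot l p)) p = l * pj 0 (rot l p)" for p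
    unfolding d_uj_def[of 0 "\<lambda>p. P (rot l p)"] dird_uj[OF P_Omega0] by (simp add: dird_uj[OF P_Omega0] field_simps)
  moreover have "d_uj 0 (\<lambda>p. P (rot l p)) p = - pj 0 p" for p
    unfolding rot by (simp add: partial_rules P_Omega0)
  ultimately have "l * pj 0 (rot l (1, 0, 0)) = - pj 0 (1, 0, 0)" by metis
  then have "l * (inverse l * C) = - C" by (simp add: gC rot_def)
  moreover have "l * (inverse l * C) = C" unfolding mult.assoc[symmetric] using l(2) by simp
  ultimately have "C = - C" by simp
  then have "C = 0" by (simp add: equation_minus_iff complex_eq_iff)
  then show ?thesis using gC by (simp add: fun_eq_iff)
qed

end

context symmetry
begin

text \<open>If 1, f, f_u satisfy a relation that involves f or f_u, then f_u = \<alpha> + \<beta> f.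
  Nonlinearity of f gives \<beta> \<noteq> 0, and independence of f and f_u gives \<alpha> \<noteq>
  0.\<close>

lemma p_zero:
  assumes nonlinear: "\<And>c. \<exists>x. deriv f x \<noteq> c"
    and EI: "\<And>N. N0 \<le> N \<Longrightarrow> \<exists>W\<in>nobar. \<forall>p. (\<Sum>j\<le>N. (- 1) ^ j * (e ^^ j) (\<lambda>p. pj j p * e q_fun p) p) - zc p * e P p
      = cnj (W p) - cnj (zc p) * eb P p"
    and wt: "weighted_degree P d" and d: "d \<noteq> 0"
  shows "pj j = (\<lambda>p. 0)"
proof (rule order_descent[OF P_Omega0])
  fix m assume "\<And>j. m < j \<Longrightarrow> pj j = (\<lambda>p. 0)"
  then interpret symmetry_order f P m by unfold_locales
  have EI: euler_identity
    unfolding euler_identity_def using EI[of "max N0 m"] by (intro exI[of _ "max N0 m"]) simp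
  show "pj m = (\<lambda>p. 0)"
  proof (cases m)
    case 0
    then show ?thesis using p_order_0[OF 0 EI wt d] by simp
  next
    case (Suc k)
    show ?thesis
    proof (cases "\<forall>A B C. (\<forall>x. A + B * of_real (f x) + C * of_real (deriv f x) = (0::complex)) \<longrightarrow> B = 0 \<and> C = 0")
      case True
      show ?thesis by (rule p_top_generic[OF _ Suc EI]) (use True in blast)
    next
      case False
      then obtain A B C where ABC: "\<And>x. A + B * of_real (f x) + C * of_real (deriv f x) = (0::complex)"
        "B \<noteq> 0 \<or> C \<noteq> 0" by blast
      have C: "C \<noteq> 0"
      proof
        assume "C = 0"
        then have "A + B * of_real (f x) = 0" for x using ABC(1)[of x] by simp
        then have "B = 0" by (rule f_complex_nonconst)
        then show False using ABC(2) \<open>C = 0\<close> by simp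
      qed
      define a b where "a = - A / C" and "b = - B / C"
      \<comment> \<open>The relation has complex coefficients; since f is real, its real part is
        again a relation.\<close>
      define \<alpha> \<beta> where "\<alpha> = Re a" and "\<beta> = Re b"
      have fu: "deriv f x = \<alpha> + \<beta> * f x" for x
      proof -
        have "C * of_real (deriv f x) = - A - B * of_real (f x)" using ABC(1)[of x] by algebra
        then have "complex_of_real (deriv f x) = (- A - B * of_real (f x)) / C"
          using C by (metis nonzero_mult_div_cancel_left)
        then have "complex_of_real (deriv f x) = a + b * of_real (f x)"
          by (simp add: diff_divide_distrib a_def b_def)
        then have "Re (complex_of_real (deriv f x)) = Re (a + b * of_real (f x))" by simp
        then show ?thesis by (simp add: \<alpha>_def \<beta>_def)
      qed
      have "\<beta> \<noteq> 0" using nonlinear[of \<alpha>] fu by auto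
      moreover have "\<alpha> \<noteq> 0" using indep[rule_format, of "- \<beta>" 1] fu by auto
      ultimately show ?thesis using p_top_exponential[OF fu _ _ Suc] by blast
    qed
  qed
qed

end

section \<open>The Euler operator\<close>

context poisson_indep
begin

definition euler :: "nat \<Rightarrow> (jet \<Rightarrow> complex) \<Rightarrow> jet \<Rightarrow> complex" where
  "euler N F p = (\<Sum>j\<le>N. (- 1) ^ j * (e ^^ j) (d_uj j F) p)"

lemma e_pow_add: "F \<in> Omega0 \<Longrightarrow> G \<in> Omega0 \<Longrightarrow> (e ^^ j) (\<lambda>p. F p + G p) = (\<lambda>p. (e ^^ j) F p + (e ^^ j) G p)"
  by (induction j) (simp_all add: e_m1_rules Omega0_e_pow)

lemma e_pow_cmult: "F \<in> Omega0 \<Longrightarrow> (e ^^ j) (\<lambda>p. c * F p) = (\<lambda>p. c * (e ^^ j) F p)"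
  by (induction j) (simp_all add: e_m1_cmult Omega0_e_pow)

lemma e_pow_commute: "(e ^^ j) (e F) = e ((e ^^ j) F)"
  by (induction j) simp_all

lemma euler_add: "F \<in> Omega0 \<Longrightarrow> G \<in> Omega0 \<Longrightarrow> euler N (\<lambda>p. F p + G p) = (\<lambda>p. euler N F p + euler N G p)"
  by (simp add: euler_def[abs_def] partial_rules e_pow_add Omega0_intros distrib_left sum.distrib)

lemma euler_cmult: "F \<in> Omega0 \<Longrightarrow> euler N (\<lambda>p. c * F p) = (\<lambda>p. c * euler N F p)"
  by (simp add: euler_def[abs_def] partial_rules e_pow_cmult Omega0_intros sum_distrib_left mult_ac)

text \<open>The index shift of \<open>d_uj_e\<close> telescopes the alternating sum and the last
  term vanishes beyond the order of F. The term \<open>d_u F\<close> is left over because the sum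
  starts at u_0 and does not include the coordinate \<open>u\<close> itself.\<close>

lemma euler_e:
  assumes F: "F \<in> Omega0" "of_order k F" "k < N"
  shows "euler N (e F) = d_u F"
proof
  fix p
  have "euler N (e F) p = d_u F p + (- 1) ^ N * (e ^^ Suc N) (d_uj N F) p" for N
  proof (induction N)
    case 0
    show ?case by (simp add: euler_def d_uj_e[OF F(1)])
  next
    case (Suc N)
    have "(e ^^ Suc N) (d_uj (Suc N) (e F)) p = (e ^^ Suc (Suc N)) (d_uj (Suc N) F) p + (e ^^ Suc N) (d_uj N F) p"
      unfolding d_uj_e(1)[OF F(1)] by (subst e_pow_add) (simp_all add: Omega0_e Omega0_intros F e_pow_commute)
    then show ?case using Suc by (simp add: euler_def algebra_simps)
  qed
  from this[of N] show "euler N (e F) p = d_u F p"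
    using d_uj_order(1)[OF F(2,3)] e_pow_0[of "Suc N"] by (simp del: funpow.simps)
qed

text \<open>Write q e P - P e q = e (q P) - 2 P e q. The first part is annihilated, as q P is free
  of \<open>u\<close>. In the second, the derivatives of \<open>e q_fun\<close> are 1 in direction
  u_0 and z in direction u_1, so they contribute P - e (z P) = - z e P.\<close>

lemma euler_current:
  assumes P: "P \<in> Omega0" "d_u P = (\<lambda>p. 0)"
  obtains N0 where "\<And>N p. N0 \<le> N \<Longrightarrow> euler N (\<lambda>p. c * (q_fun p * e P p - P p * e q_fun p)) p
    = - 2 * c * ((\<Sum>j\<le>N. (- 1) ^ j * (e ^^ j) (\<lambda>p. d_uj j P p * e q_fun p) p) - zc p * e P p)"
proof -
  have qP: "(\<lambda>p. q_fun p * P p) \<in> Omega0" by (intro Omega0_intros partial_q(1) P)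
  obtain k where k: "of_order k (\<lambda>p. q_fun p * P p)" using qP by (auto simp: Omega0_iff)
  have q: "q_fun = (\<lambda>p. zc p * uj 0 p - cnj (zc p) * cnj (uj 0 p))" by (simp add: fun_eq_iff q_fun_def)
  have qu: "d_u q_fun = (\<lambda>p. 0)" unfolding q by (simp add: partial_rules Omega0_intros)
  have main: "euler N (\<lambda>p. c * (q_fun p * e P p - P p * e q_fun p)) p
    = - 2 * c * ((\<Sum>j\<le>N. (- 1) ^ j * (e ^^ j) (\<lambda>p. d_uj j P p * e q_fun p) p) - zc p * e P p)" if N: "Suc k \<le> N" for N p
  proof -
    have A: "(\<lambda>p. c * (q_fun p * e P p - P p * e q_fun p)) = (\<lambda>p. c * e (\<lambda>p. q_fun p * P p) p + (- 2 * c) * (P p * e q_fun p))"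
      by (simp add: e_m1_rules partial_q(1) P algebra_simps)
    have O: "e (\<lambda>p. q_fun p * P p) \<in> Omega0" "(\<lambda>p. P p * e q_fun p) \<in> Omega0"
      by (intro Omega0_e qP Omega0_intros P e_q_nobar)+
    have E1: "euler N (e (\<lambda>p. q_fun p * P p)) p = 0"
      using N by (simp add: euler_e[OF qP k] partial_rules partial_q(1) P qu)
    let ?r = "\<lambda>j p. if j = 0 then P p else if j = 1 then P p * zc p else 0"
    have D: "d_uj j (\<lambda>p. P p * e q_fun p) = (\<lambda>p. d_uj j P p * e q_fun p + ?r j p)" for j
      by (auto simp: partial_rules P e_q_nobar)
    have R: "?r j \<in> Omega0" for j by (cases "j = 0"; cases "j = 1") (simp_all add: P Omega0_intros)
    have R': "(\<lambda>p. d_uj j P p * e q_fun p) \<in> Omega0" for j by (intro Omega0_intros P e_q_nobar)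
    have "(e ^^ j) (d_uj j (\<lambda>p. P p * e q_fun p)) p
        = (e ^^ j) (\<lambda>p. d_uj j P p * e q_fun p) p + (e ^^ j) (?r j) p" for j
      by (simp only: D e_pow_add[OF R' R])
    then have "euler N (\<lambda>p. P p * e q_fun p) p = (\<Sum>j\<le>N. (- 1) ^ j * (e ^^ j) (\<lambda>p. d_uj j P p * e q_fun p) p)
       + (\<Sum>j\<le>N. (- 1) ^ j * (e ^^ j) (?r j) p)"
      by (simp add: euler_def distrib_left sum.distrib)
    also have "(\<Sum>j\<le>N. (- 1) ^ j * (e ^^ j) (?r j) p) = (\<Sum>j\<in>{0, 1}. (- 1) ^ j * (e ^^ j) (?r j) p)"
      by (rule sum.mono_neutral_right) (use N in \<open>auto simp: e_pow_0\<close>)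
    also have "\<dots> = - (zc p * e P p)"
      by (simp add: e_m1_rules P Omega0_intros e_fst)
    finally have E2: "euler N (\<lambda>p. P p * e q_fun p) p
        = (\<Sum>j\<le>N. (- 1) ^ j * (e ^^ j) (\<lambda>p. d_uj j P p * e q_fun p) p) + - (zc p * e P p)" .
    show ?thesis
      unfolding A euler_add[OF Omega0_mult[OF Omega0_const O(1)] Omega0_mult[OF Omega0_const O(2)]]
        euler_cmult[OF O(1)] euler_cmult[OF O(2)] E1 E2 by simp
  qed
  show ?thesis by (rule that[of "Suc k"]) (rule main)
qed

lemma symmetry_cnj:
  assumes "symmetry f P" shows "symmetry f (\<lambda>p. cnj (P p))"
proof -
  interpret symmetry f P by fact
  show ?thesis
  proof unfold_locales
    show "eb (e (\<lambda>p. cnj (P p))) = (\<lambda>p. - (fu p * cnj (P p)))"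
      by (simp add: e_m1_cnj P_eq e_eb_commute[OF P_Omega0])
    show "d_ujbar j (d_uj i (\<lambda>p. cnj (P p))) = (\<lambda>p. 0)" for i j
      using derivation_commute[OF derivation_partial(4) derivation_partial(5) P_Omega0, of j i] P_mixed
      by (simp add: d_cnj P_Omega0 Omega0_intros)
  qed (simp_all add: d_cnj P_Omega0 Omega0_intros P_u)
qed

text \<open>Apply the Euler operator to e F and to e of the conjugate of F: both compute
  \<open>d_u F\<close>, up to conjugation. W is the Euler sum for the conjugate of P, whose
  coefficients are free of conjugate jets.\<close>

lemma euler_identity_exact:
  assumes P: "symmetry f P" and F: "F \<in> Omega0" and c: "c \<noteq> 0"
    and A: "e F = (\<lambda>p. c * (q_fun p * e P p - P p * e q_fun p))"
    and B: "eb F = (\<lambda>p. - c * (q_fun p * eb P p - P p * eb q_fun p))"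
  obtains N0 where "\<And>N. N0 \<le> N \<Longrightarrow> \<exists>W\<in>nobar. \<forall>p. (\<Sum>j\<le>N. (- 1) ^ j * (e ^^ j) (\<lambda>p. d_uj j P p * e q_fun p) p)
      - zc p * e P p = cnj (W p) - cnj (zc p) * eb P p"
proof -
  interpret P: symmetry f P by fact
  interpret P': symmetry f "\<lambda>p. cnj (P p)" by (rule symmetry_cnj[OF P])
  obtain N1 where N1: "\<And>N p. N1 \<le> N \<Longrightarrow> euler N (\<lambda>p. c * (q_fun p * e P p - P p * e q_fun p)) p
    = - 2 * c * ((\<Sum>j\<le>N. (- 1) ^ j * (e ^^ j) (\<lambda>p. d_uj j P p * e q_fun p) p) - zc p * e P p)"
    by (rule euler_current[OF P.P_Omega0 P.P_u]) (rule that)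
  let ?Q = "\<lambda>p. cnj (P p)" and ?F = "\<lambda>p. cnj (F p)"
  obtain N2 where N2: "\<And>N p. N2 \<le> N \<Longrightarrow> euler N (\<lambda>p. cnj c * (q_fun p * e ?Q p - ?Q p * e q_fun p)) p
    = - 2 * cnj c * ((\<Sum>j\<le>N. (- 1) ^ j * (e ^^ j) (\<lambda>p. d_uj j ?Q p * e q_fun p) p) - zc p * e ?Q p)"
    by (rule euler_current[OF P'.P_Omega0 P'.P_u]) (rule that)
  obtain k where k: "of_order k F" using F by (auto simp: Omega0_iff)
  have k': "of_order k ?F" using k by (simp add: of_order_def)
  have q: "cnj (q_fun p) = - q_fun p" for p by (simp add: q_fun_def)
  have A': "e ?F = (\<lambda>p. cnj c * (q_fun p * e ?Q p - ?Q p * e q_fun p))"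
    by (simp add: e_m1_cnj B q partial_q(3) algebra_simps)
  have main: "\<exists>W\<in>nobar. \<forall>p. (\<Sum>j\<le>N. (- 1) ^ j * (e ^^ j) (\<lambda>p. d_uj j P p * e q_fun p) p)
      - zc p * e P p = cnj (W p) - cnj (zc p) * eb P p" if N: "max (max N1 N2) (Suc k) \<le> N" for N
  proof
    let ?W = "\<lambda>p. \<Sum>j\<le>N. (- 1) ^ j * (e ^^ j) (\<lambda>p. d_uj j ?Q p * e q_fun p) p"
    show "?W \<in> nobar" by (intro nobar_sum nobar_mult nobar_const nobar_e_pow P'.w_nobar)
    show "\<forall>p. (\<Sum>j\<le>N. (- 1) ^ j * (e ^^ j) (\<lambda>p. d_uj j P p * e q_fun p) p) - zc p * e P p
        = cnj (?W p) - cnj (zc p) * eb P p"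
    proof
      fix p
      have "d_u F p = - 2 * c * ((\<Sum>j\<le>N. (- 1) ^ j * (e ^^ j) (\<lambda>p. d_uj j P p * e q_fun p) p) - zc p * e P p)"
        using N1[of N p] N euler_e[OF F k, of N] by (simp add: A)
      moreover have "d_u ?F p = - 2 * cnj c * (?W p - zc p * e ?Q p)"
        using N2[of N p] N euler_e[OF Omega0_cnj[OF F] k', of N] by (simp add: A')
      then have "cnj (d_u ?F p) = - 2 * c * (cnj (?W p) - cnj (zc p) * eb P p)"
        by (simp add: e_m1_cnj)
      moreover have "cnj (d_u ?F p) = d_u F p" by (simp add: d_cnj F)
      ultimately have "- 2 * c * ((\<Sum>j\<le>N. (- 1) ^ j * (e ^^ j) (\<lambda>p. d_uj j P p * e q_fun p) p) - zc p * e P p)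
          = - 2 * c * (cnj (?W p) - cnj (zc p) * eb P p)" by simp
      then show "(\<Sum>j\<le>N. (- 1) ^ j * (e ^^ j) (\<lambda>p. d_uj j P p * e q_fun p) p) - zc p * e P p
        = cnj (?W p) - cnj (zc p) * eb P p" using c by (simp only: mult_cancel_left) simp
    qed
  qed
  show ?thesis by (rule that[of "max (max N1 N2) (Suc k)"]) (rule main)
qed

lemma weighted_degree_cnj:
  assumes "weighted_degree P d" shows "weighted_degree (\<lambda>p. cnj (P p)) (- d)"
  unfolding weighted_degree_def
proof (intro allI impI)
  fix l :: complex and p assume l: "cmod l = 1"
  then have "cnj l = inverse l"
    by (metis complex_div_cnj complex_norm_square divide_inverse inverse_unique mult.commute of_real_1 one_power2)
  then show "cnj (P (rot l p)) = l powi - d * cnj (P p)"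
    using assms l by (simp add: weighted_degree_def power_int_minus power_int_inverse)
qed

text \<open>Applied to P and to its conjugate, \<open>p_zero\<close> leaves a function of z and its
  conjugate only. The symmetry equation at two values of \<open>u\<close> with different f_u then
  gives P = 0.\<close>

lemma exact_current_zero:
  assumes P: "symmetry f P" and F: "F \<in> Omega0" and c: "c \<noteq> 0"
    and A: "e F = (\<lambda>p. c * (q_fun p * e P p - P p * e q_fun p))"
    and B: "eb F = (\<lambda>p. - c * (q_fun p * eb P p - P p * eb q_fun p))"
    and nonlinear: "\<And>c. \<exists>x. deriv f x \<noteq> c" and wt: "weighted_degree P d" and d: "d \<noteq> 0"
  shows "P = (\<lambda>p. 0)"
proof -
  interpret P: symmetry f P by fact
  interpret P': symmetry f "\<lambda>p. cnj (P p)" by (rule symmetry_cnj[OF P])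
  obtain N0 where N0: "\<And>N. N0 \<le> N \<Longrightarrow> \<exists>W\<in>nobar. \<forall>p. (\<Sum>j\<le>N. (- 1) ^ j * (e ^^ j) (\<lambda>p. d_uj j P p * e q_fun p) p)
      - zc p * e P p = cnj (W p) - cnj (zc p) * eb P p"
    by (rule euler_identity_exact[OF P F c A B]) (rule that)
  have p0: "d_uj j P = (\<lambda>p. 0)" for j by (rule P.p_zero[OF nonlinear N0 wt d])
  let ?Q = "\<lambda>p. cnj (P p)" and ?F = "\<lambda>p. cnj (F p)"
  have q: "cnj (q_fun p) = - q_fun p" for p by (simp add: q_fun_def)
  have A': "e ?F = (\<lambda>p. cnj c * (q_fun p * e ?Q p - ?Q p * e q_fun p))"
    by (simp add: e_m1_cnj B q partial_q(3) algebra_simps)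
  have B': "eb ?F = (\<lambda>p. - cnj c * (q_fun p * eb ?Q p - ?Q p * eb q_fun p))"
    by (simp add: e_m1_cnj A q partial_q(3) algebra_simps)
  have c': "cnj c \<noteq> 0" using c by simp
  obtain N1 where N1: "\<And>N. N1 \<le> N \<Longrightarrow> \<exists>W\<in>nobar. \<forall>p. (\<Sum>j\<le>N. (- 1) ^ j * (e ^^ j) (\<lambda>p. d_uj j ?Q p * e q_fun p) p)
      - zc p * e ?Q p = cnj (W p) - cnj (zc p) * eb ?Q p"
    by (rule euler_identity_exact[OF symmetry_cnj[OF P] Omega0_cnj[OF F] c' A' B']) (rule that)
  have d': "- d \<noteq> 0" using d by simp
  have "d_uj j ?Q = (\<lambda>p. 0)" for j
    by (rule P'.p_zero[OF nonlinear N1 weighted_degree_cnj[OF wt] d'])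
  then have pb0: "d_ujbar j P = (\<lambda>p. 0)" for j
    by (simp add: d_cnj P.P_Omega0 fun_eq_iff)
  obtain k where k: "of_order k P" using P.P_Omega0 by (auto simp: Omega0_iff)
  have eP: "e P = d_z P"
    using e_m1_sum[OF k order_refl, of f] by (simp add: fun_eq_iff p0 pb0 P.P_u)
  have hol: "d_z P \<in> hol"
    by (rule hol_partial) (simp add: hol_def nobar_def P.P_Omega0 P.P_u pb0)
  have "d_uj j (d_z P) = (\<lambda>p. 0)" for j
    by (simp add: derivation_commute[OF derivation_partial(4) derivation_partial(1) P.P_Omega0] p0)
  from eb_hol[OF hol this] have "eb (e P) p = d_zbar (d_z P) p" for p
    by (simp add: eP \<open>\<And>j. d_uj j (d_z P) = (\<lambda>p. 0)\<close>)
  then have "d_zbar (d_z P) p = - (fu p * P p)" for p using fun_cong[OF P.P_eq, of p] by (simp only:)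
  then have eq: "d_zbar (d_z P) p + fu p * P p = 0" for p by simp
  have "P p = 0" for p
  proof -
    have fr: "d_zbar (d_z P) p + of_real (deriv f x) * P p = 0" for x
      using eq[of "freeze_u x p"] hol_freeze[OF hol_partial(2)[OF hol]] freeze_u_const[OF P.P_Omega0 P.P_u] by simp
    obtain x where "deriv f x \<noteq> deriv f 0" using nonlinear by blast
    moreover have "of_real (deriv f x) * P p = of_real (deriv f 0) * P p"
      using fr[of x] fr[of 0] by algebra
    ultimately show ?thesis by simp
  qed
  then show ?thesis by auto
qed

end

section \<open>Injectivity\<close>

lemma partial_divide:
  assumes "derivation D" "F \<in> Omega0" shows "D (\<lambda>p. F p / c) = (\<lambda>p. D F p / c)"
  using derivation_cmult[OF assms, of "1 / c"] by simp

lemma e_m1_divide: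
  assumes "F \<in> Omega0"
  shows "e_m1 f (\<lambda>p. F p / c) = (\<lambda>p. e_m1 f F p / c)" "e_m1bar f (\<lambda>p. F p / c) = (\<lambda>p. e_m1bar f F p / c)"
  using e_m1_cmult[OF assms, of f "1 / c"] by simp_all

context poisson
begin

text \<open>Equal symbols mean a difference in the ideal, which is a coboundary of the quotient
  complex.\<close>

lemma class_eqI:
  assumes "has_symbol \<alpha> A B" "has_symbol \<beta> A B" "e B = eb A"
  shows "H1_class f \<alpha> = H1_class f \<beta>"
  using H1_class_eq_iff[OF has_symbol_Z1[OF assms(1,3)] has_symbol_Z1[OF assms(2,3)]]
    ideal1_B1[OF has_symbol_diff_ideal1[OF assms(1,2)]] by simp

lemma e_eb_q: "eb (e q_fun) = (\<lambda>p. - (fu p * q_fun p))"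
proof -
  have T1: "T (Suc 0) = (\<lambda>p. uj 0 p * fu p)" by (simp add: fun_eq_iff partial_f)
  have T0: "(\<lambda>p. T 0 p) \<in> Omega0" "eb (\<lambda>p. T 0 p) = (\<lambda>p. cnj (uj 0 p) * fu p)"
    using T_Omega0[of 0] e_f(2)[OF DERIV_f Omega0_f(1)] by simp_all
  show ?thesis unfolding partial_q(2)
    by (simp add: e_m1_rules Omega0_intros e_uj e_fst T0 T1 q_fun_def fun_eq_iff algebra_simps
        del: jetT.simps)
qed

lemma phi_symbol:
  assumes P: "P \<in> Omega0" and d: "d \<noteq> 0"
  shows "has_symbol (phi f h d P) (\<lambda>p. 1 / (2 * \<i> * of_int d) * (q_fun p * e P p - P p * e q_fun p))
     (\<lambda>p. - (1 / (2 * \<i> * of_int d)) * (q_fun p * eb P p - P p * eb q_fun p))"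
proof -
  have "phi f h d P = (\<lambda>p v. 1 / (\<i> * of_int d) * interior v_rot (Phi f P) p v)"
    using d by (simp add: phi_def smult1_def)
  moreover have k: "1 / (2 * \<i> * of_int d) = 1 / (\<i> * of_int d) * (1 / 2)" by simp
  have "(\<lambda>p. 1 / (2 * \<i> * of_int d) * (q_fun p * e P p - P p * e q_fun p))
      = (\<lambda>p. 1 / (\<i> * of_int d) * ((q_fun p * e P p - P p * e q_fun p) / 2))"
    "(\<lambda>p. - (1 / (2 * \<i> * of_int d)) * (q_fun p * eb P p - P p * eb q_fun p))
      = (\<lambda>p. 1 / (\<i> * of_int d) * (- (q_fun p * eb P p - P p * eb q_fun p) / 2))"
    unfolding k by (simp_all add: algebra_simps diff_divide_distrib)
  ultimately show ?thesis
    using has_symbol_smult[OF Omega0_const has_symbol_Phi[OF P], of "1 / (\<i> * of_int d)"] by (simp only:)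
qed

text \<open>Green's identity: the products of first derivatives cancel, and both q and P satisfy the
  same linear equation, so the terms with \<open>f\<^sub>u\<close> cancel as well.\<close>

lemma current_closed:
  assumes P: "P \<in> Omega0" "eb (e P) = (\<lambda>p. - (fu p * P p))"
  shows "e (\<lambda>p. - c * (q_fun p * eb P p - P p * eb q_fun p)) = eb (\<lambda>p. c * (q_fun p * e P p - P p * e q_fun p))"
proof -
  have "e (eb P) = (\<lambda>p. - (fu p * P p))" "e (eb q_fun) = (\<lambda>p. - (fu p * q_fun p))"
    using e_eb_commute[OF P(1)] e_eb_commute[OF partial_q(1)] P(2) e_eb_q by simp_all
  then show ?thesis
    by (simp add: e_m1_rules Omega0_intros Omega0_e Omega0_eb P partial_q(1) e_eb_q algebra_simps
        del: mult_minus_left)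
qed

lemma V_space_add:
  assumes "P \<in> V_space f d" "Q \<in> V_space f d"
  shows "(\<lambda>p. a * P p + b * Q p) \<in> V_space f d"
proof -
  have P: "P \<in> Omega0" "Q \<in> Omega0" "weighted_degree P d" "weighted_degree Q d"
    "\<And>p. eb (e P) p = - (fu p * P p)" "\<And>p. eb (e Q) p = - (fu p * Q p)"
    "d_u P = (\<lambda>p. 0)" "d_u Q = (\<lambda>p. 0)"
    "\<And>i j. d_ujbar j (d_uj i P) = (\<lambda>p. 0)" "\<And>i j. d_ujbar j (d_uj i Q) = (\<lambda>p. 0)"
    using assms by (auto simp: V_space_def add_eq_0_iff fun_eq_iff)
  show ?thesis unfolding V_space_def
    using P(3,4)
    by (simp add: P e_m1_rules e_m1_cmult partial_rules Omega0_intros Omega0_e weighted_degree_def algebra_simps)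
qed

end

context poisson_indep
begin

lemma V_space_symmetry: "P \<in> V_space f d \<Longrightarrow> symmetry f P"
  by unfold_locales (auto simp: V_space_def fun_eq_iff add_eq_0_iff)

text \<open>When f_u is constant the symmetry equation has constant coefficients, and the rotation
  field R, which is z e minus its conjugate, maps symmetries to symmetries. Since
  \<open>q_fun\<close> is R u, further elements of weight 0 are R^3 u and so on; the function used
  here is R^3 u - R u, which explains the coefficients of W.\<close>

lemma V_space_linear_f:
  assumes lin: "\<And>x. deriv f x = \<alpha>"
  shows "\<exists>P\<in>V_space f 0. \<forall>c. P \<noteq> (\<lambda>p. c * q_fun p)"
proof -
  let ?a = "complex_of_real \<alpha>"
  have fu: "fu = (\<lambda>p. ?a)" by (simp add: lin)
  have T: "T (Suc i) = (\<lambda>p. ?a * uj i p)" for i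
  proof (induction i)
    case 0
    show ?case by (simp add: partial_f lin fun_eq_iff)
  next
    case (Suc i)
    then show ?case using e_T[of "Suc i"] by (simp add: e_m1_cmult Omega0_intros e_uj del: jetT.simps)
  qed
  have T0: "(\<lambda>p. T 0 p) \<in> Omega0" "e (\<lambda>p. T 0 p) = (\<lambda>p. uj 0 p * ?a)" "eb (\<lambda>p. T 0 p) = (\<lambda>p. cnj (uj 0 p) * ?a)"
    "cnj (T 0 p) = T 0 p" for p
    using T_Omega0[of 0] e_f[OF DERIV_f Omega0_f(1)] by (simp_all add: lin)
  have T12: "T (Suc 0) = (\<lambda>p. ?a * uj 0 p)" "T (Suc (Suc 0)) = (\<lambda>p. ?a * uj (Suc 0) p)" "T 2 = (\<lambda>p. ?a * uj (Suc 0) p)" "T 3 = (\<lambda>p. ?a * uj 2 p)"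
    using T[of 0] T[of 1] T[of 2] by (simp_all only: numeral_3_eq_3 numeral_2_eq_2 One_nat_def)
  define W where "W = (\<lambda>p. zc p * zc p * zc p * uj 2 p + 3 * (zc p * zc p * uj 1 p) + 3 * ?a * (zc p * zc p * cnj (zc p) * uj 0 p))"
  have zb_hol: "(\<lambda>p. cnj (zc p)) \<in> hol" "fst \<in> hol"
    by (simp_all add: hol_def nobar_def Omega0_intros d_cnj)
  have W: "W \<in> hol"
    unfolding W_def by (intro hol_add hol_mult hol_const zb_hol hol_uj)
  have W0: "W \<in> Omega0" using W holD by blast
  let ?P = "\<lambda>p. W p - cnj (W p)"
  have eW: "e W = (\<lambda>p. zc p * zc p * zc p * uj 3 p + 6 * (zc p * zc p * uj 2 p) + 6 * (zc p * uj 1 p)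
      + ?a * (6 * (zc p * cnj (zc p) * uj 0 p) + 3 * (zc p * zc p * cnj (zc p) * uj 1 p)))"
    unfolding W_def
    by (simp add: e_m1_rules Omega0_intros e_fst e_uj fun_eq_iff numeral_3_eq_3 numeral_2_eq_2 del: jetT.simps)
  have ebW: "eb W = (\<lambda>p. - ?a * (zc p * zc p * zc p * uj 1 p + 3 * (zc p * zc p * cnj (zc p) * T 0 p)))"
    unfolding W_def
    by (simp add: e_m1_rules Omega0_intros e_fst e_uj fun_eq_iff T12 del: jetT.simps)
      (simp add: algebra_simps)
  have e_W: "eb (e W) = (\<lambda>p. - ?a * W p - 6 * ?a * (zc p * cnj (zc p) * T 0 p))"
    unfolding eW W_def
    by (simp add: e_m1_rules Omega0_intros e_fst e_uj fun_eq_iff T12 del: jetT.simps)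
      (simp add: algebra_simps)
  have "?P \<in> V_space f 0"
    unfolding V_space_def
  proof (intro CollectI conjI allI)
    show "?P \<in> Omega0" by (intro Omega0_intros W0)
    show "weighted_degree ?P 0"
    proof -
      have "W (rot l p) = W p" if l: "cmod l = 1" for l p
      proof -
        have "cnj l * l = 1" using l complex_norm_square[of l] by (simp add: mult.commute)
        moreover have "l \<noteq> 0" using l by auto
        ultimately have cl: "cnj (inverse l) = l" by (metis complex_cnj_inverse inverse_inverse_eq inverse_unique)
        have l1: "inverse l * l = 1" using \<open>l \<noteq> 0\<close> by simp
        have cz: "cnj (inverse l * zc p) = l * cnj (zc p)" by (simp only: complex_cnj_mult cl)
        have "W (rot l p) = (inverse l * l) ^ 3 * (zc p * zc p * zc p * uj 2 p) + 3 * ((inverse l * l) ^ 2 * (zc p * zc p * uj 1 p))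
          + 3 * ?a * ((inverse l * l) ^ 2 * (zc p * zc p * cnj (zc p) * uj 0 p))"
          unfolding W_def rot_def fst_conv snd_conv cz
          by (simp only: numeral_2_eq_2 numeral_3_eq_3 power.simps) (simp add: mult_ac)
        then show ?thesis unfolding l1 W_def by simp
      qed
      then show ?thesis by (simp add: weighted_degree_def)
    qed
    show "eb (e ?P) p + of_real (deriv f (uc p)) * ?P p = 0" for p
    proof -
      have "eb (e ?P) = (\<lambda>p. eb (e W) p - cnj (eb (e W) p))"
        by (simp add: e_m1_rules Omega0_intros W0 Omega0_e Omega0_eb e_eb_commute[OF W0])
      then show ?thesis unfolding e_W by (simp add: lin T0(4) algebra_simps del: jetT.simps)
    qed
    show "d_u ?P p = 0" for p by (simp add: partial_rules Omega0_intros W0 holD[OF W])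
    show "d_ujbar j (d_uj i ?P) p = 0" for i j p
      using holD(4)[OF hol_partial(3)[OF W]]
      by (simp add: partial_rules Omega0_intros W0 holD(4)[OF W])
  qed
  moreover have "?P \<noteq> (\<lambda>p. c * q_fun p)" for c
  proof
    assume eq: "?P = (\<lambda>p. c * q_fun p)"
    \<comment> \<open>At z = 1 with u_2 = \<open>\<i>\<close> as the only nonzero jet,
      \<open>q_fun\<close> vanishes and the left side is 2 \<open>\<i>\<close>.\<close>
    show False using fun_cong[OF eq, of "(1, 0, 0(2 := \<i>))"] by (simp add: W_def q_fun_def)
  qed
  ultimately show ?thesis by blast
qed

lemma V_space_nonlinear_f:
  assumes "V_space f 0 = {(\<lambda>p. c * q_fun p) | c. True}"
  shows "\<exists>x. deriv f x \<noteq> \<alpha>"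
  using V_space_linear_f[of \<alpha>] assms by blast

text \<open>The Green current is linear in its second argument, so the difference of two forms has
  the current of Q - P as symbol, and \<open>exact_current_zero\<close> applies to Q - P.\<close>

lemma phi_injective:
  assumes d: "d \<noteq> 0" and nonlinear: "\<And>c. \<exists>x. deriv f x \<noteq> c"
    and P: "P \<in> V_space f d" and Q: "Q \<in> V_space f d" and eq: "phi f h d Q - phi f h d P \<in> B1 f"
  shows "P = Q"
proof -
  let ?k = "1 / (2 * \<i> * of_int d)"
  let ?R = "\<lambda>p. 1 * Q p + (- 1) * P p"
  have O: "P \<in> Omega0" "Q \<in> Omega0" using P Q by (auto simp: V_space_def)
  have R: "?R \<in> V_space f d" by (rule V_space_add[OF Q P])
  have k: "?k \<noteq> 0" using d by simp
  have "has_symbol (\<lambda>p v. phi f h d Q p v + (- 1) * phi f h d P p v)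
      (\<lambda>p. ?k * (q_fun p * e Q p - Q p * e q_fun p) + (- 1) * (?k * (q_fun p * e P p - P p * e q_fun p)))
      (\<lambda>p. - ?k * (q_fun p * eb Q p - Q p * eb q_fun p) + (- 1) * (- ?k * (q_fun p * eb P p - P p * eb q_fun p)))"
    by (intro has_symbol_add has_symbol_smult phi_symbol O d Omega0_const)
  moreover have "(\<lambda>p v. phi f h d Q p v + (- 1) * phi f h d P p v) = phi f h d Q - phi f h d P"
    by (simp add: fun_eq_iff)
  ultimately have sym: "has_symbol (phi f h d Q - phi f h d P)
      (\<lambda>p. ?k * (q_fun p * e Q p - Q p * e q_fun p) + (- 1) * (?k * (q_fun p * e P p - P p * e q_fun p)))
      (\<lambda>p. - ?k * (q_fun p * eb Q p - Q p * eb q_fun p) + (- 1) * (- ?k * (q_fun p * eb P p - P p * eb q_fun p)))"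
    by (simp only:)
  obtain F where F: "F \<in> Omega0"
    "e F = (\<lambda>p. ?k * (q_fun p * e Q p - Q p * e q_fun p) + (- 1) * (?k * (q_fun p * e P p - P p * e q_fun p)))"
    "eb F = (\<lambda>p. - ?k * (q_fun p * eb Q p - Q p * eb q_fun p) + (- 1) * (- ?k * (q_fun p * eb P p - P p * eb q_fun p)))"
    by (rule B1_symbol[OF eq sym]) (rule that)
  have eR: "e ?R = (\<lambda>p. e Q p - e P p)" "eb ?R = (\<lambda>p. eb Q p - eb P p)"
    by (simp_all add: e_m1_rules O Omega0_intros)
  have al: "k * (q * eQ - Q * w) + (- 1) * (k * (q * eP - P * w)) = k * (q * (eQ - eP) - (1 * Q + (- 1) * P) * w)"
    "- k * (q * eQ - Q * w) + (- 1) * (- k * (q * eP - P * w)) = - k * (q * (eQ - eP) - (1 * Q + (- 1) * P) * w)"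
    for k q eQ eP P Q w :: complex by (simp_all add: algebra_simps)
  have "?R = (\<lambda>p. 0)"
  proof (rule exact_current_zero[OF V_space_symmetry[OF R] F(1) k _ _ nonlinear _ d])
    show "e F = (\<lambda>p. ?k * (q_fun p * e ?R p - ?R p * e q_fun p))"
      unfolding F(2) eR by (rule ext, rule al(1))
    show "eb F = (\<lambda>p. - ?k * (q_fun p * eb ?R p - ?R p * eb q_fun p))"
      unfolding F(3) eR by (rule ext, rule al(2))
    show "weighted_degree ?R d" using R by (simp add: V_space_def)
  qed
  then show ?thesis by (simp add: fun_eq_iff)
qed

end

section \<open>The class in weight zero\<close>

locale poisson_antideriv = poisson_indep +
  fixes h :: "real \<Rightarrow> real"
  assumes antideriv: "\<forall>x. (h has_real_derivative f x) (at x)"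
begin

abbreviation E0 :: "jet \<Rightarrow> complex" where
  "E0 \<equiv> \<lambda>p. - (1/2) * zc p * (uj 0 p * uj 0 p) + cnj (zc p) * of_real (h (uc p))"

lemma Omega0_h: "(\<lambda>p. of_real (h (uc p))) \<in> Omega0"
proof (rule Omega0_of_real_u)
  have h: "deriv h = f" using antideriv by (auto intro: DERIV_imp_deriv)
  have "h differentiable_on UNIV"
    using antideriv by (auto simp: differentiable_on_def real_differentiable_def)
  then have "(deriv ^^ n) h differentiable_on UNIV" for n
  proof (cases n)
    case (Suc m)
    then show ?thesis using smooth_f by (simp only: funpow_Suc_right o_apply h)
  qed simp
  then show "\<forall>n. (deriv ^^ n) h differentiable_on UNIV" by blast
qed

lemma E0_Omega0: "E0 \<in> Omega0" "(\<lambda>p. cnj (E0 p)) \<in> Omega0"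
  by (intro Omega0_intros Omega0_h)+

lemma phi0_symbol: "has_symbol (phi0 f h) E0 (\<lambda>p. cnj (E0 p))"
proof (rule has_symbolI)
  show "(\<lambda>p v. (- (1/2) * (zc p * uj 0 p + cnj (zc p) * cnj (uj 0 p))) * eta f 0 p v) \<in> ideal1 f"
    by (intro ideal1_smult' ideal1_eta Omega0_intros)
  show "phi0 f h p v = E0 p * zc v + cnj (E0 p) * cnj (zc v)
      + (- (1/2) * (zc p * uj 0 p + cnj (zc p) * cnj (uj 0 p))) * eta f 0 p v" for p v
    by (simp add: phi0_def Let_def smult1_def cnj1_def zeta_def power2_eq_square del: eta.simps)
qed (rule E0_Omega0)+

text \<open>The left side is the conjugate of the right one, which is real.\<close>

lemma phi0_closed: "e (\<lambda>p. cnj (E0 p)) = eb E0"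
proof -
  have "eb (\<lambda>p. of_real (h (uc p))) = (\<lambda>p. cnj (uj 0 p) * of_real (f (uc p)))"
    by (rule e_f(2)) (use antideriv Omega0_h in auto)
  then have eb: "eb E0 = (\<lambda>p. zc p * uj 0 p * of_real (f (uc p)) + of_real (h (uc p))
      + cnj (zc p) * cnj (uj 0 p) * of_real (f (uc p)))"
    by (simp add: e_m1_rules e_m1_divide Omega0_intros Omega0_h e_fst e_uj algebra_simps)
  have "e (\<lambda>p. cnj (E0 p)) = (\<lambda>p. cnj (eb E0 p))" by (rule e_m1_cnj)
  also have "\<dots> = eb E0" unfolding eb by (simp add: fun_eq_iff algebra_simps)
  finally show ?thesis .
qed

lemma phi_0_symbol:
  "has_symbol (phi f h 0 (\<lambda>p. c * q_fun p)) (\<lambda>p. - \<i> * c * E0 p) (\<lambda>p. - \<i> * c * cnj (E0 p))"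
proof -
  \<comment> \<open>The test point z = 1, u_0 = \<open>\<i>\<close> has \<open>q_fun\<close> = 2
    \<open>\<i>\<close>, so the definite description picks out c.\<close>
  have "c' = c" if "(\<lambda>p. c * q_fun p) = (\<lambda>p. c' * q_fun p)" for c'
    using fun_cong[OF that, of "(1, 0, 0(0 := \<i>))"] by (simp add: q_fun_def)
  then have "(THE c'. (\<lambda>p. c * q_fun p) = (\<lambda>p. c' * q_fun p)) = c" by (intro the_equality) auto
  then have "phi f h 0 (\<lambda>p. c * q_fun p) = (\<lambda>p v. - \<i> * c * phi0 f h p v)"
    by (simp add: phi_def smult1_def)
  then show ?thesis using has_symbol_smult[OF Omega0_const phi0_symbol, of "- \<i> * c"] by simp
qed

lemma phi_0_closed: "e (\<lambda>p. c * cnj (E0 p)) = eb (\<lambda>p. c * E0 p)"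
  unfolding e_m1_cmult(1)[OF E0_Omega0(2)] e_m1_cmult(2)[OF E0_Omega0(1)] phi0_closed ..

text \<open>The total derivative of F would involve no jet beyond u_0, so by descent F has no
  holomorphic jet derivatives. Then \<open>d_u F\<close> is the u_0-derivative of e F, namely - c z
  u_0, yet it must itself be independent of u_0.\<close>

lemma E0_not_exact:
  assumes F: "F \<in> Omega0" "e F = (\<lambda>p. c * E0 p)"
  shows "c = 0"
proof -
  have E: "d_uj j (e F) = (\<lambda>p. if j = 0 then - c * (zc p * uj 0 p) else 0)" for j
    unfolding F(2)
    by (simp add: partial_rules derivation_partial[THEN partial_divide] Omega0_intros Omega0_h partial_of_real_u[OF antideriv[rule_format]] fun_eq_iff)
  have F0: "d_uj j F = (\<lambda>p. 0)" for j
  proof (rule order_descent[OF F(1)])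
    fix m assume "\<And>j. m < j \<Longrightarrow> d_uj j F = (\<lambda>p. 0)"
    then show "d_uj m F = (\<lambda>p. 0)" using E[of "Suc m"] d_uj_e(1)[OF F(1), of m] by simp
  qed
  have "d_u F = (\<lambda>p. - c * (zc p * uj 0 p))" using E[of 0] d_uj_e(2)[OF F(1)] F0 by simp
  moreover have "d_uj 0 (d_u F) = (\<lambda>p. 0)"
    by (simp add: derivation_commute[OF derivation_partial(4) derivation_partial(3) F(1)] F0)
  ultimately have "d_uj 0 (\<lambda>p. - c * (zc p * uj 0 p)) (1, 0, 0) = 0" by simp
  then show ?thesis by (simp add: partial_rules Omega0_intros)
qed

end

text \<open>Linearity is expressed through the operations on cosets, since classes are sets of
  cocycles; additivity and homogeneity accompany injectivity on each
  \<open>V_space f d\<close>.\<close>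

theorem lemma8p14:
  fixes f h :: "real \<Rightarrow> real"
  assumes smooth: "\<forall>n. (deriv ^^ n) f differentiable_on UNIV"
    and indep: "\<forall>a b :: real. (\<forall>x. a * f x + b * deriv f x = 0) \<longrightarrow> a = 0 \<and> b = 0"
    and antideriv: "\<forall>x. (h has_real_derivative f x) (at x)"
    and V0: "V_space f 0 = {(\<lambda>p. c * q_fun p) | c. True}"
  shows "\<forall>d :: int.
     (\<forall>P \<in> V_space f d. H1_class f (phi f h d P) \<in> H1bar f) \<and>
     (\<forall>P \<in> V_space f d. \<forall>Q \<in> V_space f d.
        H1_class f (phi f h d (P + Q))
          = H1_add f (H1_class f (phi f h d P)) (H1_class f (phi f h d Q))) \<and>
     (\<forall>c :: complex. \<forall>P \<in> V_space f d.
        H1_class f (phi f h d (\<lambda>p. c * P p)) = H1_scale f c (H1_class f (phi f h d P))) \<and>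
     inj_on (\<lambda>P. H1_class f (phi f h d P)) (V_space f d)"
proof
  fix d :: int
  interpret poisson_antideriv f h using smooth indep antideriv by unfold_locales
  have nonlinear: "\<exists>x. deriv f x \<noteq> c" for c by (rule V_space_nonlinear_f[OF V0])
  have plus: "P + Q = (\<lambda>p. P p + Q p)" for P Q :: "jet \<Rightarrow> complex" by (simp add: fun_eq_iff)
  have pluss: "\<alpha> + \<beta> = (\<lambda>p v. \<alpha> p v + \<beta> p v)" for \<alpha> \<beta> :: form1 by (simp add: fun_eq_iff)
  show "(\<forall>P \<in> V_space f d. H1_class f (phi f h d P) \<in> H1bar f) \<and>
     (\<forall>P \<in> V_space f d. \<forall>Q \<in> V_space f d.
        H1_class f (phi f h d (P + Q))
          = H1_add f (H1_class f (phi f h d P)) (H1_class f (phi f h d Q))) \<and>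
     (\<forall>c :: complex. \<forall>P \<in> V_space f d.
        H1_class f (phi f h d (\<lambda>p. c * P p)) = H1_scale f c (H1_class f (phi f h d P))) \<and>
     inj_on (\<lambda>P. H1_class f (phi f h d P)) (V_space f d)"
  proof (cases "d = 0")
    case False
    let ?k = "1 / (2 * \<i> * of_int d)"
    let ?A = "\<lambda>P p. ?k * (q_fun p * e P p - P p * e q_fun p)"
    let ?B = "\<lambda>P p. - ?k * (q_fun p * eb P p - P p * eb q_fun p)"
    have al: "k * (q * (x + y) - (P + Q) * w) = k * (q * x - P * w) + k * (q * y - Q * w)"
      "k * (q * (c * x) - c * P * w) = c * (k * (q * x - P * w))" for k q x y P Q w c :: complex
      by (simp_all add: algebra_simps)
    have O: "P \<in> Omega0" if "P \<in> V_space f d" for P using that by (simp add: V_space_def)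
    have cl: "e (?B P) = eb (?A P)" if "P \<in> V_space f d" for P
      by (rule current_closed[OF O[OF that] symmetry.P_eq[OF V_space_symmetry[OF that]]])
    note sym = phi_symbol[OF O False]
    have Z: "phi f h d P \<in> Z1 f" if "P \<in> V_space f d" for P
      by (rule has_symbol_Z1[OF sym[OF that] cl[OF that]])
    have add: "H1_class f (phi f h d (P + Q)) = H1_add f (H1_class f (phi f h d P)) (H1_class f (phi f h d Q))"
      if P: "P \<in> V_space f d" and Q: "Q \<in> V_space f d" for P Q
    proof -
      have PQ: "P + Q \<in> V_space f d" using V_space_add[OF P Q, of 1 1] by (simp add: plus)
      have "?A (P + Q) = (\<lambda>p. ?A P p + ?A Q p)" "?B (P + Q) = (\<lambda>p. ?B P p + ?B Q p)"
        unfolding plus e_m1_add[OF O[OF P] O[OF Q]] by (rule ext, rule al)+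
      then have "has_symbol (phi f h d P + phi f h d Q) (?A (P + Q)) (?B (P + Q))"
        using has_symbol_add[OF sym[OF P] sym[OF Q]] unfolding pluss by (simp only:)
      from class_eqI[OF sym[OF PQ] this cl[OF PQ]] show ?thesis
        by (simp only: H1_add_class[OF Z[OF P] Z[OF Q]])
    qed
    have scale: "H1_class f (phi f h d (\<lambda>p. c * P p)) = H1_scale f c (H1_class f (phi f h d P))"
      if P: "P \<in> V_space f d" for c P
    proof -
      have cP: "(\<lambda>p. c * P p) \<in> V_space f d" using V_space_add[OF P P, of c 0] by simp
      have "?A (\<lambda>p. c * P p) = (\<lambda>p. c * ?A P p)" "?B (\<lambda>p. c * P p) = (\<lambda>p. c * ?B P p)"
        unfolding e_m1_cmult[OF O[OF P]] by (rule ext, rule al)+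
      then have "has_symbol (smult1 (\<lambda>_. c) (phi f h d P)) (?A (\<lambda>p. c * P p)) (?B (\<lambda>p. c * P p))"
        using has_symbol_smult[OF Omega0_const sym[OF P], of c] unfolding smult1_def by (simp only:)
      from class_eqI[OF sym[OF cP] this cl[OF cP]] show ?thesis
        by (simp only: H1_scale_class[OF Z[OF P]])
    qed
    have inj: "inj_on (\<lambda>P. H1_class f (phi f h d P)) (V_space f d)"
      by (rule inj_onI) (use phi_injective[OF False nonlinear] H1_class_eq_iff[OF Z Z] in blast)
    show ?thesis using Z H1_class_in add scale inj by blast
  next
    \<comment> \<open>Here P is a multiple of \<open>q_fun\<close>, so everything reduces to the
      single symbol \<open>E0\<close>, and injectivity to its not being a total derivative.\<close>
    case True
    let ?q = "\<lambda>c p. c * q_fun p"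
    let ?A = "\<lambda>c p. - \<i> * c * E0 p" and ?B = "\<lambda>c p. - \<i> * c * cnj (E0 p)"
    have al: "- \<i> * (a + b) * x = - \<i> * a * x + - \<i> * b * x" "- \<i> * (c * a) * x = c * (- \<i> * a * x)"
      "- \<i> * b * x + (- 1) * (- \<i> * a * x) = (- \<i> * (b - a)) * x" for a b c x :: complex
      by (simp_all add: algebra_simps)
    note sym = phi_0_symbol
    note cl = phi_0_closed
    have Z: "phi f h 0 (?q c) \<in> Z1 f" for c by (rule has_symbol_Z1[OF sym cl])
    have add: "H1_class f (phi f h 0 (?q a + ?q b)) = H1_add f (H1_class f (phi f h 0 (?q a))) (H1_class f (phi f h 0 (?q b)))" for a b
    proof -
      have ab: "?q a + ?q b = ?q (a + b)" by (simp add: fun_eq_iff algebra_simps)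
      have "?A (a + b) = (\<lambda>p. ?A a p + ?A b p)" "?B (a + b) = (\<lambda>p. ?B a p + ?B b p)"
        by (rule ext, rule al)+
      then have "has_symbol (phi f h 0 (?q a) + phi f h 0 (?q b)) (?A (a + b)) (?B (a + b))"
        using has_symbol_add[OF sym[of a] sym[of b]] unfolding pluss by (simp only:)
      from class_eqI[OF sym this cl] show ?thesis unfolding ab
        by (simp only: H1_add_class[OF Z Z])
    qed
    have scale: "H1_class f (phi f h 0 (\<lambda>p. c * ?q a p)) = H1_scale f c (H1_class f (phi f h 0 (?q a)))" for c a
    proof -
      have ca: "(\<lambda>p. c * ?q a p) = ?q (c * a)" by (simp add: fun_eq_iff algebra_simps)
      have "?A (c * a) = (\<lambda>p. c * ?A a p)" "?B (c * a) = (\<lambda>p. c * ?B a p)"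
        by (rule ext, rule al)+
      then have "has_symbol (smult1 (\<lambda>_. c) (phi f h 0 (?q a))) (?A (c * a)) (?B (c * a))"
        using has_symbol_smult[OF Omega0_const sym[of a], of c] unfolding smult1_def by (simp only:)
      from class_eqI[OF sym this cl] show ?thesis unfolding ca
        by (simp only: H1_scale_class[OF Z])
    qed
    have inj: "a = b" if "H1_class f (phi f h 0 (?q a)) = H1_class f (phi f h 0 (?q b))" for a b
    proof -
      have B1: "phi f h 0 (?q b) - phi f h 0 (?q a) \<in> B1 f"
        using that H1_class_eq_iff[OF Z Z] by blast
      have "has_symbol (\<lambda>p v. phi f h 0 (?q b) p v + (- 1) * phi f h 0 (?q a) p v)
          (\<lambda>p. ?A b p + (- 1) * ?A a p) (\<lambda>p. ?B b p + (- 1) * ?B a p)"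
        by (intro has_symbol_add has_symbol_smult sym Omega0_const)
      moreover have "(\<lambda>p v. phi f h 0 (?q b) p v + (- 1) * phi f h 0 (?q a) p v) = phi f h 0 (?q b) - phi f h 0 (?q a)"
        by (simp add: fun_eq_iff)
      ultimately have "has_symbol (phi f h 0 (?q b) - phi f h 0 (?q a))
          (\<lambda>p. ?A b p + (- 1) * ?A a p) (\<lambda>p. ?B b p + (- 1) * ?B a p)"
        by (simp only:)
      from B1 this obtain F where F: "F \<in> Omega0" "e F = (\<lambda>p. ?A b p + (- 1) * ?A a p)"
        by (rule B1_symbol) (rule that)
      have "(\<lambda>p. ?A b p + (- 1) * ?A a p) = (\<lambda>p. (- \<i> * (b - a)) * E0 p)"
        by (rule ext, rule al)
      with F(2) have "e F = (\<lambda>p. (- \<i> * (b - a)) * E0 p)" by (simp only:)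
      from E0_not_exact[OF F(1) this] show ?thesis by simp
    qed
    have Vq: "\<exists>c. P = ?q c" if "P \<in> V_space f d" for P using that V0 True by auto
    show ?thesis
    proof (intro conjI ballI allI inj_onI)
      show "H1_class f (phi f h d P) \<in> H1bar f" if "P \<in> V_space f d" for P
        using Vq[OF that] Z H1_class_in True by auto
      show "H1_class f (phi f h d (P + Q)) = H1_add f (H1_class f (phi f h d P)) (H1_class f (phi f h d Q))"
        if PQ: "P \<in> V_space f d" "Q \<in> V_space f d" for P Q
      proof -
        obtain a b where "P = ?q a" "Q = ?q b" using Vq[OF PQ(1)] Vq[OF PQ(2)] by blast
        then show ?thesis using add[of a b] True by (simp only:)
      qed
      show "H1_class f (phi f h d (\<lambda>p. c * P p)) = H1_scale f c (H1_class f (phi f h d P))"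
        if P: "P \<in> V_space f d" for c P
      proof -
        obtain a where "P = ?q a" using Vq[OF P] by blast
        then show ?thesis using scale[of c a] True by (simp only:)
      qed
      show "P = Q" if PQ: "P \<in> V_space f d" "Q \<in> V_space f d"
        "H1_class f (phi f h d P) = H1_class f (phi f h d Q)" for P Q
      proof -
        obtain a b where ab: "P = ?q a" "Q = ?q b" using Vq[OF PQ(1)] Vq[OF PQ(2)] by blast
        then have "a = b" using PQ(3) True by (intro inj) (simp only:)
        then show ?thesis using ab by simp
      qed
    qed
  qed
qed

end
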